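(* If $\mathbb{P}\{S_0=\infty\}<1$, then for all $\delta\ge0$ and $x\ge0$ $$\mathcal{B}_Z^\delta(x)=\mathbb{E}\left\{\frac{\mathbb{I}\{\epsilon_\delta(Y)>x\}}{\epsilon_\delta(Y)}\right\}<\infty .$$
   Context: Let $d\ge1$. $D$ is the space of generalised c\`adl\`ag functions $f:\mathbb{R}^d\to[0,\infty)$ (limits exist at every point within each of the $2^d$ quadrants, and $f(s)\to f(t)$ as $s\to t$ with $s\ge t$ componentwise), equipped with Skorohod's $J_1$-topology and the $\sigma$-field generated by the projections $f\mapsto f(t)$. The underlying probability space is complete and non-atomic. $Z(t),t\in\mathbb{R}^d$, is a random field with almost all sample paths in $D$ such that $\mathbb{E}\{Z(t)\}=1$ for all $t\in\mathbb{R}^d$, $\mathbb{E}\{\sup_{t\in[0,T]^d}Z(t)\}<\infty$ for all $T>0$, $\mathbb{P}\{\sup_{t\in\mathbb{R}^d}Z(t)>0\}=1$, and $Z$ is a spectral random field of a stationary max-stable random field $X$: the field $X(t)=\max_{i\ge1}\Gamma_i^{-1}Z^{(i)}(t)$, $t\in\mathbb{R}^d$, is stationary, where $\Gamma_i=\sum_{k=1}^i\mathcal{V}_k$, the $\mathcal{V}_k$ are i.i.d. unit exponential, independent of the i.i.d. copies $Z^{(i)}$ of $Z$. With $B^hZ(\cdot)=Z(\cdot-h)$, stationarity of $X$ is equivalent to $\mathbb{E}\{Z(h)F(Z)\}=\mathbb{E}\{Z(0)F(B^hZ)\}$ for all $h\in\mathbb{R}^d$ and all measurable $F:D\to[0,\infty]$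 with $F(cf)=F(f)$ for all $f\in D,c>0$. $\mathbb{I}$ denotes an indicator. $\lambda_0=\lambda$ is Lebesgue measure and $0\mathbb{Z}^d:=\mathbb{R}^d$; for $\delta>0$, $\lambda_\delta$ is $\delta^d$ times the counting measure on $\delta\mathbb{Z}^d$. Set $S_\delta=\int_{\delta\mathbb{Z}^d}Z(t)\,\lambda_\delta(dt)$. For the fixed $\delta\ge0$ under consideration $Z$ is chosen so that $S_\delta>0$ almost surely. Convention: $1/\infty=0$. The Berman function is, for $\delta,x\ge0$, $$\mathcal{B}_Z^\delta(x)=\lim_{T\to\infty}\frac1{T^d}\int_0^\infty\mathbb{P}\left\{\int_{[0,T]^d\cap\delta\mathbb{Z}^d}\mathbb{I}(Z(t)>s)\,\lambda_\delta(dt)>x\right\}ds .$$ $\Theta$ is a random field with sample paths in $D$ and law $\mu(A)=\mathbb{E}\{Z(0)\mathbb{I}\{Z/Z(0)\in A\}\}$ for measurable $A\subset D$. $Y(t)=R\,\Theta(t)$, where $R$ is independent of $\Theta$ with $\mathbb{P}\{R>r\}=1/r$, $r\ge1$, and $\epsilon_\delta(Y)=\int_{\delta\mathbb{Z}^d}\mathbb{I}\{Y(t)>1\}\,\lambda_\delta(dt)$. *)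

theory Defs
  imports "HOL-Probability.Probability"
begin

text \<open>
  A random field is represented by the map \<open>\<omega> \<mapsto> sample path\<close>, so for a field \<open>Z\<close> the value
  at \<open>t\<close> is \<open>Z \<omega> t\<close>.  Path spaces carry the sigma-field generated by the projections.
\<close>

definition path_space :: "('t \<Rightarrow> 'b::topological_space) measure" where
  "path_space = PiM UNIV (\<lambda>_. borel)"

subsection \<open>Generalised cadlag functions\<close>

text \<open>
  The \<open>2 ^ d\<close> quadrants at \<open>t\<close> partition the space: coordinates in \<open>I\<close> lie strictly below
  those of \<open>t\<close>, the others weakly above.  The set of \<open>s\<close> with \<open>t \<le> s\<close> is the quadrant for
  \<open>I = {}\<close>.
\<close>

definition quadrant :: "'d set \<Rightarrow> real ^ 'd \<Rightarrow> (real ^ 'd) set" where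
  "quadrant I t = {s. \<forall>i. if i \<in> I then s $ i < t $ i else t $ i \<le> s $ i}"

definition cadlag_space :: "(real ^ 'd \<Rightarrow> real) set" where
  "cadlag_space = {f. (\<forall>t. 0 \<le> f t)
     \<and> (\<forall>t I. \<exists>l. (f \<longlongrightarrow> l) (at t within quadrant I t))
     \<and> (\<forall>t. (f \<longlongrightarrow> f t) (at t within {s. t \<le> s}))}"

definition cadlag_measurable_space :: "(real ^ 'd \<Rightarrow> real) measure" where
  "cadlag_measurable_space = restrict_space path_space cadlag_space"

text \<open>Only almost all sample paths are required to be cadlag.\<close>

definition cadlag_field :: "'a measure \<Rightarrow> ('a \<Rightarrow> real ^ 'd \<Rightarrow> real) \<Rightarrow> bool" where
  "cadlag_field M Z \<longleftrightarrow> Z \<in> M \<rightarrow>\<^sub>M path_space \<and> (AE \<omega> in M. Z \<omega> \<in> cadlag_space)"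

subsection \<open>Probabilistic notions\<close>

definition non_atomic :: "'a measure \<Rightarrow> bool" where
  "non_atomic M \<longleftrightarrow> (\<forall>A\<in>sets M. 0 < emeasure M A \<longrightarrow>
     (\<exists>B\<in>sets M. B \<subseteq> A \<and> 0 < emeasure M B \<and> emeasure M B < emeasure M A))"

text \<open>
  Independence of two random elements whose value types may differ
  (the library's \<open>indep_var\<close> requires them to be equal).
\<close>

definition independent_elements ::
  "'a measure \<Rightarrow> 'b measure \<Rightarrow> ('a \<Rightarrow> 'b) \<Rightarrow> 'c measure \<Rightarrow> ('a \<Rightarrow> 'c) \<Rightarrow> bool" where
  "independent_elements M S X T Y \<longleftrightarrow> X \<in> M \<rightarrow>\<^sub>M S \<and> Y \<in> M \<rightarrow>\<^sub>M T \<and>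
     (\<forall>A\<in>sets S. \<forall>B\<in>sets T.
        measure M {\<omega>\<in>space M. X \<omega> \<in> A \<and> Y \<omega> \<in> B} =
        measure M {\<omega>\<in>space M. X \<omega> \<in> A} * measure M {\<omega>\<in>space M. Y \<omega> \<in> B})"

definition stationary_field ::
  "'a measure \<Rightarrow> ('a \<Rightarrow> real ^ 'd \<Rightarrow> 'b::topological_space) \<Rightarrow> bool" where
  "stationary_field M X \<longleftrightarrow> X \<in> M \<rightarrow>\<^sub>M path_space \<and>
     (\<forall>h. distr M path_space (\<lambda>\<omega> t. X \<omega> (t + h)) = distr M path_space X)"

text \<open>
  Sequences are indexed from \<open>0\<close>, so \<open>arrival V i\<close> is the arrival time with number \<open>i + 1\<close>.
  The maximum over the infinitely many indices is almost surely attained; it is rendered as a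
  supremum in the extended nonnegative reals, which does not matter on the exceptional null set.
\<close>

definition arrival :: "(nat \<Rightarrow> 'a \<Rightarrow> real) \<Rightarrow> nat \<Rightarrow> 'a \<Rightarrow> real" where
  "arrival V i \<omega> = (\<Sum>k\<le>i. V k \<omega>)"

definition max_stable_field ::
  "(nat \<Rightarrow> 'a \<Rightarrow> real) \<Rightarrow> (nat \<Rightarrow> 'a \<Rightarrow> real ^ 'd \<Rightarrow> real) \<Rightarrow> 'a \<Rightarrow> real ^ 'd \<Rightarrow> ennreal" where
  "max_stable_field V C \<omega> t = (SUP i. ennreal (C i \<omega> t / arrival V i \<omega>))"

text \<open>
  \<open>V\<close> are the i.i.d. unit exponentials and \<open>C\<close> the i.i.d. copies of \<open>Z\<close>, independent of \<open>V\<close>.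
\<close>

definition max_stable_ingredients ::
  "'a measure \<Rightarrow> (nat \<Rightarrow> 'a \<Rightarrow> real) \<Rightarrow> (nat \<Rightarrow> 'a \<Rightarrow> real ^ 'd \<Rightarrow> real)
     \<Rightarrow> ('a \<Rightarrow> real ^ 'd \<Rightarrow> real) \<Rightarrow> bool" where
  "max_stable_ingredients M V C Z \<longleftrightarrow>
     (\<forall>k. distributed M lborel (V k) (exponential_density 1)) \<and>
     prob_space.indep_vars M (\<lambda>_. borel) V UNIV \<and>
     (\<forall>i. cadlag_field M (C i) \<and> distr M path_space (C i) = distr M path_space Z) \<and>
     prob_space.indep_vars M (\<lambda>_. path_space) C UNIV \<and>
     independent_elements M
       (PiM UNIV (\<lambda>_. borel)) (\<lambda>\<omega> k. V k \<omega>)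
       (PiM UNIV (\<lambda>_. path_space)) (\<lambda>\<omega> i. C i \<omega>)"

subsection \<open>Grid integrals and the Berman function\<close>

definition grid :: "real \<Rightarrow> (real ^ 'd) set" where
  "grid \<delta> = (if \<delta> = 0 then UNIV else {t. \<forall>i. \<exists>k::int. t $ i = \<delta> * of_int k})"

text \<open>The underlying space of this measure is \<open>grid \<delta>\<close>, so integrals against it run over the grid.\<close>

definition grid_measure :: "real \<Rightarrow> (real ^ 'd) measure" where
  "grid_measure \<delta> = (if \<delta> = 0 then lborel
     else scale_measure (ennreal (\<delta> ^ CARD('d))) (count_space (grid \<delta>)))"

definition total_mass :: "real \<Rightarrow> (real ^ 'd \<Rightarrow> real) \<Rightarrow> ennreal" where
  "total_mass \<delta> f = (\<integral>\<^sup>+t. ennreal (f t) \<partial>grid_measure \<delta>)"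

definition sojourn_above_one :: "real \<Rightarrow> (real ^ 'd \<Rightarrow> real) \<Rightarrow> ennreal" where
  "sojourn_above_one \<delta> f = (\<integral>\<^sup>+t. indicator {t. f t > 1} t \<partial>grid_measure \<delta>)"

text \<open>\<open>vec T\<close> is the constant vector, so \<open>{0..vec T}\<close> is the cube with side length \<open>T\<close>.\<close>

definition berman_average ::
  "'a measure \<Rightarrow> ('a \<Rightarrow> real ^ 'd \<Rightarrow> real) \<Rightarrow> real \<Rightarrow> real \<Rightarrow> real \<Rightarrow> ennreal" where
  "berman_average M Z \<delta> x T = ennreal (1 / T ^ CARD('d)) *
     (\<integral>\<^sup>+s\<in>{0..}. emeasure M {\<omega>\<in>space M.
        (\<integral>\<^sup>+t\<in>{0..vec T}. indicator {t. Z \<omega> t > s} t \<partial>grid_measure \<delta>) > ennreal x} \<partial>lborel)"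

definition berman ::
  "'a measure \<Rightarrow> ('a \<Rightarrow> real ^ 'd \<Rightarrow> real) \<Rightarrow> real \<Rightarrow> real \<Rightarrow> ennreal" where
  "berman M Z \<delta> x = Lim at_top (berman_average M Z \<delta> x)"

end

theory Submission
  imports Defs
begin

text \<open>
  Let \<open>e\<^sub>K(s)\<close> be the sojourn of \<open>Z\<close> above the level \<open>s\<close> in a bounded set \<open>K\<close>, and
  \<open>\<phi>(e) = \<one>(e > x) / e\<close>.  Since \<open>e\<^sub>K(s)\<close> is finite, everything follows from the trivial identity
  \<open>\<one>(e\<^sub>K(s) > x) = e\<^sub>K(s) \<phi>(e\<^sub>K(s)) = \<integral>\<^sub>K \<one>(Z(t) > s) \<phi>(e\<^sub>K(s)) \<lambda>\<^sub>\<delta>(dt)\<close>.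
  Integrate it over the levels \<open>s\<close> and over the probability space, and exchange the integrals.  For a
  fixed location \<open>t\<close> put \<open>s = Z(t) v\<close> with \<open>0 < v < 1\<close>.  A uniform \<open>v\<close> has the law of \<open>1 / R\<close>, so the
  contribution of \<open>t\<close> is an expectation, weighted by \<open>Z(t)\<close>, of a functional of the ratio field
  \<open>Z / Z(t)\<close>.  Stationarity moves \<open>t\<close> to the origin, where the weighted ratio field is \<open>\<Theta>\<close>.  Thus the
  contribution of \<open>t\<close> equals the expectation of \<open>\<phi>\<close> at the sojourn of \<open>Y = R \<Theta>\<close> above one in \<open>K - t\<close>
  (\<open>sojourn_identity_at_point\<close>, \<open>sojourn_identity\<close>).

  For the cube \<open>K = [0, T]\<^sup>d\<close> the Berman average is therefore a mean over \<open>t \<in> K\<close>.  Seen from a point in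
  fixed relative position \<open>\<tau> = t / T\<close> inside the cube, \<open>K - t\<close> exhausts the space as \<open>T\<close> grows, and the
  sojourn of \<open>Y\<close> in it converges to \<open>\<epsilon>\<^sub>\<delta>(Y)\<close> from below.  If \<open>x > 0\<close> then \<open>\<phi>\<close> is bounded by \<open>1 / x\<close>;
  if \<open>\<delta> > 0\<close> then a positive sojourn is at least \<open>\<delta>\<^sup>d\<close>, so \<open>\<phi>\<close> is bounded on the values that matter.
  In both cases dominated convergence gives the limit (\<open>berman_average_tendsto_bounded\<close>).

  The case \<open>x = \<delta> = 0\<close>, in which the limit is a Pickands constant, has an unbounded \<open>\<phi>\<close>.  It is reduced
  to small positive levels \<open>x\<close>: a path whose sojourn in a cube of side \<open>N\<close> is positive but not more
  than \<open>x\<close> has a positive sojourn of at most \<open>x\<close> in one of its \<open>N\<^sup>d\<close> unit cubes.  By stationarity, replacing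
  the level \<open>0\<close> by \<open>x\<close> changes the Berman average for side \<open>N\<close> by at most \<open>c(x)\<close>, the quantity for one
  unit cube, and \<open>c(x)\<close> tends to \<open>0\<close> with \<open>x\<close> because the supremum of \<open>Z\<close> over a unit cube has finite mean
  (\<open>berman_average_pickands\<close>).

  The stationarity used above concerns the spectral field \<open>Z\<close>, whereas the hypothesis concerns the max-stable
  field \<open>X\<close>.  The two are linked by tails: \<open>u P(max\<^sub>j a\<^sub>j X(t\<^sub>j) > u)\<close> tends to \<open>E max\<^sub>j a\<^sub>j Z(t\<^sub>j)\<close>
  as \<open>u\<close> grows (\<open>max_stable_tail\<close>), so these maximum moments are invariant under shifts of the \<open>t\<^sub>j\<close>.
  Their right derivative in the weight of the origin is the expectation of \<open>Z(0)\<close> over the event that the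
  ratios \<open>Z(t\<^sub>j) / Z(0)\<close> do not exceed prescribed bounds, and such box probabilities determine the weighted
  law of the ratio field (\<open>spectral_law_shift\<close>).
\<close>

section \<open>Tails of a max-stable field\<close>

lemma tendsto_le_Liminf_Limsup_le:
  fixes l :: "'b :: {complete_linorder, linorder_topology}"
  assumes "F \<noteq> bot" "l \<le> Liminf F f" "Limsup F f \<le> l"
  shows "(f \<longlongrightarrow> l) F"
proof -
  have "Liminf F f \<le> Limsup F f"
    using assms(1) by (rule Liminf_le_Limsup)
  then have "Liminf F f = l" "Limsup F f = l"
    using assms(2,3) by auto
  then show ?thesis
    using assms(1) by (simp add: tendsto_iff_Liminf_eq_Limsup)
qed

lemma distr_Pair_independent_elements:
  assumes "prob_space M" and ind: "independent_elements M S X T Y"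
  shows "distr M (S \<Otimes>\<^sub>M T) (\<lambda>\<omega>. (X \<omega>, Y \<omega>)) = distr M S X \<Otimes>\<^sub>M distr M T Y"
proof -
  interpret prob_space M by fact
  have [measurable]: "X \<in> M \<rightarrow>\<^sub>M S" "Y \<in> M \<rightarrow>\<^sub>M T"
    using ind by (auto simp: independent_elements_def)
  interpret X: prob_space "distr M S X" by (rule prob_space_distr) simp
  interpret Y: prob_space "distr M T Y" by (rule prob_space_distr) simp
  show ?thesis
  proof (rule pair_measure_eqI[symmetric])
    fix A B assume "A \<in> sets (distr M S X)" "B \<in> sets (distr M T Y)"
    then have [measurable]: "A \<in> sets S" "B \<in> sets T" by simp_all
    have "measure M {\<omega>\<in>space M. X \<omega> \<in> A \<and> Y \<omega> \<in> B} =
        measure M {\<omega>\<in>space M. X \<omega> \<in> A} * measure M {\<omega>\<in>space M. Y \<omega> \<in> B}"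
      using ind \<open>A \<in> sets S\<close> \<open>B \<in> sets T\<close> by (auto simp: independent_elements_def)
    moreover have "(\<lambda>\<omega>. (X \<omega>, Y \<omega>)) -` (A \<times> B) \<inter> space M = {\<omega>\<in>space M. X \<omega> \<in> A \<and> Y \<omega> \<in> B}"
      "X -` A \<inter> space M = {\<omega>\<in>space M. X \<omega> \<in> A}" "Y -` B \<inter> space M = {\<omega>\<in>space M. Y \<omega> \<in> B}"
      by auto
    ultimately show "emeasure (distr M S X) A * emeasure (distr M T Y) B =
        emeasure (distr M (S \<Otimes>\<^sub>M T) (\<lambda>\<omega>. (X \<omega>, Y \<omega>))) (A \<times> B)"
      by (simp add: emeasure_distr emeasure_eq_measure ennreal_mult)
  qed (auto intro: X.sigma_finite_measure_axioms Y.sigma_finite_measure_axioms)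
qed

text \<open>
  Conditioning on \<open>W\<close> and rescaling the density of \<open>G\<close> puts \<open>u\<close> inside the density only.  This form
  makes both bounds for the tail of the max-stable field visible: the scaled Erlang densities of the
  arrival times sum to one, and the first of them tends to one.
\<close>

lemma emeasure_scaled_less:
  fixes G W :: "'a \<Rightarrow> real" and g :: "real \<Rightarrow> ennreal"
  assumes "prob_space M" and G: "distributed M lborel G g" and ind: "independent_elements M borel G borel W"
    and u: "u > 0"
  shows "ennreal u * emeasure M {\<omega>\<in>space M. u * G \<omega> < W \<omega>} =
    (\<integral>\<^sup>+\<omega>. (\<integral>\<^sup>+y. g (y / u) * indicator {..<W \<omega>} y \<partial>lborel) \<partial>M)"
proof -
  interpret prob_space M by fact
  have [measurable]: "W \<in> borel_measurable M" "G \<in> borel_measurable M"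
    using ind by (auto simp: independent_elements_def)
  have [measurable]: "g \<in> borel_measurable borel"
    using G by (auto simp: distributed_def)
  interpret G: prob_space "distr M borel G" by (rule prob_space_distr) simp
  interpret W: prob_space "distr M borel W" by (rule prob_space_distr) simp
  interpret pair_sigma_finite "distr M borel G" "distr M borel W" ..
  have Gd: "distr M borel G = density lborel g"
    using G by (simp add: distributed_def cong: distr_cong)
  define S where "S = {p :: real \<times> real. u * fst p < snd p}"
  have "{p \<in> space (borel \<Otimes>\<^sub>M borel). u * fst p < snd p} \<in> sets (borel \<Otimes>\<^sub>M (borel :: real measure))"
    by measurable
  then have S: "S \<in> sets (borel \<Otimes>\<^sub>M borel)"
    by (simp add: S_def space_pair_measure)
  have inner: "ennreal u * emeasure (density lborel g) {y. u * y < w} = (\<integral>\<^sup>+y. g (y / u) * indicator {..<w} y \<partial>lborel)" for w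
  proof -
    have "emeasure (density lborel g) {y. u * y < w} = (\<integral>\<^sup>+y. g y * indicator {y. u * y < w} y \<partial>lborel)"
      by (subst emeasure_density) auto
    also have "\<dots> = \<bar>1/u\<bar> * (\<integral>\<^sup>+y. g (0 + (1/u) * y) * indicator {y. u * y < w} (0 + (1/u) * y) \<partial>lborel)"
      by (rule nn_integral_real_affine) (use u in auto)
    also have "\<dots> = ennreal (1/u) * (\<integral>\<^sup>+y. g (y / u) * indicator {..<w} y \<partial>lborel)"
      using u by (intro arg_cong2[where f="(*)"] nn_integral_cong) (auto simp: indicator_def)
    finally show ?thesis
      using u by (simp add: mult.assoc[symmetric] ennreal_mult[symmetric])
  qed
  have "emeasure M {\<omega>\<in>space M. u * G \<omega> < W \<omega>} = emeasure (distr M (borel \<Otimes>\<^sub>M borel) (\<lambda>\<omega>. (G \<omega>, W \<omega>))) S"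
    using S by (subst emeasure_distr) (auto simp: S_def intro!: arg_cong[where f="emeasure M"])
  also have "\<dots> = emeasure (distr M borel G \<Otimes>\<^sub>M distr M borel W) S"
    by (simp add: distr_Pair_independent_elements[OF assms(1) ind])
  also have "\<dots> = (\<integral>\<^sup>+w. emeasure (distr M borel G) ((\<lambda>y. (y, w)) -` S) \<partial>distr M borel W)"
    using S by (intro emeasure_pair_measure_alt2)
       (simp cong: sets_pair_measure_cong)
  also have "\<dots> = (\<integral>\<^sup>+w. emeasure (density lborel g) {y. u * y < w} \<partial>distr M borel W)"
    unfolding Gd by (simp add: S_def vimage_def)
  finally have *: "emeasure M {\<omega>\<in>space M. u * G \<omega> < W \<omega>} =
     (\<integral>\<^sup>+w. emeasure (density lborel g) {y. u * y < w} \<partial>distr M borel W)" .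
  have m: "(\<lambda>w. emeasure (density lborel g) {y. u * y < w}) \<in> borel_measurable borel"
  proof -
    interpret D: sigma_finite_measure "density lborel g"
      unfolding Gd[symmetric] by (rule G.sigma_finite_measure_axioms)
    have "{p \<in> space (borel \<Otimes>\<^sub>M borel). u * snd p < fst p} \<in> sets (borel \<Otimes>\<^sub>M (borel :: real measure))"
      by measurable
    then have "{p. u * snd p < fst p} \<in> sets (borel \<Otimes>\<^sub>M density lborel g)"
      by (simp add: space_pair_measure cong: sets_pair_measure_cong)
    from D.measurable_emeasure_Pair[OF this] show ?thesis
      by (simp add: vimage_def)
  qed
  show ?thesis
    unfolding * inner[symmetric]
    by (subst nn_integral_cmult[symmetric]) (use m in \<open>auto simp: nn_integral_distr\<close>)
qed

text \<open>
  The arrival times form a Poisson process of unit rate, so their densities add up to the constant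
  intensity one.
\<close>

lemma suminf_erlang_density:
  assumes "0 \<le> y" shows "(\<Sum>i. ennreal (erlang_density i 1 y)) = 1"
proof -
  have "(\<lambda>n. y ^ n /\<^sub>R fact n * exp (- y)) sums (exp y * exp (-y))"
    by (intro sums_mult2 exp_converges)
  moreover have "exp y * exp (-y) = 1"
    by (simp add: exp_minus)
  moreover have "y ^ n /\<^sub>R fact n * exp (- y) = erlang_density n 1 y" for n
    using assms by (simp add: erlang_density_def field_simps)
  ultimately have "(\<lambda>n. erlang_density n 1 y) sums 1"
    by simp
  then have "(\<lambda>n. ennreal (erlang_density n 1 y)) sums ennreal 1"
    by (subst sums_ennreal) auto
  then show ?thesis by (simp add: sums_iff)
qed

lemma arrival_erlang:
  assumes "prob_space M" "max_stable_ingredients M V C Z"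
  shows "distributed M lborel (arrival V i) (erlang_density i 1)"
proof -
  interpret prob_space M by fact
  have "indep_vars (\<lambda>_. borel) V {..i}"
    using assms(2) by (auto simp: max_stable_ingredients_def intro: indep_vars_subset)
  then have "distributed M lborel (\<lambda>x. \<Sum>k\<in>{..i}. V k x) (erlang_density ((card {..i}) - 1) 1)"
    using assms(2) by (intro exponential_distributed_sum) (auto simp: max_stable_ingredients_def)
  then show ?thesis by (simp add: arrival_def[abs_def])
qed

lemma arrival_pos:
  assumes "prob_space M" "max_stable_ingredients M V C Z"
  shows "AE \<omega> in M. 0 < arrival V i \<omega>"
proof -
  have D: "distributed M lborel (arrival V i) (erlang_density i 1)"
    by (rule arrival_erlang) fact+
  have "AE y in lborel. y \<noteq> (0::real)"
    by (rule AE_lborel_singleton)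
  then have "AE y in lborel. 0 < ennreal (erlang_density i 1 y) \<longrightarrow> 0 < y"
    by eventually_elim (auto simp: erlang_density_def not_less)
  then have "AE y in density lborel (\<lambda>y. ennreal (erlang_density i 1 y)). 0 < y"
    by (subst AE_density) auto
  then have "AE y in distr M lborel (arrival V i). 0 < y"
    by (subst distributed_distr_eq_density[OF D])
  then show ?thesis
    using D by (subst (asm) AE_distr_iff) (auto simp: distributed_def)
qed

text \<open>
  The union bound over the arrivals gives \<open>E w(Z)\<close> as an upper bound for every \<open>n\<close>, because the Erlang
  densities sum to one.  The first arrival alone already gives a lower bound with the same
  limit: its density is one at zero, and Fatou's lemma applies.
\<close>

lemma max_stable_tail:
  assumes "prob_space M" and ingr: "max_stable_ingredients M V C Z"
    and Z [measurable]: "Z \<in> M \<rightarrow>\<^sub>M path_space"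
    and w [measurable]: "w \<in> borel_measurable path_space"
  shows "(\<lambda>n. ennreal (Suc n) * emeasure M {\<omega>\<in>space M. \<exists>i. Suc n * arrival V i \<omega> < w (C i \<omega>)})
    \<longlonglongrightarrow> (\<integral>\<^sup>+\<omega>. ennreal (w (Z \<omega>)) \<partial>M)"
proof -
  interpret prob_space M by fact
  have C [measurable]: "C i \<in> M \<rightarrow>\<^sub>M path_space" for i
    using ingr by (auto simp: max_stable_ingredients_def cadlag_field_def)
  have V [measurable]: "V i \<in> borel_measurable M" for i
    using ingr by (auto simp: max_stable_ingredients_def distributed_def)
  have CZ: "(\<integral>\<^sup>+\<omega>. f (w (C i \<omega>)) \<partial>M) = (\<integral>\<^sup>+\<omega>. f (w (Z \<omega>)) \<partial>M)"
    if [measurable]: "f \<in> borel_measurable borel" for f :: "real \<Rightarrow> ennreal" and i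
  proof -
    have "(\<integral>\<^sup>+\<omega>. f (w (C i \<omega>)) \<partial>M) = (\<integral>\<^sup>+x. f (w x) \<partial>distr M path_space (C i))"
      by (rule nn_integral_distr[symmetric]) auto
    also have "\<dots> = (\<integral>\<^sup>+x. f (w x) \<partial>distr M path_space Z)"
      using ingr by (auto simp: max_stable_ingredients_def)
    also have "\<dots> = (\<integral>\<^sup>+\<omega>. f (w (Z \<omega>)) \<partial>M)"
      by (rule nn_integral_distr) auto
    finally show ?thesis .
  qed
  have ind: "independent_elements M borel (arrival V i) borel (\<lambda>\<omega>. w (C i \<omega>))" for i
    unfolding independent_elements_def
  proof (intro conjI ballI)
    show [measurable]: "arrival V i \<in> borel_measurable M"
      unfolding arrival_def[abs_def] by measurable
    fix A B :: "real set" assume [measurable]: "A \<in> sets borel" "B \<in> sets borel"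
    let ?A = "{v \<in> space (PiM UNIV (\<lambda>_. borel)). (\<Sum>k\<le>i. v k) \<in> A}"
    let ?B = "{c \<in> space (PiM UNIV (\<lambda>_. path_space)). w (c i) \<in> B}"
    have "?A \<in> sets (PiM UNIV (\<lambda>_. borel))"
      by measurable
    moreover have "?B \<in> sets (PiM UNIV (\<lambda>_. path_space))"
      by measurable
    ultimately have "measure M {\<omega>\<in>space M. (\<lambda>k. V k \<omega>) \<in> ?A \<and> (\<lambda>i. C i \<omega>) \<in> ?B} =
        measure M {\<omega>\<in>space M. (\<lambda>k. V k \<omega>) \<in> ?A} * measure M {\<omega>\<in>space M. (\<lambda>i. C i \<omega>) \<in> ?B}"
      using ingr unfolding max_stable_ingredients_def independent_elements_def by blast
    moreover have "(\<lambda>k. V k \<omega>) \<in> ?A \<longleftrightarrow> arrival V i \<omega> \<in> A" for \<omega>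
      by (auto simp: space_PiM arrival_def)
    moreover have "(\<lambda>i. C i \<omega>) \<in> ?B \<longleftrightarrow> w (C i \<omega>) \<in> B" for \<omega>
      by (auto simp: space_PiM path_space_def)
    ultimately show "measure M {\<omega>\<in>space M. arrival V i \<omega> \<in> A \<and> w (C i \<omega>) \<in> B} =
        measure M {\<omega>\<in>space M. arrival V i \<omega> \<in> A} * measure M {\<omega>\<in>space M. w (C i \<omega>) \<in> B}"
      by (simp only:)
  qed measurable
  have [measurable]: "arrival V i \<in> borel_measurable M" for i
    unfolding arrival_def[abs_def] by measurable
  define p where "p i u = (\<integral>\<^sup>+\<omega>. (\<integral>\<^sup>+y. ennreal (erlang_density i 1 (y / u)) * indicator {..<w (Z \<omega>)} y \<partial>lborel) \<partial>M)"
    for i u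
  have p: "ennreal u * emeasure M {\<omega>\<in>space M. u * arrival V i \<omega> < w (C i \<omega>)} = p i u" if "u > 0" for i u
    unfolding p_def
    by (subst emeasure_scaled_less[OF assms(1) arrival_erlang[OF assms(1) ingr] ind that])
       (rule CZ, simp only: lessThan_def, measurable)
  have line: "(\<integral>\<^sup>+y. indicator {0..<z} y \<partial>lborel) = ennreal z" for z
    by (cases "0 \<le> z") (auto simp: ennreal_neg)
  \<comment> \<open>Union bound; the scaled Erlang densities add up to one on the nonnegative half-line.\<close>
  have upper: "ennreal u * emeasure M {\<omega>\<in>space M. \<exists>i. u * arrival V i \<omega> < w (C i \<omega>)} \<le> (\<integral>\<^sup>+\<omega>. ennreal (w (Z \<omega>)) \<partial>M)"
    if u: "u > 0" for u :: real
  proof -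
    have "{\<omega>\<in>space M. \<exists>i. u * arrival V i \<omega> < w (C i \<omega>)} = (\<Union>i. {\<omega>\<in>space M. u * arrival V i \<omega> < w (C i \<omega>)})"
      by auto
    moreover have "emeasure M (\<Union>i. {\<omega>\<in>space M. u * arrival V i \<omega> < w (C i \<omega>)}) \<le>
        (\<Sum>i. emeasure M {\<omega>\<in>space M. u * arrival V i \<omega> < w (C i \<omega>)})"
      by (rule emeasure_subadditive_countably) auto
    ultimately have "ennreal u * emeasure M {\<omega>\<in>space M. \<exists>i. u * arrival V i \<omega> < w (C i \<omega>)} \<le>
        ennreal u * (\<Sum>i. emeasure M {\<omega>\<in>space M. u * arrival V i \<omega> < w (C i \<omega>)})"
      by (auto intro: mult_left_mono)
    also have "\<dots> = (\<Sum>i. p i u)"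
      using p[OF u] by (simp add: ennreal_suminf_cmult[symmetric])
    also have "\<dots> = (\<integral>\<^sup>+\<omega>. (\<integral>\<^sup>+y. (\<Sum>i. ennreal (erlang_density i 1 (y / u)) * indicator {..<w (Z \<omega>)} y) \<partial>lborel) \<partial>M)"
    proof -
      let ?f = "\<lambda>i \<omega> y. ennreal (erlang_density i 1 (y / u)) * indicator {..<w (Z \<omega>)} y"
      have "(\<integral>\<^sup>+y. (\<Sum>i. ?f i \<omega> y) \<partial>lborel) = (\<Sum>i. (\<integral>\<^sup>+y. ?f i \<omega> y \<partial>lborel))" for \<omega>
        by (rule nn_integral_suminf) simp
      moreover have "(\<lambda>\<omega>. (\<integral>\<^sup>+y. ?f i \<omega> y \<partial>lborel)) \<in> borel_measurable M" for i
        unfolding lessThan_def by measurable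
      ultimately show ?thesis
        unfolding p_def by (simp only: nn_integral_suminf)
    qed
    also have "\<dots> = (\<integral>\<^sup>+\<omega>. (\<integral>\<^sup>+y. indicator {0..<w (Z \<omega>)} y \<partial>lborel) \<partial>M)"
    proof (intro nn_integral_cong)
      fix \<omega> y
      show "(\<Sum>i. ennreal (erlang_density i 1 (y / u)) * indicator {..<w (Z \<omega>)} y) = indicator {0..<w (Z \<omega>)} y"
      proof (cases "0 \<le> y")
        case True
        then have s: "(\<Sum>i. ennreal (erlang_density i 1 (y / u))) = 1"
          using u by (intro suminf_erlang_density) simp
        show ?thesis
          using True by (cases "y < w (Z \<omega>)") (simp_all add: s)
      next
        case False
        then have "y / u < 0"
          using u by (simp add: divide_less_0_iff)
        then have "erlang_density i 1 (y / u) = 0" for i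
          by (simp add: erlang_density_def)
        then show ?thesis
          using False by simp
      qed
    qed
    finally show ?thesis by (simp add: line)
  qed
  \<comment> \<open>Only the first arrival is kept.\<close>
  have lower: "p 0 u \<le> ennreal u * emeasure M {\<omega>\<in>space M. \<exists>i. u * arrival V i \<omega> < w (C i \<omega>)}" if u: "u > 0" for u :: real
    unfolding p[OF u, symmetric] by (intro mult_left_mono emeasure_mono) auto
  have "(\<integral>\<^sup>+\<omega>. ennreal (w (Z \<omega>)) \<partial>M) = (\<integral>\<^sup>+\<omega>. (\<integral>\<^sup>+y. indicator {0..<w (Z \<omega>)} y \<partial>lborel) \<partial>M)"
    by (simp add: line)
  also have "\<dots> \<le> (\<integral>\<^sup>+\<omega>. (\<integral>\<^sup>+y. liminf (\<lambda>n. ennreal (erlang_density 0 1 (y / Suc n)) * indicator {..<w (Z \<omega>)} y) \<partial>lborel) \<partial>M)"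
  proof (intro nn_integral_mono)
    fix \<omega> y
    show "indicator {0..<w (Z \<omega>)} y \<le> liminf (\<lambda>n. ennreal (erlang_density 0 1 (y / Suc n)) * indicator {..<w (Z \<omega>)} y)"
    proof (cases "0 \<le> y \<and> y < w (Z \<omega>)")
      case True
      have "(\<lambda>n. y * inverse (real (Suc n))) \<longlonglongrightarrow> y * 0"
        by (intro tendsto_intros LIMSEQ_inverse_real_of_nat)
      then have "(\<lambda>n. ennreal (exp (- (y * inverse (real (Suc n)))))) \<longlonglongrightarrow> ennreal (exp (- (y * 0)))"
        by (intro tendsto_ennrealI tendsto_exp tendsto_minus)
      moreover have "ennreal (exp (- (y * inverse (real (Suc n))))) = ennreal (erlang_density 0 1 (y / Suc n)) * indicator {..<w (Z \<omega>)} y" for n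
      proof -
        have "0 \<le> y * inverse (real (Suc n))"
          using True by (intro mult_nonneg_nonneg) auto
        then show ?thesis
          using True by (simp add: erlang_density_def divide_inverse not_less del: of_nat_Suc)
      qed
      ultimately have "(\<lambda>n. ennreal (erlang_density 0 1 (y / Suc n)) * indicator {..<w (Z \<omega>)} y) \<longlonglongrightarrow> 1"
        by simp
      then have "liminf (\<lambda>n. ennreal (erlang_density 0 1 (y / Suc n)) * indicator {..<w (Z \<omega>)} y) = 1"
        by (intro lim_imp_Liminf) auto
      then show ?thesis by (simp add: indicator_def)
    qed auto
  qed
  also have "\<dots> \<le> (\<integral>\<^sup>+\<omega>. liminf (\<lambda>n. (\<integral>\<^sup>+y. ennreal (erlang_density 0 1 (y / Suc n)) * indicator {..<w (Z \<omega>)} y \<partial>lborel)) \<partial>M)"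
    by (intro nn_integral_mono nn_integral_liminf) measurable
  also have "\<dots> \<le> liminf (\<lambda>n. p 0 (Suc n))"
    unfolding p_def lessThan_def by (intro nn_integral_liminf) measurable
  also have "\<dots> \<le> liminf (\<lambda>n. ennreal (Suc n) * emeasure M {\<omega>\<in>space M. \<exists>i. Suc n * arrival V i \<omega> < w (C i \<omega>)})"
    by (intro Liminf_mono always_eventually allI lower) simp
  finally have "(\<integral>\<^sup>+\<omega>. ennreal (w (Z \<omega>)) \<partial>M) \<le> liminf (\<lambda>n. ennreal (Suc n) * emeasure M {\<omega>\<in>space M. \<exists>i. Suc n * arrival V i \<omega> < w (C i \<omega>)})" .
  moreover have "limsup (\<lambda>n. ennreal (Suc n) * emeasure M {\<omega>\<in>space M. \<exists>i. Suc n * arrival V i \<omega> < w (C i \<omega>)}) \<le> (\<integral>\<^sup>+\<omega>. ennreal (w (Z \<omega>)) \<partial>M)"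
    by (intro Limsup_bounded always_eventually allI upper) simp
  ultimately show ?thesis
    by (intro tendsto_le_Liminf_Limsup_le) auto
qed

section \<open>Shift invariance of the spectral law\<close>

lemma space_path_space [simp]: "space path_space = UNIV"
  by (simp add: path_space_def space_PiM)

lemma measurable_path_component [measurable]: "(\<lambda>f. f t) \<in> path_space \<rightarrow>\<^sub>M borel"
  unfolding path_space_def by (rule measurable_component_singleton) simp

lemma measurable_path_spaceI:
  assumes "\<And>t. (\<lambda>x. F x t) \<in> N \<rightarrow>\<^sub>M borel"
  shows "F \<in> N \<rightarrow>\<^sub>M path_space"
  unfolding path_space_def using assms by (intro measurable_PiM_single') auto

lemma measurable_path_value:
  assumes "F \<in> N \<rightarrow>\<^sub>M path_space"
  shows "(\<lambda>x. F x t) \<in> N \<rightarrow>\<^sub>M borel"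
  by (rule measurable_compose[OF assms measurable_path_component])

text \<open>
  The extra \<open>0\<close> makes the maximum well defined for empty \<open>P\<close> and does not change it on nonnegative
  paths.  Index pairs, instead of a weight for each point, allow the same point to occur twice,
  which the differentiation in the weight of the origin needs.
\<close>

definition max_functional :: "(real \<times> 't) set \<Rightarrow> ('t \<Rightarrow> real) \<Rightarrow> real" where
  "max_functional P f = Max (insert 0 ((\<lambda>(a, t). a * f t) ` P))"

lemma max_functional_insert:
  "finite P \<Longrightarrow> max_functional (insert (a, t) P) f = max (a * f t) (max_functional P f)"
  unfolding max_functional_def
  by (simp add: insert_commute[of 0])

lemma max_functional_nonneg: "finite P \<Longrightarrow> 0 \<le> max_functional P f"
  unfolding max_functional_def by (intro Max_ge) auto

lemma less_max_functional_iff: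
  "finite P \<Longrightarrow> 0 \<le> u \<Longrightarrow> u < max_functional P f \<longleftrightarrow> (\<exists>(a, t)\<in>P. u < a * f t)"
  unfolding max_functional_def split_beta by (subst Max_gr_iff) auto

lemma max_functional_le_iff:
  "finite P \<Longrightarrow> 0 \<le> u \<Longrightarrow> max_functional P f \<le> u \<longleftrightarrow> (\<forall>(a, t)\<in>P. a * f t \<le> u)"
  unfolding max_functional_def by (subst Max_le_iff) auto

lemma measurable_max_functional [measurable]:
  assumes "finite P" shows "max_functional P \<in> borel_measurable path_space"
  using assms
proof (induction P)
  case empty
  then show ?case by (simp add: max_functional_def[abs_def])
next
  case (insert p P)
  obtain a t where p: "p = (a, t)" by (cases p)
  have "max_functional (insert p P) = (\<lambda>f. max (a * f t) (max_functional P f))"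
    unfolding p using insert.hyps by (intro ext max_functional_insert)
  then show ?case using insert.IH by simp
qed

text \<open>
  By \<open>max_stable_tail\<close> both sides are limits of \<open>u\<close> times the probability that \<open>X\<close> exceeds one of the
  levels \<open>u / a\<close> at the (shifted) points \<open>t\<close>, and the law of \<open>X\<close> is invariant under shifts.
\<close>

lemma nn_integral_max_functional_shift:
  fixes Z :: "'a \<Rightarrow> real ^ 'd \<Rightarrow> real"
  assumes "prob_space M" and ingr: "max_stable_ingredients M V C Z"
    and Z [measurable]: "Z \<in> M \<rightarrow>\<^sub>M path_space"
    and stat: "stationary_field M (max_stable_field V C)"
    and P: "finite P" "\<And>a t. (a, t) \<in> P \<Longrightarrow> 0 < a"
  shows "(\<integral>\<^sup>+\<omega>. ennreal (max_functional P (\<lambda>t. Z \<omega> (t + h))) \<partial>M) =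
    (\<integral>\<^sup>+\<omega>. ennreal (max_functional P (Z \<omega>)) \<partial>M)"
proof -
  interpret prob_space M by fact
  let ?X = "max_stable_field V C"
  have C [measurable]: "C i \<in> M \<rightarrow>\<^sub>M path_space" for i
    using ingr by (auto simp: max_stable_ingredients_def cadlag_field_def)
  have V [measurable]: "V i \<in> borel_measurable M" for i
    using ingr by (auto simp: max_stable_ingredients_def distributed_def)
  have [measurable]: "arrival V i \<in> borel_measurable M" for i
    unfolding arrival_def[abs_def] by measurable
  have X: "?X \<in> M \<rightarrow>\<^sub>M path_space"
    using stat by (simp add: stationary_field_def)
  have [measurable]: "(\<lambda>\<omega>. ?X \<omega> t) \<in> borel_measurable M" for t
    by (rule measurable_path_value[OF X])
  have shift: "(\<lambda>f t. f (t + k)) \<in> path_space \<rightarrow>\<^sub>M (path_space :: (real^'d \<Rightarrow> real) measure)" for k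
    by (rule measurable_path_spaceI) simp
  have max_shift: "(\<lambda>f. max_functional P (\<lambda>t. f (t + k))) \<in> borel_measurable path_space" for k :: "real^'d"
    by (rule measurable_compose[OF shift measurable_max_functional[OF P(1)]])
  have [measurable]: "(\<lambda>\<omega>. max_functional P (\<lambda>t. C i \<omega> (t + k))) \<in> borel_measurable M" for i k
    by (rule measurable_compose[OF C max_shift])
  define exc where "exc u = {g \<in> space path_space. \<exists>(a, t)\<in>P. ennreal (u / a) < g t}" for u and g :: "real^'d \<Rightarrow> ennreal"
  have exc [measurable]: "exc u \<in> sets path_space" for u
  proof -
    have "{g \<in> space path_space. ennreal (u / fst p) < g (snd p)} \<in> sets (path_space :: (real^'d \<Rightarrow> ennreal) measure)" for p
      by measurable
    then show ?thesis
      unfolding exc_def split_beta using P by (intro sets.sets_Collect_finite_Ex)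
  qed
  \<comment> \<open>Up to a null set on which some arrival time is not positive, the event is one about \<open>X\<close> shifted by \<open>k\<close>.\<close>
  have tail: "emeasure M {\<omega>\<in>space M. \<exists>i. Suc n * arrival V i \<omega> < max_functional P (\<lambda>t. C i \<omega> (t + k))} =
      emeasure (distr M path_space ?X) (exc (Suc n))" for n k
  proof -
    have Xk: "(\<lambda>\<omega> t. ?X \<omega> (t + k)) \<in> M \<rightarrow>\<^sub>M path_space"
      by (rule measurable_path_spaceI) simp
    have "emeasure M {\<omega>\<in>space M. \<exists>i. Suc n * arrival V i \<omega> < max_functional P (\<lambda>t. C i \<omega> (t + k))} =
      emeasure M {\<omega>\<in>space M. (\<lambda>t. ?X \<omega> (t + k)) \<in> exc (Suc n)}"
    proof (rule emeasure_eq_AE)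
      have "AE \<omega> in M. \<forall>i. 0 < arrival V i \<omega>"
        using arrival_pos[OF assms(1) ingr] by (simp add: AE_all_countable)
      then show "AE \<omega> in M. \<omega> \<in> {\<omega>\<in>space M. \<exists>i. Suc n * arrival V i \<omega> < max_functional P (\<lambda>t. C i \<omega> (t + k))} \<longleftrightarrow>
          \<omega> \<in> {\<omega>\<in>space M. (\<lambda>t. ?X \<omega> (t + k)) \<in> exc (Suc n)}"
      proof eventually_elim
        fix \<omega> assume pos: "\<forall>i. 0 < arrival V i \<omega>"
        have "ennreal (Suc n / a) < ennreal (C i \<omega> s / arrival V i \<omega>) \<longleftrightarrow> Suc n * arrival V i \<omega> < a * C i \<omega> s"
          if "0 < a" for a i s
          using that pos[rule_format, of i]
          by (subst ennreal_less_iff) (auto simp: field_simps)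
        then have "ennreal (Suc n / a) < ?X \<omega> s \<longleftrightarrow> (\<exists>i. Suc n * arrival V i \<omega> < a * C i \<omega> s)"
          if "0 < a" for a s
          unfolding max_stable_field_def less_SUP_iff using that by simp
        then have X: "ennreal (Suc n / fst p) < ?X \<omega> (snd p + k) \<longleftrightarrow>
            (\<exists>i. Suc n * arrival V i \<omega> < fst p * C i \<omega> (snd p + k))" if "p \<in> P" for p
          using that P(2)[of "fst p" "snd p"] by simp
        have nonneg: "0 \<le> Suc n * arrival V i \<omega>" for i
          using pos[rule_format, of i] by simp
        have "(\<exists>i. Suc n * arrival V i \<omega> < max_functional P (\<lambda>t. C i \<omega> (t + k))) \<longleftrightarrow>
            (\<exists>i. \<exists>p\<in>P. Suc n * arrival V i \<omega> < fst p * C i \<omega> (snd p + k))"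
          unfolding less_max_functional_iff[OF P(1) nonneg] split_beta ..
        also have "\<dots> \<longleftrightarrow> (\<exists>p\<in>P. \<exists>i. Suc n * arrival V i \<omega> < fst p * C i \<omega> (snd p + k))"
          by blast
        also have "\<dots> \<longleftrightarrow> (\<exists>p\<in>P. ennreal (Suc n / fst p) < ?X \<omega> (snd p + k))"
          by (intro bex_cong refl X[symmetric])
        finally have *: "(\<exists>i. Suc n * arrival V i \<omega> < max_functional P (\<lambda>t. C i \<omega> (t + k))) \<longleftrightarrow>
            (\<exists>p\<in>P. ennreal (Suc n / fst p) < ?X \<omega> (snd p + k))" .
        show "\<omega> \<in> {\<omega>\<in>space M. \<exists>i. Suc n * arrival V i \<omega> < max_functional P (\<lambda>t. C i \<omega> (t + k))} \<longleftrightarrow>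
          \<omega> \<in> {\<omega>\<in>space M. (\<lambda>t. ?X \<omega> (t + k)) \<in> exc (Suc n)}"
          unfolding exc_def split_beta mem_Collect_eq * by (simp only: UNIV_I space_path_space simp_thms)
      qed
      show "{\<omega>\<in>space M. \<exists>i. Suc n * arrival V i \<omega> < max_functional P (\<lambda>t. C i \<omega> (t + k))} \<in> sets M"
        by measurable
      show "{\<omega>\<in>space M. (\<lambda>t. ?X \<omega> (t + k)) \<in> exc (Suc n)} \<in> sets M"
        using measurable_sets[OF Xk exc[of "Suc n"]] by (simp add: vimage_def Int_def conj_commute)
    qed
    also have "\<dots> = emeasure (distr M path_space (\<lambda>\<omega> t. ?X \<omega> (t + k))) (exc (Suc n))"
      by (subst emeasure_distr[OF Xk exc]) (auto intro!: arg_cong[where f="emeasure M"])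
    also have "distr M path_space (\<lambda>\<omega> t. ?X \<omega> (t + k)) = distr M path_space ?X"
      using stat by (auto simp: stationary_field_def)
    finally show ?thesis .
  qed
  have lim: "(\<lambda>n. ennreal (Suc n) * emeasure (distr M path_space ?X) (exc (Suc n)))
    \<longlonglongrightarrow> (\<integral>\<^sup>+\<omega>. ennreal (max_functional P (\<lambda>t. Z \<omega> (t + k))) \<partial>M)" for k
    using max_stable_tail[OF assms(1) ingr Z max_shift]
    by (simp add: tail del: of_nat_Suc)
  show ?thesis
    using LIMSEQ_unique[OF lim[of h] lim[of 0]] by simp
qed

text \<open>
  The difference quotient of \<open>c \<mapsto> max (c u) m\<close> at \<open>c = 1\<close> from the right lies between \<open>0\<close> and \<open>u\<close> and tends to
  \<open>u\<close> if \<open>m \<le> u\<close> and to \<open>0\<close> otherwise.  Maximum moments therefore determine how much mass of \<open>U 0\<close> lies on the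
  event that \<open>U 0\<close> dominates all the weighted values.
\<close>

lemma max_functional_right_derivative:
  fixes U :: "'a \<Rightarrow> 't::zero \<Rightarrow> real"
  assumes int: "\<And>t. integrable M (\<lambda>\<omega>. U \<omega> t)" and nonneg: "\<And>t. AE \<omega> in M. 0 \<le> U \<omega> t"
    and P: "finite P"
  shows "integrable M (\<lambda>\<omega>. max_functional P (U \<omega>))"
    and "(\<lambda>n. Suc n * ((\<integral>\<omega>. max_functional (insert (1 + 1 / Suc n, 0) P) (U \<omega>) \<partial>M) -
            (\<integral>\<omega>. max_functional (insert (1, 0) P) (U \<omega>) \<partial>M)))
        \<longlonglongrightarrow> (\<integral>\<omega>. U \<omega> 0 * indicator {\<omega>. max_functional P (U \<omega>) \<le> U \<omega> 0} \<omega> \<partial>M)"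
proof -
  have [measurable]: "(\<lambda>\<omega>. U \<omega> t) \<in> borel_measurable M" for t
    using int by auto
  have int_max: "integrable M (\<lambda>\<omega>. max_functional P (U \<omega>))" if "finite P" for P
    using that
  proof (induction P)
    case empty
    then show ?case by (simp add: max_functional_def)
  next
    case (insert p P)
    obtain a t where p: "p = (a, t)" by (cases p)
    show ?case
      unfolding p max_functional_insert[OF insert.hyps(1)] using insert.IH int by (intro integrable_max) auto
  qed
  show "integrable M (\<lambda>\<omega>. max_functional P (U \<omega>))"
    by (rule int_max[OF P])
  have [measurable]: "(\<lambda>\<omega>. max_functional P (U \<omega>)) \<in> borel_measurable M"
    using int_max[OF P] by auto
  let ?q = "\<lambda>n \<omega>. Suc n * (max ((1 + 1 / Suc n) * U \<omega> 0) (max_functional P (U \<omega>)) - max (U \<omega> 0) (max_functional P (U \<omega>)))"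
  have "Suc n * ((\<integral>\<omega>. max_functional (insert (1 + 1 / Suc n, 0) P) (U \<omega>) \<partial>M) -
            (\<integral>\<omega>. max_functional (insert (1, 0) P) (U \<omega>) \<partial>M)) = (\<integral>\<omega>. ?q n \<omega> \<partial>M)" for n
  proof -
    have "integrable M (\<lambda>\<omega>. max_functional (insert (c, 0) P) (U \<omega>))" for c
      using P by (intro int_max) auto
    note this[unfolded max_functional_insert[OF P]]
    from this[of "1 + 1 / Suc n"] this[of 1] show ?thesis
      unfolding max_functional_insert[OF P] by (simp del: of_nat_Suc)
  qed
  moreover have "(\<lambda>n. \<integral>\<omega>. ?q n \<omega> \<partial>M) \<longlonglongrightarrow> (\<integral>\<omega>. U \<omega> 0 * indicator {\<omega>. max_functional P (U \<omega>) \<le> U \<omega> 0} \<omega> \<partial>M)"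
  proof (rule integral_dominated_convergence[where w="\<lambda>\<omega>. U \<omega> 0"])
    show "(\<lambda>\<omega>. U \<omega> 0 * indicator {\<omega>. max_functional P (U \<omega>) \<le> U \<omega> 0} \<omega>) \<in> borel_measurable M"
      by measurable
    show "?q n \<in> borel_measurable M" for n
      by measurable
    show "integrable M (\<lambda>\<omega>. U \<omega> 0)" by (rule int)
    have q: "(0::real) \<le> u \<Longrightarrow> 0 < k \<Longrightarrow> \<bar>k * (max ((1 + 1/k) * u) m - max u m)\<bar> \<le> u" for u m k
    proof -
      assume "0 \<le> u" "0 < k"
      then have "0 \<le> u / k" by simp
      then have "0 \<le> max (u + u/k) m - max u m" "max (u + u/k) m - max u m \<le> u / k" by auto
      then have "0 \<le> k * (max (u + u/k) m - max u m)" "k * (max (u + u/k) m - max u m) \<le> u"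
        using \<open>0 < k\<close> by (simp_all add: pos_le_divide_eq mult.commute)
      moreover have "(1 + 1/k) * u = u + u / k" by (simp add: field_simps)
      ultimately show ?thesis using \<open>0 < k\<close> by simp
    qed
    show "AE \<omega> in M. norm (?q n \<omega>) \<le> U \<omega> 0" for n
      using nonneg[of 0] by eventually_elim (auto intro!: q simp del: of_nat_Suc)
    show "AE \<omega> in M. (\<lambda>n. ?q n \<omega>) \<longlonglongrightarrow> U \<omega> 0 * indicator {\<omega>. max_functional P (U \<omega>) \<le> U \<omega> 0} \<omega>"
      using nonneg[of 0]
    proof eventually_elim
      fix \<omega> assume u: "0 \<le> U \<omega> 0"
      let ?u = "U \<omega> 0" and ?m = "max_functional P (U \<omega>)"
      show "(\<lambda>n. ?q n \<omega>) \<longlonglongrightarrow> ?u * indicator {\<omega>. max_functional P (U \<omega>) \<le> U \<omega> 0} \<omega>"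
      proof (cases "?m \<le> ?u")
        case True
        have "?q n \<omega> = ?u" for n
        proof -
          have "?u \<le> (1 + 1 / Suc n) * ?u" using u by (simp add: field_simps)
          then have "?m \<le> (1 + 1 / Suc n) * ?u" using True by simp
          then show ?thesis
            unfolding max_absorb1[OF True] by (subst max_absorb1) (auto simp: field_simps)
        qed
        then show ?thesis using True by simp
      next
        case False
        have "(\<lambda>n. (1 + inverse (real (Suc n))) * ?u) \<longlonglongrightarrow> (1 + 0) * ?u"
          by (intro tendsto_intros LIMSEQ_inverse_real_of_nat)
        then have "eventually (\<lambda>n. (1 + inverse (real (Suc n))) * ?u < ?m) sequentially"
          using False by (intro order_tendstoD) auto
        then have "eventually (\<lambda>n. ?q n \<omega> = 0) sequentially"
          by (rule eventually_mono) (use False in \<open>auto simp: inverse_eq_divide max_def\<close>)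
        then show ?thesis using False by (simp add: tendsto_eventually)
      qed
    qed
  qed
  ultimately show "(\<lambda>n. Suc n * ((\<integral>\<omega>. max_functional (insert (1 + 1 / Suc n, 0) P) (U \<omega>) \<partial>M) -
            (\<integral>\<omega>. max_functional (insert (1, 0) P) (U \<omega>) \<partial>M)))
        \<longlonglongrightarrow> (\<integral>\<omega>. U \<omega> 0 * indicator {\<omega>. max_functional P (U \<omega>) \<le> U \<omega> 0} \<omega> \<partial>M)"
    by simp
qed

text \<open>
  Boxes form an intersection-stable generator.  Positive bounds suffice: a box with a negative
  bound is null, and a box with nonnegative bounds is a decreasing intersection of boxes with positive
  ones.
\<close>

lemma path_space_measure_eqI:
  fixes M N :: "('t \<Rightarrow> real) measure"
  assumes sets: "sets M = sets path_space" "sets N = sets path_space"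
    and fin: "finite_measure M" "finite_measure N"
    and nonneg: "\<And>t. AE f in M. 0 \<le> f t" "\<And>t. AE f in N. 0 \<le> f t"
    and eq: "\<And>J b. finite J \<Longrightarrow> (\<And>t. 0 < b t) \<Longrightarrow>
      emeasure M {f. \<forall>t\<in>J. f t \<le> b t} = emeasure N {f. \<forall>t\<in>J. f t \<le> b t}"
  shows "M = N"
proof -
  define box where "box J b = {f :: 't \<Rightarrow> real. \<forall>t\<in>J. f t \<le> b t}" for J b
  define E where "E = {box J b | J b. finite J}"
  have box [measurable]: "box J b \<in> sets path_space" if "finite J" for J b
  proof -
    have "{f \<in> space path_space. f t \<le> b t} \<in> sets path_space" for t
      by measurable
    then have "{f \<in> space path_space. \<forall>t\<in>J. f t \<le> b t} \<in> sets path_space"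
      using that by (intro sets.sets_Collect_finite_All)
    then show ?thesis by (simp add: box_def)
  qed
  have sp: "space M = UNIV" "space N = UNIV"
    using sets_eq_imp_space_eq[OF sets(1)] sets_eq_imp_space_eq[OF sets(2)] by auto
  have gen: "sets path_space = sigma_sets UNIV E"
  proof
    show "sigma_sets UNIV E \<subseteq> sets path_space"
    proof -
      have "E \<subseteq> sets path_space" by (auto simp: E_def box)
      then show ?thesis using sets.sigma_sets_subset[of E path_space] by simp
    qed
    have "(\<lambda>f. f) \<in> sigma UNIV E \<rightarrow>\<^sub>M path_space"
    proof (rule measurable_path_spaceI)
      show "(\<lambda>f. f t) \<in> borel_measurable (sigma UNIV E)" for t :: 't
      proof (rule borel_measurableI_le)
        fix y :: real
        have "box {t} (\<lambda>_. y) \<in> sigma_sets UNIV E"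
          by (auto simp: E_def)
        then show "{x \<in> space (sigma UNIV E). x t \<le> y} \<in> sets (sigma UNIV E)"
          by (simp add: box_def)
      qed
    qed
    from measurable_sets[OF this] show "sets path_space \<subseteq> sigma_sets UNIV E"
      by auto
  qed
  have lim: "(\<lambda>n. emeasure L (box J (\<lambda>t. b t + 1 / Suc n))) \<longlonglongrightarrow> emeasure L (box J b)"
    if L: "sets L = sets path_space" "finite_measure L" and J: "finite J" for L J b
  proof -
    interpret L: finite_measure L by fact
    have "(\<lambda>n. emeasure L (box J (\<lambda>t. b t + 1 / Suc n))) \<longlonglongrightarrow> emeasure L (\<Inter>n. box J (\<lambda>t. b t + 1 / Suc n))"
    proof (rule Lim_emeasure_decseq)
      show "range (\<lambda>n. box J (\<lambda>t. b t + 1 / Suc n)) \<subseteq> sets L"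
        using box[OF J] L(1) by auto
      have "1 / real (Suc n) \<le> 1 / real (Suc m)" if "m \<le> n" for m n
        using that by (intro divide_left_mono) auto
      then show "decseq (\<lambda>n. box J (\<lambda>t. b t + 1 / Suc n))"
        unfolding box_def decseq_def by (fastforce simp del: of_nat_Suc)
    qed (simp add: L.emeasure_finite)
    moreover have "(\<Inter>n. box J (\<lambda>t. b t + 1 / Suc n)) = box J b"
    proof (safe)
      fix f assume f: "f \<in> (\<Inter>n. box J (\<lambda>t. b t + 1 / Suc n))"
      have "f t \<le> b t" if "t \<in> J" for t
      proof (rule LIMSEQ_le_const)
        have "(\<lambda>n. b t + inverse (real (Suc n))) \<longlonglongrightarrow> b t + 0"
          by (intro tendsto_intros LIMSEQ_inverse_real_of_nat)
        then show "(\<lambda>n. b t + 1 / Suc n) \<longlonglongrightarrow> b t"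
          by (simp add: inverse_eq_divide)
        show "\<exists>N. \<forall>n\<ge>N. f t \<le> b t + 1 / Suc n"
          using f that by (auto simp: box_def)
      qed
      then show "f \<in> box J b" by (simp add: box_def)
    next
      fix f n assume "f \<in> box J b"
      then show "f \<in> box J (\<lambda>t. b t + 1 / Suc n)"
        by (auto simp: box_def intro: order_trans)
    qed
    ultimately show ?thesis by simp
  qed
  have eq_box: "emeasure M (box J b) = emeasure N (box J b)" if J: "finite J" for J b
  proof (cases "\<forall>t\<in>J. 0 \<le> b t")
    case True
    define b' where "b' t = (if t \<in> J then b t else 0)" for t
    have b': "box J b = box J b'" "\<And>t. 0 \<le> b' t"
      using True by (auto simp: box_def b'_def)
    have pos: "0 < b' t + 1 / real (Suc n)" for t n
      using b'(2)[of t] by (intro add_nonneg_pos) auto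
    have "emeasure M (box J (\<lambda>t. b' t + 1 / Suc n)) = emeasure N (box J (\<lambda>t. b' t + 1 / Suc n))" for n
      unfolding box_def by (rule eq[OF J pos])
    then show ?thesis
      unfolding b'(1) using LIMSEQ_unique[OF lim[OF sets(1) fin(1) J] _, of b'] lim[OF sets(2) fin(2) J, of b'] by simp
  next
    case False
    then obtain t where t: "t \<in> J" "b t < 0" by auto
    have "emeasure L (box J b) = 0" if "AE f in L. 0 \<le> f t" "sets L = sets path_space" for L
    proof -
      have "AE f in L. f \<notin> box J b"
        using that(1) by eventually_elim (use t in \<open>force simp: box_def\<close>)
      then show ?thesis
        using box[OF J, of b] that(2) by (subst (asm) AE_iff_measurable) (auto simp: sets_eq_imp_space_eq[OF that(2)])
    qed
    then show ?thesis using nonneg sets by simp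
  qed
  show ?thesis
  proof (rule measure_eqI_generator_eq[where E=E and \<Omega>=UNIV and A="\<lambda>_. UNIV"])
    show "Int_stable E"
    proof (rule Int_stableI)
      fix A B assume "A \<in> E" "B \<in> E"
      then obtain J b K c where AB: "A = box J b" "B = box K c" "finite J" "finite K"
        by (auto simp: E_def)
      define e where "e t = (if t \<in> J then if t \<in> K then min (b t) (c t) else b t else c t)" for t
      have "A \<inter> B = box (J \<union> K) e"
        unfolding AB box_def e_def by (auto split: if_splits)
      then show "A \<inter> B \<in> E" using AB by (auto simp: E_def)
    qed
    show "emeasure M X = emeasure N X" if "X \<in> E" for X
      using that eq_box by (auto simp: E_def)
    have "UNIV = box {} (\<lambda>_. 0)" by (simp add: box_def)
    then show "range (\<lambda>_. UNIV) \<subseteq> E" by (auto simp: E_def)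
    show "emeasure M UNIV \<noteq> \<infinity>"
      using finite_measure.emeasure_finite[OF fin(1)] by auto
  qed (use sets gen in auto)
qed

text \<open>
  The law of the field seen from \<open>h\<close>, normalised by its value there and weighted by that value.
  For \<open>h = 0\<close> this is the law \<open>\<mu>\<close> of \<open>\<Theta>\<close>.  Division by zero is harmless because the weight vanishes there.
\<close>

definition spectral_law :: "'a measure \<Rightarrow> ('a \<Rightarrow> real ^ 'd \<Rightarrow> real) \<Rightarrow> real ^ 'd \<Rightarrow> (real ^ 'd \<Rightarrow> real) measure" where
  "spectral_law M Z h = distr (density M (\<lambda>\<omega>. ennreal (Z \<omega> h))) path_space (\<lambda>\<omega> t. Z \<omega> (t + h) / Z \<omega> h)"

text \<open>
  This is the form in which the stationarity of \<open>X\<close> is used below.  A bound \<open>b\<close> on the ratio \<open>Z(t + h) / Z(h)\<close>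
  is the condition that \<open>Z(h)\<close> dominates \<open>Z(t + h)\<close> with weight \<open>1 / b\<close>.
\<close>

lemma spectral_law_shift:
  fixes Z :: "'a \<Rightarrow> real ^ 'd \<Rightarrow> real"
  assumes "prob_space M" and ingr: "max_stable_ingredients M V C Z"
    and stat: "stationary_field M (max_stable_field V C)"
    and Z: "Z \<in> M \<rightarrow>\<^sub>M path_space" and nonneg: "\<And>t. AE \<omega> in M. 0 \<le> Z \<omega> t"
    and int: "\<And>t. integrable M (\<lambda>\<omega>. Z \<omega> t)"
  shows "spectral_law M Z h = spectral_law M Z 0"
proof -
  interpret prob_space M by fact
  have [measurable]: "(\<lambda>\<omega>. Z \<omega> t) \<in> borel_measurable M" for t
    by (rule measurable_path_value[OF Z])
  have [measurable]: "(\<lambda>\<omega> t. Z \<omega> (t + k) / Z \<omega> k) \<in> M \<rightarrow>\<^sub>M path_space" for k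
    by (rule measurable_path_spaceI) measurable
  have mom: "(\<integral>\<omega>. max_functional P (\<lambda>t. Z \<omega> (t + h)) \<partial>M) = (\<integral>\<omega>. max_functional P (Z \<omega>) \<partial>M)"
    if P: "finite P" "\<And>a t. (a, t) \<in> P \<Longrightarrow> 0 < a" for P
  proof -
    have "ennreal (\<integral>\<omega>. max_functional P (\<lambda>t. Z \<omega> (t + k)) \<partial>M) = (\<integral>\<^sup>+\<omega>. ennreal (max_functional P (\<lambda>t. Z \<omega> (t + k))) \<partial>M)" for k
      using max_functional_right_derivative(1)[where U="\<lambda>\<omega> t. Z \<omega> (t + k)", OF int nonneg P(1)] P(1)
      by (intro nn_integral_eq_integral[symmetric]) (auto simp: max_functional_nonneg)
    note eq = this
    have "(\<integral>\<^sup>+\<omega>. ennreal (max_functional P (\<lambda>t. Z \<omega> (t + h))) \<partial>M) = (\<integral>\<^sup>+\<omega>. ennreal (max_functional P (\<lambda>t. Z \<omega> (t + 0))) \<partial>M)"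
      unfolding add_0_right
      by (rule nn_integral_max_functional_shift[OF assms(1) ingr Z stat P])
    then show ?thesis
      unfolding eq[symmetric] using P(1)
      by (subst (asm) ennreal_inj) (auto intro!: integral_nonneg_AE simp: max_functional_nonneg)
  qed
  have box: "(\<integral>\<omega>. Z \<omega> h * indicator {\<omega>. max_functional P (\<lambda>t. Z \<omega> (t + h)) \<le> Z \<omega> h} \<omega> \<partial>M) =
      (\<integral>\<omega>. Z \<omega> 0 * indicator {\<omega>. max_functional P (Z \<omega>) \<le> Z \<omega> 0} \<omega> \<partial>M)"
    if P: "finite P" "\<And>a t. (a, t) \<in> P \<Longrightarrow> 0 < a" for P
  proof -
    have "(\<integral>\<omega>. max_functional (insert (1 + 1 / Suc n, 0) P) (\<lambda>t. Z \<omega> (t + h)) \<partial>M) = (\<integral>\<omega>. max_functional (insert (1 + 1 / Suc n, 0) P) (Z \<omega>) \<partial>M)" for n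
      using P by (intro mom) (auto intro: add_pos_pos)
    moreover have "(\<integral>\<omega>. max_functional (insert (1, 0) P) (\<lambda>t. Z \<omega> (t + h)) \<partial>M) = (\<integral>\<omega>. max_functional (insert (1, 0) P) (Z \<omega>) \<partial>M)"
      using P by (intro mom) auto
    ultimately show ?thesis
      using LIMSEQ_unique[OF max_functional_right_derivative(2)[where U="\<lambda>\<omega> t. Z \<omega> (t + h)", OF int nonneg P(1)]]
        max_functional_right_derivative(2)[where U=Z, OF int nonneg P(1)] by (simp del: of_nat_Suc)
  qed
  have law: "emeasure (spectral_law M Z k) A = (\<integral>\<^sup>+\<omega>. ennreal (Z \<omega> k) * indicator A (\<lambda>t. Z \<omega> (t + k) / Z \<omega> k) \<partial>M)"
    if [measurable]: "A \<in> sets path_space" for k A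
  proof -
    have "(\<lambda>\<omega> t. Z \<omega> (t + k) / Z \<omega> k) -` A \<inter> space M \<in> sets M"
      by measurable
    then show ?thesis
      unfolding spectral_law_def
      by (auto simp: emeasure_distr emeasure_density indicator_def intro!: nn_integral_cong)
  qed
  show ?thesis
  proof (rule path_space_measure_eqI)
    have fin: "finite_measure (spectral_law M Z k)" for k
    proof (rule finite_measureI)
      have "(\<integral>\<^sup>+\<omega>. ennreal (Z \<omega> k) \<partial>M) = ennreal (\<integral>\<omega>. Z \<omega> k \<partial>M)"
        using int nonneg by (intro nn_integral_eq_integral)
      then show "emeasure (spectral_law M Z k) (space (spectral_law M Z k)) \<noteq> \<infinity>"
        using law[of UNIV k] sets.top[of "path_space :: (real ^ 'd \<Rightarrow> real) measure"] by (simp add: spectral_law_def)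
    qed
    have nn: "AE f in spectral_law M Z k. 0 \<le> f t" for k t
    proof -
      have "AE \<omega> in M. 0 \<le> Z \<omega> (t + k) / Z \<omega> k"
        using nonneg[of "t + k"] nonneg[of k] by eventually_elim simp
      moreover have "{f \<in> space path_space. 0 \<le> f t} \<in> sets (path_space :: (real ^ 'd \<Rightarrow> real) measure)"
        by measurable
      ultimately show ?thesis
        unfolding spectral_law_def by (subst AE_distr_iff) (auto simp: AE_density)
    qed
    show "finite_measure (spectral_law M Z h)" "finite_measure (spectral_law M Z 0)"
      by (rule fin)+
    show "AE f in spectral_law M Z h. 0 \<le> f t" "AE f in spectral_law M Z 0. 0 \<le> f t" for t
      by (rule nn)+
    show "emeasure (spectral_law M Z h) {f. \<forall>t\<in>J. f t \<le> b t} = emeasure (spectral_law M Z 0) {f. \<forall>t\<in>J. f t \<le> b t}"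
      if J: "finite J" and b: "\<And>t. 0 < b t" for J b
    proof -
      \<comment> \<open>The weight \<open>1 / b t\<close> turns a bound on the ratio into domination by the value at the origin.\<close>
      define P where "P = (\<lambda>t. (1 / b t, t)) ` J"
      have P: "finite P" "\<And>a t. (a, t) \<in> P \<Longrightarrow> 0 < a"
        using J b by (auto simp: P_def)
      have A: "{f. \<forall>t\<in>J. f t \<le> b t} \<in> sets path_space"
      proof -
        have "{f \<in> space path_space. f t \<le> b t} \<in> sets path_space" for t
          by measurable
        then have "{f \<in> space path_space. \<forall>t\<in>J. f t \<le> b t} \<in> sets path_space"
          using J by (intro sets.sets_Collect_finite_All)
        then show ?thesis by simp
      qed
      have "emeasure (spectral_law M Z k) {f. \<forall>t\<in>J. f t \<le> b t} =
        ennreal (\<integral>\<omega>. Z \<omega> k * indicator {\<omega>. max_functional P (\<lambda>t. Z \<omega> (t + k)) \<le> Z \<omega> k} \<omega> \<partial>M)" for k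
      proof -
        have [measurable]: "(\<lambda>\<omega>. max_functional P (\<lambda>t. Z \<omega> (t + k))) \<in> borel_measurable M"
          using max_functional_right_derivative(1)[where U="\<lambda>\<omega> t. Z \<omega> (t + k)", OF int nonneg P(1)] by auto
        have "emeasure (spectral_law M Z k) {f. \<forall>t\<in>J. f t \<le> b t} =
            (\<integral>\<^sup>+\<omega>. ennreal (Z \<omega> k * indicator {\<omega>. max_functional P (\<lambda>t. Z \<omega> (t + k)) \<le> Z \<omega> k} \<omega>) \<partial>M)"
          unfolding law[OF A]
        proof (rule nn_integral_cong_AE)
          show "AE \<omega> in M. ennreal (Z \<omega> k) * indicator {f. \<forall>t\<in>J. f t \<le> b t} (\<lambda>t. Z \<omega> (t + k) / Z \<omega> k) =
              ennreal (Z \<omega> k * indicator {\<omega>. max_functional P (\<lambda>t. Z \<omega> (t + k)) \<le> Z \<omega> k} \<omega>)"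
            using nonneg[of k]
          proof eventually_elim
            fix \<omega> assume z: "0 \<le> Z \<omega> k"
            have "(\<forall>t\<in>J. Z \<omega> (t + k) / Z \<omega> k \<le> b t) \<longleftrightarrow> max_functional P (\<lambda>t. Z \<omega> (t + k)) \<le> Z \<omega> k" if "0 < Z \<omega> k"
              using that P(1) z b by (auto simp: max_functional_le_iff P_def field_simps)
            then show "ennreal (Z \<omega> k) * indicator {f. \<forall>t\<in>J. f t \<le> b t} (\<lambda>t. Z \<omega> (t + k) / Z \<omega> k) =
              ennreal (Z \<omega> k * indicator {\<omega>. max_functional P (\<lambda>t. Z \<omega> (t + k)) \<le> Z \<omega> k} \<omega>)"
              using z by (cases "Z \<omega> k = 0") (auto simp: indicator_def)
          qed
        qed
        also have "\<dots> = ennreal (\<integral>\<omega>. Z \<omega> k * indicator {\<omega>. max_functional P (\<lambda>t. Z \<omega> (t + k)) \<le> Z \<omega> k} \<omega> \<partial>M)"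
        proof (rule nn_integral_eq_integral)
          show "integrable M (\<lambda>\<omega>. Z \<omega> k * indicator {\<omega>. max_functional P (\<lambda>t. Z \<omega> (t + k)) \<le> Z \<omega> k} \<omega>)"
            by (rule Bochner_Integration.integrable_bound[OF int[of k]]) (auto simp: indicator_def)
          show "AE \<omega> in M. 0 \<le> Z \<omega> k * indicator {\<omega>. max_functional P (\<lambda>t. Z \<omega> (t + k)) \<le> Z \<omega> k} \<omega>"
            using nonneg[of k] by eventually_elim simp
        qed
        finally show ?thesis .
      qed
      from this[of h] this[of 0] show ?thesis
        using box[OF P] by simp
    qed
  qed (auto simp: spectral_law_def)
qed

section \<open>Grid integrals and sojourn functionals of paths\<close>

text \<open>
  The lower corner of the grid cell of \<open>t\<close>.  Integrals over the grid become Lebesgue integrals of step functions,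
  so that the discrete and the continuous case, \<open>\<delta> = 0\<close>, are treated together.
\<close>

definition grid_floor :: "real \<Rightarrow> real ^ 'd \<Rightarrow> real ^ 'd" where
  "grid_floor \<delta> t = (if \<delta> = 0 then t else (\<chi> i. \<delta> * of_int \<lfloor>t $ i / \<delta>\<rfloor>))"

lemma measurable_vec_component [measurable]: "(\<lambda>t::real^'d. t $ i) \<in> borel_measurable borel"
  by (intro borel_measurable_continuous_onI continuous_intros)

lemma measurable_vec_lambdaI:
  assumes "\<And>i. (\<lambda>x. f x $ i) \<in> borel_measurable M"
  shows "(f :: 'a \<Rightarrow> real ^ 'd) \<in> borel_measurable M"
proof (subst borel_measurable_euclidean_space, intro ballI)
  fix b :: "real ^ 'd" assume "b \<in> Basis"
  then obtain i where "b = axis i 1" by (auto simp: Basis_vec_def)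
  then show "(\<lambda>x. f x \<bullet> b) \<in> borel_measurable M"
    using assms[of i] by (simp add: inner_axis)
qed

lemma measurable_grid_floor [measurable]: "grid_floor \<delta> \<in> borel_measurable borel"
proof (rule measurable_vec_lambdaI)
  fix i show "(\<lambda>x. grid_floor \<delta> x $ i) \<in> borel_measurable borel"
    by (cases "\<delta> = 0") (simp_all add: grid_floor_def)
qed

lemma grid_floor_in_grid: "grid_floor \<delta> t \<in> grid \<delta>"
  by (auto simp: grid_floor_def grid_def)

lemma grid_floor_add:
  assumes "p \<in> grid \<delta>" shows "grid_floor \<delta> (t + p) = grid_floor \<delta> t + p"
proof (cases "\<delta> = 0")
  case False
  show ?thesis
  proof (rule vec_eq_iff[THEN iffD2], rule)
    fix i
    obtain k where "p $ i = \<delta> * of_int k"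
      using assms False by (auto simp: grid_def)
    then show "grid_floor \<delta> (t + p) $ i = (grid_floor \<delta> t + p) $ i"
      using False by (simp add: grid_floor_def add_divide_distrib distrib_left)
  qed
qed (simp add: grid_floor_def)

lemma grid_floor_bounds:
  assumes "0 \<le> \<delta>" shows "grid_floor \<delta> t $ i \<le> t $ i" "t $ i \<le> grid_floor \<delta> t $ i + \<delta>"
proof -
  have "\<delta> * of_int \<lfloor>t $ i / \<delta>\<rfloor> \<le> t $ i \<and> t $ i \<le> \<delta> * of_int \<lfloor>t $ i / \<delta>\<rfloor> + \<delta>" if "0 < \<delta>"
  proof -
    have "of_int \<lfloor>t $ i / \<delta>\<rfloor> * \<delta> \<le> t $ i" "t $ i < (of_int \<lfloor>t $ i / \<delta>\<rfloor> + 1) * \<delta>"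
      using that by (rule floor_divide_lower, rule floor_divide_upper)
    then show ?thesis by (simp add: distrib_left mult.commute)
  qed
  then show "grid_floor \<delta> t $ i \<le> t $ i" "t $ i \<le> grid_floor \<delta> t $ i + \<delta>"
    using assms by (auto simp: grid_floor_def)
qed

lemma emeasure_lborel_between_cubes:
  fixes A :: "(real ^ 'd) set"
  assumes A: "A \<in> sets borel" "box p (p + vec c) \<subseteq> A" "A \<subseteq> cbox p (p + vec c)" and c: "0 \<le> c"
  shows "emeasure lborel A = ennreal (c ^ CARD('d))"
proof -
  have b: "vec c \<bullet> b = c" if "b \<in> Basis" for b :: "real ^ 'd"
    using that by (auto simp: Basis_vec_def inner_axis)
  have "(\<Prod>b\<in>Basis. (p + vec c - p) \<bullet> b) = (\<Prod>b\<in>(Basis :: (real ^ 'd) set). c)"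
    by (intro prod.cong) (auto simp: b)
  also have "\<dots> = c ^ CARD('d)" by simp
  finally have prod: "(\<Prod>b\<in>Basis. (p + vec c - p) \<bullet> b) = c ^ CARD('d)" .
  have le: "\<And>b. b \<in> Basis \<Longrightarrow> p \<bullet> b \<le> (p + vec c) \<bullet> b"
    using c by (simp add: inner_add_left b)
  have "emeasure lborel (box p (p + vec c)) = ennreal (c ^ CARD('d))"
    unfolding prod[symmetric] using le by (rule emeasure_lborel_box)
  moreover have "emeasure lborel (cbox p (p + vec c)) = ennreal (c ^ CARD('d))"
    unfolding prod[symmetric] using le by (rule emeasure_lborel_cbox)
  moreover have "emeasure lborel (box p (p + vec c)) \<le> emeasure lborel A" "emeasure lborel A \<le> emeasure lborel (cbox p (p + vec c))"
    using A by (auto intro!: emeasure_mono)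
  ultimately show ?thesis by simp
qed

text \<open>
  Each cell has volume \<open>\<delta>\<^sup>d\<close>, which is the mass of its corner.
\<close>

lemma nn_integral_grid_measure:
  assumes "0 \<le> \<delta>"
  shows "(\<integral>\<^sup>+t. g t \<partial>grid_measure \<delta>) = (\<integral>\<^sup>+t. g (grid_floor \<delta> t) \<partial>(lborel :: (real ^ 'd) measure))"
proof (cases "\<delta> = 0")
  case True
  then show ?thesis by (simp add: grid_measure_def grid_floor_def)
next
  case False
  with assms have \<delta>: "0 < \<delta>" by simp
  define cell where "cell p = {t. grid_floor \<delta> t = p}" for p :: "real ^ 'd"
  have [measurable]: "cell p \<in> sets borel" for p
  proof -
    have "grid_floor \<delta> -` {p} \<inter> space borel \<in> sets borel" by measurable
    then show ?thesis by (simp add: cell_def vimage_def)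
  qed
  have cell: "emeasure lborel (cell p) = ennreal (\<delta> ^ CARD('d))" if p: "p \<in> grid \<delta>" for p :: "real ^ 'd"
  proof (rule emeasure_lborel_between_cubes[where p=p])
    show "box p (p + vec \<delta>) \<subseteq> cell p"
    proof
      fix t assume t: "t \<in> box p (p + vec \<delta>)"
      show "t \<in> cell p"
        unfolding cell_def mem_Collect_eq
      proof (rule vec_eq_iff[THEN iffD2], rule)
        fix i
        obtain k where k: "p $ i = \<delta> * of_int k"
          using p False by (auto simp: grid_def)
        have "\<delta> * of_int k < t $ i" "t $ i < \<delta> * of_int k + \<delta>"
          using t unfolding k[symmetric] by (simp_all add: mem_box_cart)
        then have "of_int k \<le> t $ i / \<delta>" "t $ i / \<delta> < of_int k + 1"
          using \<delta> by (auto simp: field_simps)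
        then have "\<lfloor>t $ i / \<delta>\<rfloor> = k" by linarith
        then show "grid_floor \<delta> t $ i = p $ i"
          using False k by (simp add: grid_floor_def)
      qed
    qed
    show "cell p \<subseteq> cbox p (p + vec \<delta>)"
      using grid_floor_bounds[OF assms] by (auto simp: cell_def mem_box_cart)
  qed (use assms in auto)
  have count: "countable (grid \<delta> :: (real ^ 'd) set)"
  proof -
    have "grid \<delta> \<subseteq> range (\<lambda>k :: 'd \<Rightarrow> int. (\<chi> i. \<delta> * of_int (k i)) :: real ^ 'd)"
    proof
      fix p :: "real ^ 'd" assume "p \<in> grid \<delta>"
      then have "\<forall>i. \<exists>k::int. p $ i = \<delta> * of_int k"
        using False by (simp add: grid_def)
      then obtain k where "\<forall>i. p $ i = \<delta> * of_int (k i)"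
        by metis
      then have "p = (\<chi> i. \<delta> * of_int (k i))" by (simp add: vec_eq_iff)
      then show "p \<in> range (\<lambda>k :: 'd \<Rightarrow> int. (\<chi> i. \<delta> * of_int (k i)) :: real ^ 'd)" by blast
    qed
    then show ?thesis
      by (rule countable_subset) simp
  qed
  have "(\<integral>\<^sup>+t. g t \<partial>grid_measure \<delta>) = ennreal (\<delta> ^ CARD('d)) * (\<integral>\<^sup>+p. g p \<partial>count_space (grid \<delta> :: (real ^ 'd) set))"
    using False by (simp add: grid_measure_def nn_integral_scale_measure)
  also have "\<dots> = (\<integral>\<^sup>+p. ennreal (\<delta> ^ CARD('d)) * g p \<partial>count_space (grid \<delta> :: (real ^ 'd) set))"
    by (simp add: nn_integral_cmult)
  also have "\<dots> = (\<integral>\<^sup>+p. (\<integral>\<^sup>+t. g p * indicator (cell p) t \<partial>lborel) \<partial>count_space (grid \<delta>))"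
    by (intro nn_integral_cong) (simp add: nn_integral_cmult_indicator cell mult.commute)
  also have "\<dots> = (\<integral>\<^sup>+t. (\<integral>\<^sup>+p. g p * indicator (cell p) t \<partial>count_space (grid \<delta>)) \<partial>lborel)"
    using count by (intro nn_integral_count_space_nn_integral[symmetric]) auto
  also have "\<dots> = (\<integral>\<^sup>+t. g (grid_floor \<delta> t) \<partial>lborel)"
  proof (rule nn_integral_cong)
    fix t :: "real ^ 'd"
    have "(\<integral>\<^sup>+p. g p * indicator (cell p) t \<partial>count_space (grid \<delta>)) = (\<Sum>p\<in>{grid_floor \<delta> t}. g p * indicator (cell p) t)"
      by (rule nn_integral_count_space') (auto simp: cell_def grid_floor_in_grid)
    then show "(\<integral>\<^sup>+p. g p * indicator (cell p) t \<partial>count_space (grid \<delta>)) = g (grid_floor \<delta> t)"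
      by (simp add: cell_def)
  qed
  finally show ?thesis .
qed

lemma nn_integral_lborel_shift:
  fixes g :: "'a::euclidean_space \<Rightarrow> ennreal"
  assumes [measurable]: "g \<in> borel_measurable borel"
  shows "(\<integral>\<^sup>+t. g (t + p) \<partial>lborel) = (\<integral>\<^sup>+t. g t \<partial>lborel)"
proof -
  have "(\<integral>\<^sup>+t. g t \<partial>lborel) = (\<integral>\<^sup>+t. g t \<partial>distr lborel borel ((+) p))"
    by (simp add: lborel_distr_plus)
  also have "\<dots> = (\<integral>\<^sup>+t. g (p + t) \<partial>lborel)"
    by (rule nn_integral_distr) simp_all
  finally show ?thesis by (simp add: add.commute)
qed

lemma nn_integral_lborel_scale:
  fixes g :: "real ^ 'd \<Rightarrow> ennreal"
  assumes [measurable]: "g \<in> borel_measurable borel" and "0 < T"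
  shows "(\<integral>\<^sup>+t. g t \<partial>lborel) = ennreal (T ^ CARD('d)) * (\<integral>\<^sup>+t. g (T *\<^sub>R t) \<partial>lborel)"
proof -
  have "(\<integral>\<^sup>+t. g t \<partial>lborel) = (\<integral>\<^sup>+t. g t \<partial>density (distr lborel borel (\<lambda>x. 0 + T *\<^sub>R x)) (\<lambda>_. \<bar>T\<bar> ^ DIM(real ^ 'd)))"
    using assms(2) by (subst lborel_affine[of T 0]) auto
  also have "\<dots> = ennreal (T ^ CARD('d)) * (\<integral>\<^sup>+t. g (T *\<^sub>R t) \<partial>lborel)"
    using assms(2) by (subst nn_integral_density) (auto simp: nn_integral_distr nn_integral_cmult)
  finally show ?thesis .
qed

text \<open>
  Right-continuity in the componentwise order, by which the values of a path at dyadic points determine the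
  path.
\<close>

definition right_cts :: "(real ^ 'd \<Rightarrow> real) \<Rightarrow> bool" where
  "right_cts f \<longleftrightarrow> (\<forall>t. (f \<longlongrightarrow> f t) (at t within {s. t \<le> s}))"

lemma right_cts_cadlag: "f \<in> cadlag_space \<Longrightarrow> right_cts f"
  by (simp add: cadlag_space_def right_cts_def)

lemma right_cts_shift:
  assumes "right_cts f" shows "right_cts (\<lambda>t. f (t + h))"
  unfolding right_cts_def
proof
  fix t
  have "continuous (at (t + h) within {s. t + h \<le> s}) f"
    using assms by (simp add: right_cts_def continuous_within)
  then have "continuous (at (t + h) within (\<lambda>s. s + h) ` {s. t \<le> s}) f"
    by (rule continuous_within_subset) (auto simp: less_eq_vec_def)
  then have "continuous (at t within {s. t \<le> s}) (f \<circ> (\<lambda>s. s + h))"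
    by (intro continuous_within_compose continuous_intros)
  then show "((\<lambda>s. f (s + h)) \<longlongrightarrow> f (t + h)) (at t within {s. t \<le> s})"
    by (simp add: continuous_within comp_def)
qed

lemma right_cts_mult: "right_cts f \<Longrightarrow> right_cts (\<lambda>t. c * f t)"
  unfolding right_cts_def by (auto intro: tendsto_mult)

lemma cadlag_space_mult:
  assumes "f \<in> cadlag_space" "0 \<le> c" shows "(\<lambda>t. c * f t) \<in> cadlag_space"
proof -
  have "\<exists>l. ((\<lambda>t. c * f t) \<longlongrightarrow> l) (at t within quadrant I t)" for t I
  proof -
    obtain l where "(f \<longlongrightarrow> l) (at t within quadrant I t)"
      using assms(1) unfolding cadlag_space_def by blast
    then have "((\<lambda>t. c * f t) \<longlongrightarrow> c * l) (at t within quadrant I t)"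
      by (rule tendsto_mult_left)
    then show ?thesis by blast
  qed
  moreover have "((\<lambda>t. c * f t) \<longlongrightarrow> c * f t) (at t within {s. t \<le> s})" for t
    using assms(1) unfolding cadlag_space_def by (intro tendsto_mult_left) blast
  moreover have "0 \<le> c * f t" for t
    using assms unfolding cadlag_space_def by (intro mult_nonneg_nonneg) blast+
  ultimately show ?thesis
    unfolding cadlag_space_def mem_Collect_eq by blast
qed

definition dyadic_ceiling :: "nat \<Rightarrow> real ^ 'd \<Rightarrow> real ^ 'd" where
  "dyadic_ceiling n t = (\<chi> i. of_int \<lceil>t $ i * 2 ^ n\<rceil> / 2 ^ n)"

text \<open>
  Evaluation of a path at a point is not measurable in the path and the point together on the product space.
  This substitute evaluates at countably many points only and is jointly measurable on all paths; for
  cadlag paths it is the ordinary value, since \<open>dyadic_ceiling n t\<close> tends to \<open>t\<close> from above.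
\<close>

definition right_limit :: "(real ^ 'd \<Rightarrow> real) \<Rightarrow> real ^ 'd \<Rightarrow> ennreal" where
  "right_limit f t = liminf (\<lambda>n. ennreal (f (dyadic_ceiling n t)))"

lemma right_limit_eq:
  assumes "right_cts f" shows "right_limit f t = ennreal (f t)"
proof -
  have "continuous (at t within {s. t \<le> s}) f"
    using assms by (simp add: right_cts_def continuous_within)
  moreover have "dyadic_ceiling n t \<in> {s. t \<le> s}" for n
  proof -
    have "t $ i \<le> of_int \<lceil>t $ i * 2 ^ n\<rceil> / 2 ^ n" for i
      using le_of_int_ceiling[of "t $ i * 2 ^ n"] by (simp add: field_simps)
    then show ?thesis by (simp add: dyadic_ceiling_def less_eq_vec_def)
  qed
  moreover have "(\<lambda>n. dyadic_ceiling n t) \<longlonglongrightarrow> t"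
  proof (rule vec_tendstoI)
    fix i
    have "\<bar>dyadic_ceiling n t $ i - t $ i\<bar> \<le> (1 / 2) ^ n" for n
    proof -
      have "t $ i * 2 ^ n \<le> of_int \<lceil>t $ i * 2 ^ n\<rceil>" "of_int \<lceil>t $ i * 2 ^ n\<rceil> \<le> t $ i * 2 ^ n + 1"
        by linarith+
      then have "t $ i \<le> of_int \<lceil>t $ i * 2 ^ n\<rceil> / 2 ^ n" "of_int \<lceil>t $ i * 2 ^ n\<rceil> / 2 ^ n \<le> t $ i + 1 / 2 ^ n"
        by (simp_all add: pos_le_divide_eq pos_divide_le_eq distrib_right)
      then show ?thesis
        by (simp add: dyadic_ceiling_def power_divide)
    qed
    moreover have "(\<lambda>n. (1 / 2 :: real) ^ n) \<longlonglongrightarrow> 0"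
      by (rule LIMSEQ_power_zero) simp
    ultimately have "(\<lambda>n. dyadic_ceiling n t $ i - t $ i) \<longlonglongrightarrow> 0"
      unfolding real_norm_def[symmetric]
      by (rule Lim_null_comparison[OF always_eventually[OF allI]])
    then show "(\<lambda>n. dyadic_ceiling n t $ i) \<longlonglongrightarrow> t $ i"
      by (simp add: LIM_zero_iff)
  qed
  ultimately have "(\<lambda>n. f (dyadic_ceiling n t)) \<longlonglongrightarrow> f t"
    by (rule continuous_within_tendsto_compose')
  then have "(\<lambda>n. ennreal (f (dyadic_ceiling n t))) \<longlonglongrightarrow> ennreal (f t)"
    by (rule tendsto_ennrealI)
  then show ?thesis
    unfolding right_limit_def by (intro lim_imp_Liminf) auto
qed

text \<open>
  For fixed \<open>n\<close> the dyadic approximation takes countably many values, and on each of the sets where it is constant the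
  map is a coordinate projection.
\<close>

lemma measurable_right_limit:
  "(\<lambda>(f, t). right_limit f t) \<in> borel_measurable (path_space \<Otimes>\<^sub>M (borel :: (real ^ 'd) measure))"
proof -
  let ?N = "path_space \<Otimes>\<^sub>M (borel :: (real ^ 'd) measure)"
  have "(\<lambda>p. ennreal (fst p (dyadic_ceiling n (snd p)))) \<in> borel_measurable ?N" for n
  proof -
    define pt where "pt k = ((\<chi> i. of_int (k i) / 2 ^ n) :: real ^ 'd)" for k :: "'d \<Rightarrow> int"
    \<comment> \<open>The integer index of the dyadic cell ranges over a countable type.\<close>
    define ix where "ix p = (\<lambda>i. \<lceil>snd p $ i * 2 ^ n\<rceil>)" for p :: "(real ^ 'd \<Rightarrow> real) \<times> (real ^ 'd)"
    have "(\<lambda>p. ennreal (fst p (pt (ix p)))) \<in> borel_measurable ?N"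
    proof (rule measurable_compose_countable[where f="\<lambda>k p. ennreal (fst p (pt k))" and g=ix])
      show "(\<lambda>p. ennreal (fst p (pt k))) \<in> borel_measurable ?N" for k
        by measurable
      show "ix \<in> ?N \<rightarrow>\<^sub>M count_space UNIV"
      proof (subst measurable_count_space_eq2_countable, safe)
        fix k :: "'d \<Rightarrow> int"
        have "{p \<in> space ?N. \<lceil>snd p $ i * 2 ^ n\<rceil> = k i} \<in> sets ?N" for i
          by measurable
        then have "{p \<in> space ?N. \<forall>i\<in>UNIV. \<lceil>snd p $ i * 2 ^ n\<rceil> = k i} \<in> sets ?N"
          by (intro sets.sets_Collect_finite_All) auto
        moreover have "ix -` {k} \<inter> space ?N = {p \<in> space ?N. \<forall>i\<in>UNIV. \<lceil>snd p $ i * 2 ^ n\<rceil> = k i}"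
          by (auto simp: ix_def fun_eq_iff)
        ultimately show "ix -` {k} \<inter> space ?N \<in> sets ?N" by simp
      qed simp
    qed
    then show ?thesis
      by (simp add: pt_def ix_def dyadic_ceiling_def)
  qed
  then show ?thesis
    unfolding right_limit_def split_beta by measurable
qed

lemma measurable_right_limit_compose [measurable (raw)]:
  assumes "F \<in> N \<rightarrow>\<^sub>M path_space" "g \<in> N \<rightarrow>\<^sub>M borel"
  shows "(\<lambda>x. right_limit (F x) (g x)) \<in> borel_measurable N"
  using measurable_compose[OF measurable_Pair[OF assms] measurable_right_limit] by simp

lemma measurable_right_limit_time [measurable]: "right_limit f \<in> borel_measurable borel"
  by (rule measurable_right_limit_compose[of "\<lambda>_. f" borel "\<lambda>t. t"]) simp_all

text \<open>
  The sojourn of \<open>f\<close> above \<open>s\<close> in \<open>K\<close>, with \<open>right_limit f\<close> in place of \<open>f\<close> to have it measurable in \<open>s\<close> and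
  \<open>f\<close> together.
\<close>

definition sojourn :: "real \<Rightarrow> (real ^ 'd) set \<Rightarrow> real \<Rightarrow> (real ^ 'd \<Rightarrow> real) \<Rightarrow> ennreal" where
  "sojourn \<delta> K s f = (\<integral>\<^sup>+t. indicator K (grid_floor \<delta> t) * indicator {ennreal s<..} (right_limit f (grid_floor \<delta> t)) \<partial>lborel)"

lemma measurable_sojourn [measurable (raw)]:
  assumes [measurable]: "K \<in> sets borel" "s \<in> borel_measurable N" "F \<in> N \<rightarrow>\<^sub>M path_space"
  shows "(\<lambda>x. sojourn \<delta> K (s x) (F x)) \<in> borel_measurable N"
  unfolding sojourn_def greaterThan_def by measurable

lemma sojourn_right_cts:
  assumes "right_cts f" "0 \<le> s"
  shows "sojourn \<delta> K s f = (\<integral>\<^sup>+t. indicator K (grid_floor \<delta> t) * indicator {u. s < f u} (grid_floor \<delta> t) \<partial>lborel)"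
  unfolding sojourn_def right_limit_eq[OF assms(1)]
  using assms(2) by (intro nn_integral_cong) (auto simp: indicator_def ennreal_less_iff)

lemma sojourn_scale:
  assumes "right_cts f" "0 \<le> s" "0 < c"
  shows "sojourn \<delta> K s (\<lambda>t. c * f t) = sojourn \<delta> K (s / c) f"
  using assms by (simp add: sojourn_right_cts right_cts_mult pos_divide_less_eq mult.commute)

lemma sojourn_shift:
  assumes f: "right_cts f" and s: "0 \<le> s" and p: "p \<in> grid \<delta>" and K: "K \<in> sets borel"
  shows "sojourn \<delta> {t. t + p \<in> K} s (\<lambda>t. f (t + p)) = sojourn \<delta> K s f"
proof -
  note K [measurable]
  have m: "(\<lambda>t. indicator K (grid_floor \<delta> t) * indicator {ennreal s<..} (right_limit f (grid_floor \<delta> t)) :: ennreal) \<in> borel_measurable borel"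
    unfolding greaterThan_def by measurable
  have "sojourn \<delta> K s f = (\<integral>\<^sup>+t. indicator K (grid_floor \<delta> (t + p)) * indicator {ennreal s<..} (right_limit f (grid_floor \<delta> (t + p))) \<partial>lborel)"
    unfolding sojourn_def by (rule nn_integral_lborel_shift[OF m, symmetric])
  also have "\<dots> = sojourn \<delta> {t. t + p \<in> K} s (\<lambda>t. f (t + p))"
    unfolding sojourn_def grid_floor_add[OF p] right_limit_eq[OF f] right_limit_eq[OF right_cts_shift[OF f]]
    by (intro nn_integral_cong) (auto simp: indicator_def)
  finally show ?thesis by simp
qed

lemma sojourn_finite:
  assumes K: "K \<subseteq> {a..b}" and \<delta>: "0 \<le> \<delta>"
  shows "sojourn \<delta> K s f < \<infinity>"
proof -
  have "sojourn \<delta> K s f \<le> (\<integral>\<^sup>+t. indicator (cbox a (b + vec \<delta>)) t \<partial>lborel)"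
    unfolding sojourn_def
  proof (rule nn_integral_mono)
    fix t
    have "t \<in> cbox a (b + vec \<delta>)" if "grid_floor \<delta> t \<in> K"
    proof -
      have *: "a $ i \<le> grid_floor \<delta> t $ i" "grid_floor \<delta> t $ i \<le> b $ i" for i
        using that K by (auto simp: less_eq_vec_def)
      have "a $ i \<le> t $ i" "t $ i \<le> b $ i + \<delta>" for i
        using *[of i] grid_floor_bounds[OF \<delta>, of t i] by linarith+
      then show ?thesis by (simp add: mem_box_cart)
    qed
    then show "indicator K (grid_floor \<delta> t) * indicator {ennreal s<..} (right_limit f (grid_floor \<delta> t)) \<le> (indicator (cbox a (b + vec \<delta>)) t :: ennreal)"
      by (auto simp: indicator_def)
  qed
  also have "\<dots> < \<infinity>"
    using emeasure_lborel_cbox_finite[of a "b + vec \<delta>"] by simp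
  finally show ?thesis .
qed

section \<open>The sojourn identity\<close>

lemma sets_AE_cong:
  assumes "complete_measure M" "A \<in> sets M" "B \<subseteq> space M" "AE \<omega> in M. \<omega> \<in> A \<longleftrightarrow> \<omega> \<in> B"
  shows "B \<in> sets M"
proof -
  obtain N where N: "{\<omega>\<in>space M. \<not> (\<omega> \<in> A \<longleftrightarrow> \<omega> \<in> B)} \<subseteq> N" "emeasure M N = 0" "N \<in> sets M"
    using assms(4) by (rule AE_E)
  have "B \<inter> N \<in> sets M"
    using N by (intro complete_measure.complete[OF assms(1), of _ N]) auto
  moreover have "B = (A - N) \<union> (B \<inter> N)"
    using N(1) assms(3) sets.sets_into_space[OF assms(2)] by auto
  ultimately show ?thesis
    using assms(2) N(3) by (metis sets.Diff sets.Un)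
qed

lemma nn_integral_spectral_law:
  assumes [measurable]: "\<Phi> \<in> borel_measurable path_space" and Z: "Z \<in> M \<rightarrow>\<^sub>M path_space"
  shows "(\<integral>\<^sup>+f. \<Phi> f \<partial>spectral_law M Z h) = (\<integral>\<^sup>+\<omega>. ennreal (Z \<omega> h) * \<Phi> (\<lambda>t. Z \<omega> (t + h) / Z \<omega> h) \<partial>M)"
proof -
  have [measurable]: "(\<lambda>\<omega>. Z \<omega> t) \<in> borel_measurable M" for t
    by (rule measurable_path_value[OF Z])
  have ratio [measurable]: "(\<lambda>\<omega> t. Z \<omega> (t + h) / Z \<omega> h) \<in> M \<rightarrow>\<^sub>M path_space"
    by (rule measurable_path_spaceI) measurable
  show ?thesis
    unfolding spectral_law_def
    by (simp add: nn_integral_distr nn_integral_density measurable_compose[OF ratio])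
qed

text \<open>
  The consequences of the hypotheses on which the argument rests, with stationarity expressed by the
  spectral law.
\<close>

locale spectral_tail_field = prob_space M for M :: "'a measure" +
  fixes Z :: "'a \<Rightarrow> real ^ 'd \<Rightarrow> real" and \<Theta> Y :: "'a \<Rightarrow> real ^ 'd \<Rightarrow> real" and R :: "'a \<Rightarrow> real" and \<delta> :: real
  assumes complete: "complete_measure M"
    and cadlag: "cadlag_field M Z"
    and mean: "\<And>t. (\<integral>\<omega>. Z \<omega> t \<partial>M) = 1"
    and spectral_shift: "\<And>h. spectral_law M Z h = spectral_law M Z 0"
    and \<Theta>_meas: "\<Theta> \<in> M \<rightarrow>\<^sub>M cadlag_measurable_space"
    and \<Theta>_law: "\<And>A. A \<in> sets cadlag_measurable_space \<Longrightarrow>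
      measure M {\<omega>\<in>space M. \<Theta> \<omega> \<in> A} = (\<integral>\<omega>. Z \<omega> 0 * indicator A (\<lambda>t. Z \<omega> t / Z \<omega> 0) \<partial>M)"
    and R_indep: "independent_elements M borel R cadlag_measurable_space \<Theta>"
    and R_law: "\<And>r. r \<ge> 1 \<Longrightarrow> measure M {\<omega>\<in>space M. R \<omega> > r} = 1 / r"
    and Y_eq: "\<And>\<omega> t. Y \<omega> t = R \<omega> * \<Theta> \<omega> t"
    and \<delta>: "0 \<le> \<delta>"
begin

lemma Z_path [measurable]: "Z \<in> M \<rightarrow>\<^sub>M path_space"
  using cadlag by (simp add: cadlag_field_def)

lemma Z_value [measurable]: "(\<lambda>\<omega>. Z \<omega> t) \<in> borel_measurable M"
  by (rule measurable_path_value[OF Z_path])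

lemma AE_cadlag: "AE \<omega> in M. Z \<omega> \<in> cadlag_space"
  using cadlag by (simp add: cadlag_field_def)

lemma AE_regular: "AE \<omega> in M. right_cts (Z \<omega>) \<and> (\<forall>t. 0 \<le> Z \<omega> t)"
  using AE_cadlag by eventually_elim (auto intro: right_cts_cadlag simp: cadlag_space_def)

lemma Z_integrable: "integrable M (\<lambda>\<omega>. Z \<omega> t)"
  using mean[of t] not_integrable_integral_eq by fastforce

lemma \<Theta>_cadlag: "\<omega> \<in> space M \<Longrightarrow> \<Theta> \<omega> \<in> cadlag_space"
  using measurable_space[OF \<Theta>_meas] by (simp add: cadlag_measurable_space_def space_restrict_space)

lemma \<Theta>_path [measurable]: "\<Theta> \<in> M \<rightarrow>\<^sub>M path_space"
  using \<Theta>_meas unfolding cadlag_measurable_space_def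
  by (rule measurable_restrict_space2_iff[THEN iffD1, THEN conjunct1])

lemma \<Theta>_value [measurable]: "(\<lambda>\<omega>. \<Theta> \<omega> t) \<in> borel_measurable M"
  by (rule measurable_path_value[OF \<Theta>_path])

lemma R_meas [measurable]: "R \<in> borel_measurable M"
  using R_indep by (simp add: independent_elements_def)

lemma Y_path [measurable]: "Y \<in> M \<rightarrow>\<^sub>M path_space"
  by (rule measurable_path_spaceI) (simp add: Y_eq)

lemma cadlag_sets: "B \<in> sets path_space \<Longrightarrow> cadlag_space \<inter> B \<in> sets cadlag_measurable_space"
  by (auto simp: cadlag_measurable_space_def sets_restrict_space)

text \<open>
  The hypothesis describes the law of \<open>\<Theta>\<close> only on traces of measurable sets on the cadlag space, and this
  space is not measurable in the product sigma-field.  Since \<open>Z / Z(0)\<close> is almost surely cadlag, completeness of the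
  probability space makes the traces measurable and the restriction immaterial.
\<close>

lemma distr_\<Theta>: "distr M path_space \<Theta> = spectral_law M Z 0"
proof (rule measure_eqI)
  fix B assume "B \<in> sets (distr M path_space \<Theta>)"
  then have B [measurable]: "B \<in> sets path_space" by simp
  define q where "q \<omega> = (\<lambda>t. Z \<omega> t / Z \<omega> 0)" for \<omega>
  have q [measurable]: "q \<in> M \<rightarrow>\<^sub>M path_space"
    unfolding q_def by (rule measurable_path_spaceI) measurable
  have AE_q: "AE \<omega> in M. q \<omega> \<in> cadlag_space"
    using AE_cadlag
  proof eventually_elim
    fix \<omega> assume Z: "Z \<omega> \<in> cadlag_space"
    then have "0 \<le> inverse (Z \<omega> 0)" by (simp add: cadlag_space_def)
    from cadlag_space_mult[OF Z this] show "q \<omega> \<in> cadlag_space"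
      by (simp add: q_def divide_inverse mult.commute)
  qed
  have m1: "{\<omega>\<in>space M. q \<omega> \<in> B} \<in> sets M"
    by measurable
  have m2: "{\<omega>\<in>space M. q \<omega> \<in> cadlag_space \<inter> B} \<in> sets M"
    by (rule sets_AE_cong[OF complete m1]) (use AE_q in auto)
  have "emeasure (distr M path_space \<Theta>) B = emeasure M {\<omega>\<in>space M. \<Theta> \<omega> \<in> cadlag_space \<inter> B}"
    by (subst emeasure_distr[OF \<Theta>_path B]) (auto intro!: arg_cong[where f="emeasure M"] simp: \<Theta>_cadlag)
  also have "\<dots> = ennreal (\<integral>\<omega>. Z \<omega> 0 * indicator (cadlag_space \<inter> B) (q \<omega>) \<partial>M)"
    by (simp only: emeasure_eq_measure \<Theta>_law[OF cadlag_sets[OF B]] q_def)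
  also have "(\<integral>\<omega>. Z \<omega> 0 * indicator (cadlag_space \<inter> B) (q \<omega>) \<partial>M) = (\<integral>\<omega>. Z \<omega> 0 * indicator {\<omega>\<in>space M. q \<omega> \<in> cadlag_space \<inter> B} \<omega> \<partial>M)"
    by (intro Bochner_Integration.integral_cong) (auto simp: indicator_def)
  also have "\<dots> = (\<integral>\<omega>. Z \<omega> 0 * indicator {\<omega>\<in>space M. q \<omega> \<in> B} \<omega> \<partial>M)"
    using m1 m2 AE_q by (intro integral_cong_AE) (auto simp: indicator_def)
  also have "ennreal \<dots> = (\<integral>\<^sup>+\<omega>. ennreal (Z \<omega> 0 * indicator {\<omega>\<in>space M. q \<omega> \<in> B} \<omega>) \<partial>M)"
  proof (rule nn_integral_eq_integral[symmetric])
    show "integrable M (\<lambda>\<omega>. Z \<omega> 0 * indicator {\<omega>\<in>space M. q \<omega> \<in> B} \<omega>)"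
      using m1 by (intro integrable_real_mult_indicator Z_integrable)
    show "AE \<omega> in M. 0 \<le> Z \<omega> 0 * indicator {\<omega>\<in>space M. q \<omega> \<in> B} \<omega>"
      using AE_regular by eventually_elim simp
  qed
  also have "\<dots> = (\<integral>\<^sup>+\<omega>. ennreal (Z \<omega> 0) * indicator B (\<lambda>t. Z \<omega> (t + 0) / Z \<omega> 0) \<partial>M)"
    by (intro nn_integral_cong) (auto simp: indicator_def q_def)
  also have "\<dots> = emeasure (spectral_law M Z 0) B"
    by (subst nn_integral_spectral_law[symmetric])
       (auto simp: spectral_law_def)
  finally show "emeasure (distr M path_space \<Theta>) B = emeasure (spectral_law M Z 0) B" .
qed (simp add: spectral_law_def)

text \<open>
  The tail \<open>1 / r\<close> is that of the reciprocal of a uniform variable.  In this form an expectation over \<open>R\<close> is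
  an integral over the substituted levels \<open>v\<close>.
\<close>

lemma distr_R: "distr M borel R = distr (uniform_measure lborel {0<..<1}) borel (\<lambda>v. 1 / v)"
proof (rule measure_eqI_lessThan)
  have [measurable]: "(\<lambda>v::real. 1 / v) \<in> uniform_measure lborel {0<..<1} \<rightarrow>\<^sub>M borel"
    by (subst measurable_cong_sets[OF sets_uniform_measure refl]) simp
  fix x :: real
  show "emeasure (distr M borel R) {x<..} < \<infinity>"
    by (simp add: emeasure_distr less_top[symmetric])
  have R: "emeasure (distr M borel R) {x<..} = ennreal (measure M {\<omega>\<in>space M. x < R \<omega>})" for x
    by (subst emeasure_distr) (auto simp: emeasure_eq_measure vimage_def Int_def conj_commute)
  have U: "emeasure (distr (uniform_measure lborel {0<..<1}) borel (\<lambda>v. 1 / v)) {x<..} = emeasure lborel {v\<in>{0<..<1}. x < 1 / v}"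
    by (subst emeasure_distr) (auto simp: emeasure_uniform_measure vimage_def Int_def divide_ennreal_def)
  show "emeasure (distr M borel R) {x<..} = emeasure (distr (uniform_measure lborel {0<..<1}) borel (\<lambda>v. 1 / v)) {x<..}"
  proof (cases "1 \<le> x")
    case True
    then have "x < 1 / v \<longleftrightarrow> v < 1 / x" if "0 < v" for v
      using that by (simp add: pos_less_divide_eq mult.commute)
    moreover have "1 / x \<le> 1"
      using True by simp
    ultimately have "{v\<in>{0<..<1}. x < 1 / v} = {0<..<1/x}"
      by force
    then show ?thesis
      unfolding U R using True by (simp add: R_law)
  next
    case False
    have "1 = measure M {\<omega>\<in>space M. 1 < R \<omega>}"
      by (simp add: R_law)
    also have "\<dots> \<le> measure M {\<omega>\<in>space M. x < R \<omega>}"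
      using False by (intro finite_measure_mono) auto
    finally have "measure M {\<omega>\<in>space M. x < R \<omega>} = 1"
      using prob_le_1 by (intro antisym)
    moreover have "{v\<in>{0<..<1}. x < 1 / v} = {0<..<1::real}"
    proof -
      have "x < 1 / v" if "0 < v" "v < 1" for v
      proof -
        have "1 < 1 / v" using that by simp
        then show ?thesis using False by linarith
      qed
      then show ?thesis by auto
    qed
    ultimately show ?thesis
      unfolding U R by simp
  qed
qed auto

lemma independent_R_\<Theta>: "independent_elements M borel R path_space \<Theta>"
  unfolding independent_elements_def
proof (intro conjI ballI)
  fix A :: "real set" and B assume A: "A \<in> sets borel" and B: "B \<in> sets (path_space :: (real ^ 'd \<Rightarrow> real) measure)"
  have "{\<omega>\<in>space M. \<Theta> \<omega> \<in> B} = {\<omega>\<in>space M. \<Theta> \<omega> \<in> cadlag_space \<inter> B}"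
    "{\<omega>\<in>space M. R \<omega> \<in> A \<and> \<Theta> \<omega> \<in> B} = {\<omega>\<in>space M. R \<omega> \<in> A \<and> \<Theta> \<omega> \<in> cadlag_space \<inter> B}"
    by (auto simp: \<Theta>_cadlag)
  note eqs = this
  show "measure M {\<omega>\<in>space M. R \<omega> \<in> A \<and> \<Theta> \<omega> \<in> B} =
      measure M {\<omega>\<in>space M. R \<omega> \<in> A} * measure M {\<omega>\<in>space M. \<Theta> \<omega> \<in> B}"
    unfolding eqs using R_indep[unfolded independent_elements_def] A cadlag_sets[OF B] by blast
qed measurable

lemma nn_integral_R_\<Theta>:
  assumes \<Phi> [measurable]: "(\<lambda>(r, f). \<Phi> r f) \<in> borel_measurable (borel \<Otimes>\<^sub>M path_space)"
  shows "(\<integral>\<^sup>+\<omega>. \<Phi> (R \<omega>) (\<Theta> \<omega>) \<partial>M) = (\<integral>\<^sup>+v. indicator {0<..<1} v * (\<integral>\<^sup>+f. \<Phi> (1 / v) f \<partial>spectral_law M Z 0) \<partial>lborel)"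
proof -
  interpret L: prob_space "spectral_law M Z 0"
    unfolding distr_\<Theta>[symmetric] by (rule prob_space_distr) simp
  have sets_L [measurable_cong]: "sets (spectral_law M Z 0) = sets path_space"
    by (simp add: spectral_law_def)
  have inner: "(\<lambda>r. \<integral>\<^sup>+f. \<Phi> r f \<partial>spectral_law M Z 0) \<in> borel_measurable borel"
    by (rule L.borel_measurable_nn_integral)
       (subst measurable_cong_sets[OF sets_pair_measure_cong[OF refl sets_L] refl], rule \<Phi>)
  have pair: "(\<lambda>\<omega>. (R \<omega>, \<Theta> \<omega>)) \<in> M \<rightarrow>\<^sub>M borel \<Otimes>\<^sub>M path_space"
    by measurable
  have "(\<integral>\<^sup>+\<omega>. \<Phi> (R \<omega>) (\<Theta> \<omega>) \<partial>M) = (\<integral>\<^sup>+(r, f). \<Phi> r f \<partial>distr M (borel \<Otimes>\<^sub>M path_space) (\<lambda>\<omega>. (R \<omega>, \<Theta> \<omega>)))"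
    by (subst nn_integral_distr[OF pair]) (use \<Phi> in auto)
  also have "\<dots> = (\<integral>\<^sup>+(r, f). \<Phi> r f \<partial>(distr M borel R \<Otimes>\<^sub>M spectral_law M Z 0))"
    by (simp add: distr_Pair_independent_elements[OF prob_space_axioms independent_R_\<Theta>] distr_\<Theta>)
  also have "\<dots> = (\<integral>\<^sup>+r. \<integral>\<^sup>+f. \<Phi> r f \<partial>spectral_law M Z 0 \<partial>distr M borel R)"
    by (subst L.nn_integral_fst[symmetric]) auto
  also have "\<dots> = (\<integral>\<^sup>+v. \<integral>\<^sup>+f. \<Phi> (1 / v) f \<partial>spectral_law M Z 0 \<partial>uniform_measure lborel {0<..<1})"
    unfolding distr_R
    by (rule nn_integral_distr) (use inner in \<open>simp_all add: measurable_cong_sets[OF sets_uniform_measure refl]\<close>)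
  also have "\<dots> = (\<integral>\<^sup>+v. (\<integral>\<^sup>+f. \<Phi> (1 / v) f \<partial>spectral_law M Z 0) * indicator {0<..<1} v \<partial>lborel)"
    by (subst nn_integral_uniform_measure) (use measurable_compose[OF _ inner, of "\<lambda>v. 1 / v" borel] in \<open>auto simp: divide_ennreal_def\<close>)
  finally show ?thesis by (simp add: mult.commute)
qed

text \<open>
  The heart of the matter.  Substituting \<open>s = Z(p) v\<close> turns the level \<open>s\<close> for \<open>Z\<close> into the level one for
  \<open>v\<^sup>-\<^sup>1 Z / Z(p)\<close>, at the price of the Jacobian \<open>Z(p)\<close>, which is exactly the weight of the spectral law at
  \<open>p\<close>.  By stationarity this law may be replaced by the one at the origin, the law of \<open>\<Theta>\<close>, and
  \<open>1 / v\<close> by \<open>R\<close>.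
\<close>

lemma sojourn_identity_at_point:
  assumes K [measurable]: "K \<in> sets borel" and \<phi> [measurable]: "\<phi> \<in> borel_measurable borel" and p: "p \<in> grid \<delta>"
  shows "(\<integral>\<^sup>+\<omega>. \<integral>\<^sup>+s. indicator {0..} s * indicator {ennreal s<..} (right_limit (Z \<omega>) p) * \<phi> (sojourn \<delta> K s (Z \<omega>)) \<partial>lborel \<partial>M)
    = (\<integral>\<^sup>+\<omega>. \<phi> (sojourn \<delta> {u. u + p \<in> K} 1 (Y \<omega>)) \<partial>M)"
proof -
  define K' where "K' = {u. u + p \<in> K}"
  have K' [measurable]: "K' \<in> sets borel"
  proof -
    have "(\<lambda>u. u + p) -` K \<inter> space borel \<in> sets borel" by measurable
    then show ?thesis by (simp add: K'_def vimage_def)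
  qed
  define \<Phi> where "\<Phi> r f = \<phi> (sojourn \<delta> K' 1 (\<lambda>t. r * f t))" for r f
  have scale: "(\<lambda>x. (\<lambda>t. g x * F x t)) \<in> N \<rightarrow>\<^sub>M path_space"
    if "g \<in> borel_measurable N" "F \<in> N \<rightarrow>\<^sub>M path_space" for g :: "'n \<Rightarrow> real" and F :: "'n \<Rightarrow> real ^ 'd \<Rightarrow> real" and N
    using that measurable_path_value[OF that(2)] by (intro measurable_path_spaceI) simp
  have \<Phi>_meas: "(\<lambda>x. \<Phi> (g x) (F x)) \<in> borel_measurable N"
    if "g \<in> borel_measurable N" "F \<in> N \<rightarrow>\<^sub>M path_space" for g :: "'n \<Rightarrow> real" and F :: "'n \<Rightarrow> real ^ 'd \<Rightarrow> real" and N
    unfolding \<Phi>_def using scale[OF that] by measurable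
  \<comment> \<open>The substitution \<open>s = f(p) v\<close>, for a fixed path.\<close>
  have subst: "(\<integral>\<^sup>+s. indicator {0..} s * indicator {ennreal s<..} (right_limit f p) * \<phi> (sojourn \<delta> K s f) \<partial>lborel)
     = (\<integral>\<^sup>+v. ennreal (f p) * (indicator {0<..<1} v * \<Phi> (1 / v) (\<lambda>t. f (t + p) / f p)) \<partial>lborel)"
    if f: "right_cts f" "0 \<le> f p" for f
  proof (cases "f p = 0")
    case True
    then show ?thesis by (simp add: right_limit_eq[OF f(1)] not_less cong: nn_integral_cong)
  next
    case False
    define z where "z = f p"
    have z: "0 < z" using False f(2) by (simp add: z_def)
    have "(\<integral>\<^sup>+s. indicator {0..} s * indicator {ennreal s<..} (right_limit f p) * \<phi> (sojourn \<delta> K s f) \<partial>lborel)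
      = (\<integral>\<^sup>+s. indicator {0<..<z} s * \<phi> (sojourn \<delta> K s f) \<partial>lborel)"
    proof (rule nn_integral_cong_AE)
      have "AE s in lborel. s \<noteq> (0::real)" by (rule AE_lborel_singleton)
      then show "AE s in lborel. indicator {0..} s * indicator {ennreal s<..} (right_limit f p) * \<phi> (sojourn \<delta> K s f) = indicator {0<..<z} s * \<phi> (sojourn \<delta> K s f)"
        by eventually_elim (auto simp: right_limit_eq[OF f(1)] z_def indicator_def ennreal_less_iff)
    qed
    also have "\<dots> = ennreal \<bar>z\<bar> * (\<integral>\<^sup>+v. indicator {0<..<z} (0 + z * v) * \<phi> (sojourn \<delta> K (0 + z * v) f) \<partial>lborel)"
      using z by (intro nn_integral_real_affine) auto
    also have "\<dots> = ennreal z * (\<integral>\<^sup>+v. indicator {0<..<1} v * \<Phi> (1 / v) (\<lambda>t. f (t + p) / z) \<partial>lborel)"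
    proof -
      have "indicator {0<..<z} (0 + z * v) * \<phi> (sojourn \<delta> K (0 + z * v) f) = indicator {0<..<1} v * \<Phi> (1 / v) (\<lambda>t. f (t + p) / z)" for v
      proof (cases "0 < v \<and> v < 1")
        case True
        have "sojourn \<delta> K (z * v) f = sojourn \<delta> K' (z * v) (\<lambda>t. f (t + p))"
          unfolding K'_def using True z p by (intro sojourn_shift[symmetric] f(1)) auto
        also have "\<dots> = sojourn \<delta> K' (1 / (1 / (z * v))) (\<lambda>t. f (t + p))"
          by simp
        also have "\<dots> = sojourn \<delta> K' 1 (\<lambda>t. (1 / (z * v)) * f (t + p))"
          using True z by (intro sojourn_scale[symmetric] right_cts_shift f(1)) auto
        also have "(\<lambda>t. (1 / (z * v)) * f (t + p)) = (\<lambda>t. (1 / v) * (f (t + p) / z))"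
          by (simp add: mult.commute)
        finally show ?thesis
          using True z by (simp add: \<Phi>_def)
      next
        case False
        then have "\<not> (0 < z * v \<and> z * v < z)"
          using z by (auto simp: zero_less_mult_iff)
        then show ?thesis using False by auto
      qed
      then show ?thesis using z by simp
    qed
    also have "\<dots> = (\<integral>\<^sup>+v. ennreal z * (indicator {0<..<1} v * \<Phi> (1 / v) (\<lambda>t. f (t + p) / z)) \<partial>lborel)"
      by (intro nn_integral_cmult[symmetric] borel_measurable_times_ennreal \<Phi>_meas) (auto)
    finally show ?thesis by (simp add: z_def)
  qed
  interpret P: pair_sigma_finite M lborel ..
  have ratio: "(\<lambda>\<omega> t. Z \<omega> (t + p) / Z \<omega> p) \<in> M \<rightarrow>\<^sub>M path_space"
    by (rule measurable_path_spaceI) measurable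
  have m: "(\<lambda>(\<omega>, v). ennreal (Z \<omega> p) * (indicator {0<..<1} v * \<Phi> (1 / v) (\<lambda>t. Z \<omega> (t + p) / Z \<omega> p))) \<in> borel_measurable (M \<Otimes>\<^sub>M lborel)"
  proof -
    have "(\<lambda>x. \<Phi> (1 / snd x) (\<lambda>t. Z (fst x) (t + p) / Z (fst x) p)) \<in> borel_measurable (M \<Otimes>\<^sub>M lborel)"
      by (rule \<Phi>_meas) (auto intro: measurable_compose[OF measurable_fst ratio])
    then show ?thesis unfolding split_beta by measurable
  qed
  have "(\<integral>\<^sup>+\<omega>. \<integral>\<^sup>+s. indicator {0..} s * indicator {ennreal s<..} (right_limit (Z \<omega>) p) * \<phi> (sojourn \<delta> K s (Z \<omega>)) \<partial>lborel \<partial>M)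
    = (\<integral>\<^sup>+\<omega>. \<integral>\<^sup>+v. ennreal (Z \<omega> p) * (indicator {0<..<1} v * \<Phi> (1 / v) (\<lambda>t. Z \<omega> (t + p) / Z \<omega> p)) \<partial>lborel \<partial>M)"
    using AE_regular by (intro nn_integral_cong_AE) (auto simp: subst)
  also have "\<dots> = (\<integral>\<^sup>+v. \<integral>\<^sup>+\<omega>. ennreal (Z \<omega> p) * (indicator {0<..<1} v * \<Phi> (1 / v) (\<lambda>t. Z \<omega> (t + p) / Z \<omega> p)) \<partial>M \<partial>lborel)"
    by (rule P.Fubini'[OF m, symmetric])
  also have "\<dots> = (\<integral>\<^sup>+v. indicator {0<..<1} v * (\<integral>\<^sup>+f. \<Phi> (1 / v) f \<partial>spectral_law M Z 0) \<partial>lborel)"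
  proof (rule nn_integral_cong)
    fix v :: real
    have [measurable]: "(\<lambda>\<omega>. \<Phi> (1 / v) (\<lambda>t. Z \<omega> (t + p) / Z \<omega> p)) \<in> borel_measurable M"
      by (rule \<Phi>_meas[OF _ ratio]) simp
    have "(\<integral>\<^sup>+\<omega>. ennreal (Z \<omega> p) * (indicator {0<..<1} v * \<Phi> (1 / v) (\<lambda>t. Z \<omega> (t + p) / Z \<omega> p)) \<partial>M)
      = indicator {0<..<1} v * (\<integral>\<^sup>+\<omega>. ennreal (Z \<omega> p) * \<Phi> (1 / v) (\<lambda>t. Z \<omega> (t + p) / Z \<omega> p) \<partial>M)"
      by (subst nn_integral_cmult[symmetric]) (auto simp: ac_simps)
    also have "(\<integral>\<^sup>+\<omega>. ennreal (Z \<omega> p) * \<Phi> (1 / v) (\<lambda>t. Z \<omega> (t + p) / Z \<omega> p) \<partial>M) = (\<integral>\<^sup>+f. \<Phi> (1 / v) f \<partial>spectral_law M Z p)"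
      by (rule nn_integral_spectral_law[symmetric]) (auto intro: \<Phi>_meas)
    finally show "(\<integral>\<^sup>+\<omega>. ennreal (Z \<omega> p) * (indicator {0<..<1} v * \<Phi> (1 / v) (\<lambda>t. Z \<omega> (t + p) / Z \<omega> p)) \<partial>M)
      = indicator {0<..<1} v * (\<integral>\<^sup>+f. \<Phi> (1 / v) f \<partial>spectral_law M Z 0)"
      by (simp only: spectral_shift[of p])
  qed
  also have "\<dots> = (\<integral>\<^sup>+\<omega>. \<Phi> (R \<omega>) (\<Theta> \<omega>) \<partial>M)"
    by (rule nn_integral_R_\<Theta>[symmetric], unfold split_beta, rule \<Phi>_meas) simp_all
  also have "\<dots> = (\<integral>\<^sup>+\<omega>. \<phi> (sojourn \<delta> {u. u + p \<in> K} 1 (Y \<omega>)) \<partial>M)"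
    by (simp add: \<Phi>_def K'_def Y_eq[abs_def])
  finally show ?thesis .
qed

text \<open>
  The factor \<open>e\<close> in \<open>e \<phi>(e)\<close> is written as an integral over the locations above the level; exchanging the
  integrals leaves \<open>sojourn_identity_at_point\<close> for each location.
\<close>

lemma sojourn_identity:
  assumes K [measurable]: "K \<in> sets borel" and \<phi> [measurable]: "\<phi> \<in> borel_measurable borel"
  shows "(\<integral>\<^sup>+\<omega>. \<integral>\<^sup>+s. indicator {0..} s * (sojourn \<delta> K s (Z \<omega>) * \<phi> (sojourn \<delta> K s (Z \<omega>))) \<partial>lborel \<partial>M)
    = (\<integral>\<^sup>+t. indicator K (grid_floor \<delta> t) * (\<integral>\<^sup>+\<omega>. \<phi> (sojourn \<delta> {u. u + grid_floor \<delta> t \<in> K} 1 (Y \<omega>)) \<partial>M) \<partial>lborel)"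
proof -
  interpret S: pair_sigma_finite "M" "lborel :: (real ^ 'd) measure" ..
  let ?h = "\<lambda>\<omega> s t. indicator K (grid_floor \<delta> t) * (indicator {0..} s * indicator {ennreal s<..} (right_limit (Z \<omega>) (grid_floor \<delta> t)) * \<phi> (sojourn \<delta> K s (Z \<omega>))) :: ennreal"
  have h: "(\<lambda>x. ?h (w x) (s x) (t x)) \<in> borel_measurable N"
    if [measurable]: "w \<in> N \<rightarrow>\<^sub>M M" "s \<in> borel_measurable N" "t \<in> borel_measurable N" for w s t and N :: "'n measure"
  proof -
    have [measurable]: "(\<lambda>x. Z (w x)) \<in> N \<rightarrow>\<^sub>M path_space"
      by (rule measurable_compose[OF that(1) Z_path])
    show ?thesis unfolding greaterThan_def by measurable
  qed
  have "(\<integral>\<^sup>+\<omega>. \<integral>\<^sup>+s. indicator {0..} s * (sojourn \<delta> K s (Z \<omega>) * \<phi> (sojourn \<delta> K s (Z \<omega>))) \<partial>lborel \<partial>M)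
    = (\<integral>\<^sup>+\<omega>. \<integral>\<^sup>+s. \<integral>\<^sup>+t. ?h \<omega> s t \<partial>lborel \<partial>lborel \<partial>M)"
  proof (intro nn_integral_cong)
    fix \<omega> s assume \<omega>: "\<omega> \<in> space M"
    have "(\<integral>\<^sup>+t. ?h \<omega> s t \<partial>lborel) = (\<integral>\<^sup>+t. (indicator {0..} s * \<phi> (sojourn \<delta> K s (Z \<omega>))) * (indicator K (grid_floor \<delta> t) * indicator {ennreal s<..} (right_limit (Z \<omega>) (grid_floor \<delta> t))) \<partial>lborel)"
      by (intro nn_integral_cong) (simp add: ac_simps)
    also have "\<dots> = (indicator {0..} s * \<phi> (sojourn \<delta> K s (Z \<omega>))) * sojourn \<delta> K s (Z \<omega>)"
      unfolding sojourn_def[of \<delta> K s "Z \<omega>"] greaterThan_def by (intro nn_integral_cmult) measurable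
    finally show "indicator {0..} s * (sojourn \<delta> K s (Z \<omega>) * \<phi> (sojourn \<delta> K s (Z \<omega>))) = (\<integral>\<^sup>+t. ?h \<omega> s t \<partial>lborel)"
      by (simp add: ac_simps)
  qed
  also have "\<dots> = (\<integral>\<^sup>+\<omega>. \<integral>\<^sup>+t. \<integral>\<^sup>+s. ?h \<omega> s t \<partial>lborel \<partial>lborel \<partial>M)"
  proof (intro nn_integral_cong)
    fix \<omega> assume \<omega>: "\<omega> \<in> space M"
    have "(\<lambda>(s, t). ?h \<omega> s t) \<in> borel_measurable (lborel \<Otimes>\<^sub>M lborel)"
      unfolding split_beta by (rule h) (use \<omega> in auto)
    from lborel_pair.Fubini'[OF this] show "(\<integral>\<^sup>+s. \<integral>\<^sup>+t. ?h \<omega> s t \<partial>lborel \<partial>lborel) = (\<integral>\<^sup>+t. \<integral>\<^sup>+s. ?h \<omega> s t \<partial>lborel \<partial>lborel)"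
      by simp
  qed
  also have "\<dots> = (\<integral>\<^sup>+t. \<integral>\<^sup>+\<omega>. \<integral>\<^sup>+s. ?h \<omega> s t \<partial>lborel \<partial>M \<partial>lborel)"
  proof (rule S.Fubini'[symmetric])
    have "(\<lambda>x. \<integral>\<^sup>+s. ?h (fst x) s (snd x) \<partial>lborel) \<in> borel_measurable (M \<Otimes>\<^sub>M (lborel :: (real ^ 'd) measure))"
    proof (rule lborel.borel_measurable_nn_integral)
      show "(\<lambda>(x, s). ?h (fst x) s (snd x)) \<in> borel_measurable ((M \<Otimes>\<^sub>M (lborel :: (real ^ 'd) measure)) \<Otimes>\<^sub>M lborel)"
        unfolding split_beta by (rule h) auto
    qed
    then show "(\<lambda>(\<omega>, t). \<integral>\<^sup>+s. ?h \<omega> s t \<partial>lborel) \<in> borel_measurable (M \<Otimes>\<^sub>M (lborel :: (real ^ 'd) measure))"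
      by (simp add: split_beta)
  qed
  also have "\<dots> = (\<integral>\<^sup>+t. indicator K (grid_floor \<delta> t) * (\<integral>\<^sup>+\<omega>. \<phi> (sojourn \<delta> {u. u + grid_floor \<delta> t \<in> K} 1 (Y \<omega>)) \<partial>M) \<partial>lborel)"
  proof (intro nn_integral_cong)
    fix t :: "real ^ 'd"
    show "(\<integral>\<^sup>+\<omega>. \<integral>\<^sup>+s. ?h \<omega> s t \<partial>lborel \<partial>M) = indicator K (grid_floor \<delta> t) * (\<integral>\<^sup>+\<omega>. \<phi> (sojourn \<delta> {u. u + grid_floor \<delta> t \<in> K} 1 (Y \<omega>)) \<partial>M)"
      using sojourn_identity_at_point[OF K \<phi> grid_floor_in_grid[of \<delta> t]]
      by (cases "grid_floor \<delta> t \<in> K") simp_all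
  qed
  finally show ?thesis .
qed

end

section \<open>Limit of the Berman average for bounded weights\<close>

lemma measurable_sojourn_shifted [measurable (raw)]:
  assumes [measurable]: "K \<in> sets borel" "g \<in> borel_measurable N" "F \<in> N \<rightarrow>\<^sub>M path_space"
  shows "(\<lambda>x. sojourn \<delta> {u. u + g x \<in> K} s (F x)) \<in> borel_measurable N"
proof -
  have "sojourn \<delta> {u. u + g x \<in> K} s (F x) =
     (\<integral>\<^sup>+t. indicator K (grid_floor \<delta> t + g x) * indicator {ennreal s<..} (right_limit (F x) (grid_floor \<delta> t)) \<partial>lborel)" for x
    unfolding sojourn_def by (intro nn_integral_cong) (simp add: indicator_def)
  then show ?thesis
    unfolding greaterThan_def by simp
qed

lemma sojourn_mono: "K \<subseteq> K' \<Longrightarrow> sojourn \<delta> K s f \<le> sojourn \<delta> K' s f"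
  unfolding sojourn_def by (intro nn_integral_mono) (auto simp: indicator_def)

lemma sojourn_Union_le:
  assumes "finite I" and K: "\<And>i. i \<in> I \<Longrightarrow> K i \<in> sets borel"
  shows "sojourn \<delta> (\<Union>i\<in>I. K i) s f \<le> (\<Sum>i\<in>I. sojourn \<delta> (K i) s f)"
proof -
  let ?v = "\<lambda>t. indicator {ennreal s<..} (right_limit f (grid_floor \<delta> t)) :: ennreal"
  have "sojourn \<delta> (\<Union>i\<in>I. K i) s f \<le> (\<integral>\<^sup>+t. (\<Sum>i\<in>I. indicator (K i) (grid_floor \<delta> t) * ?v t) \<partial>lborel)"
    unfolding sojourn_def
  proof (rule nn_integral_mono)
    fix t
    show "indicator (\<Union>i\<in>I. K i) (grid_floor \<delta> t) * ?v t \<le> (\<Sum>i\<in>I. indicator (K i) (grid_floor \<delta> t) * ?v t)"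
    proof (cases "\<exists>i\<in>I. grid_floor \<delta> t \<in> K i")
      case True
      then obtain i where i: "i \<in> I" "grid_floor \<delta> t \<in> K i" by blast
      then have "indicator (\<Union>i\<in>I. K i) (grid_floor \<delta> t) * ?v t = indicator (K i) (grid_floor \<delta> t) * ?v t"
        by (auto simp: indicator_def)
      also have "\<dots> \<le> (\<Sum>i\<in>I. indicator (K i) (grid_floor \<delta> t) * ?v t)"
        by (rule member_le_sum) (use i assms(1) in auto)
      finally show ?thesis .
    qed auto
  qed
  also have "\<dots> = (\<Sum>i\<in>I. sojourn \<delta> (K i) s f)"
    unfolding sojourn_def
  proof (rule nn_integral_sum)
    fix i assume "i \<in> I"
    from K[OF this] have [measurable]: "K i \<in> sets borel" .
    show "(\<lambda>t. indicator (K i) (grid_floor \<delta> t) * ?v t) \<in> borel_measurable lborel"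
      unfolding greaterThan_def by measurable
  qed
  finally show ?thesis .
qed

text \<open>
  Fatou's lemma gives the lower bound, monotonicity in the set the upper one.
\<close>

lemma sojourn_tendsto:
  assumes K [measurable]: "\<And>n. K n \<in> sets borel" and ev: "\<And>u. eventually (\<lambda>n. u \<in> K n) sequentially"
  shows "(\<lambda>n. sojourn \<delta> (K n) s f) \<longlonglongrightarrow> sojourn \<delta> UNIV s f"
proof (rule tendsto_le_Liminf_Limsup_le)
  let ?v = "\<lambda>t. indicator {ennreal s<..} (right_limit f (grid_floor \<delta> t)) :: ennreal"
  have "sojourn \<delta> UNIV s f \<le> (\<integral>\<^sup>+t. liminf (\<lambda>n. indicator (K n) (grid_floor \<delta> t) * ?v t) \<partial>lborel)"
    unfolding sojourn_def
  proof (rule nn_integral_mono)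
    fix t
    have "(\<lambda>n. indicator (K n) (grid_floor \<delta> t) * ?v t) \<longlonglongrightarrow> ?v t"
      by (rule tendsto_eventually, rule eventually_mono[OF ev[of "grid_floor \<delta> t"]]) simp
    then have "liminf (\<lambda>n. indicator (K n) (grid_floor \<delta> t) * ?v t) = ?v t"
      by (intro lim_imp_Liminf) auto
    then show "indicator UNIV (grid_floor \<delta> t) * ?v t \<le> liminf (\<lambda>n. indicator (K n) (grid_floor \<delta> t) * ?v t)"
      by simp
  qed
  also have "\<dots> \<le> liminf (\<lambda>n. sojourn \<delta> (K n) s f)"
    unfolding sojourn_def greaterThan_def by (rule nn_integral_liminf) measurable
  finally show "sojourn \<delta> UNIV s f \<le> liminf (\<lambda>n. sojourn \<delta> (K n) s f)" .
  show "limsup (\<lambda>n. sojourn \<delta> (K n) s f) \<le> sojourn \<delta> UNIV s f"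
    by (intro Limsup_bounded always_eventually allI sojourn_mono) auto
qed simp

text \<open>
  Every grid point counts with mass \<open>\<delta>\<^sup>d\<close>.
\<close>

lemma sojourn_lower_bound:
  fixes f :: "real ^ 'd \<Rightarrow> real"
  assumes "0 < \<delta>" "sojourn \<delta> K s f \<noteq> 0"
  shows "ennreal (\<delta> ^ CARD('d)) \<le> sojourn \<delta> K s f"
proof -
  let ?g = "\<lambda>u. indicator K u * indicator {ennreal s<..} (right_limit f u) :: ennreal"
  have eq: "sojourn \<delta> K s f = ennreal (\<delta> ^ CARD('d)) * (\<integral>\<^sup>+u. ?g u \<partial>count_space (grid \<delta>))"
    using assms(1) unfolding sojourn_def
    by (subst nn_integral_grid_measure[symmetric]) (simp_all add: grid_measure_def nn_integral_scale_measure)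
  then obtain p where p: "p \<in> grid \<delta>" "?g p \<noteq> 0"
    using assms(2) nn_integral_cong[of "count_space (grid \<delta>)" ?g "\<lambda>_. 0"] by fastforce
  then have "?g p = 1" by (auto simp: indicator_def split: if_splits)
  then have "(\<integral>\<^sup>+u. indicator {p} u \<partial>count_space (grid \<delta>)) \<le> (\<integral>\<^sup>+u. ?g u \<partial>count_space (grid \<delta>))"
    by (intro nn_integral_mono) (auto simp: indicator_def split: if_splits)
  moreover have "(\<integral>\<^sup>+u. indicator {p} u \<partial>count_space (grid \<delta>)) = 1"
    using p(1) by (subst nn_integral_indicator) auto
  ultimately have "1 \<le> (\<integral>\<^sup>+u. ?g u \<partial>count_space (grid \<delta>))" by simp
  from mult_left_mono[OF this, of "ennreal (\<delta> ^ CARD('d))"] show ?thesis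
    unfolding eq by simp
qed

definition reciprocal_above :: "real \<Rightarrow> ennreal \<Rightarrow> ennreal" where
  "reciprocal_above x e = (if ennreal x < e then 1 else 0) / e"

lemma measurable_reciprocal_above [measurable]: "reciprocal_above x \<in> borel_measurable borel"
  unfolding reciprocal_above_def[abs_def] by measurable

lemma reciprocal_above_bound:
  assumes "0 < b" and "ennreal x < e \<Longrightarrow> ennreal b \<le> e"
  shows "reciprocal_above x e \<le> ennreal (1 / b)"
proof (cases "ennreal x < e")
  case True
  have "1 / e \<le> ennreal (1 / b)"
    using assms(2)[OF True] assms(1)
    by (cases e) (auto simp: ennreal_1[symmetric] divide_ennreal divide_left_mono simp del: ennreal_1)
  then show ?thesis
    using True by (simp add: reciprocal_above_def)
qed (simp add: reciprocal_above_def)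

text \<open>
  The weight jumps at \<open>x\<close>, but it is left-continuous there, so approximation from below is
  enough.
\<close>

lemma reciprocal_above_tendsto:
  assumes lim: "e \<longlonglongrightarrow> l" and le: "\<And>n. e n \<le> l"
  shows "(\<lambda>n. reciprocal_above x (e n)) \<longlonglongrightarrow> reciprocal_above x l"
proof (cases "ennreal x < l")
  case True
  have "(\<lambda>n. inverse (e n)) \<longlonglongrightarrow> inverse l"
    by (rule continuous_on_tendsto_compose[OF continuous_on_inverse_ennreal[OF continuous_on_id, of UNIV] lim]) auto
  moreover have "eventually (\<lambda>n. inverse (e n) = reciprocal_above x (e n)) sequentially"
    using order_tendstoD(1)[OF lim True] by eventually_elim (simp add: reciprocal_above_def divide_ennreal_def)
  ultimately show ?thesis
    using True by (simp add: reciprocal_above_def[of x l] divide_ennreal_def Lim_transform_eventually)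
next
  case False
  then have "\<not> ennreal x < e n" for n
    using le[of n] by (simp add: not_less order_trans)
  then show ?thesis using False by (simp add: reciprocal_above_def)
qed

text \<open>
  In the rescaled picture the cube with side \<open>X n\<close> is the unit cube up to a boundary effect of
  order \<open>\<delta> / X n\<close>, which disappears outside the boundary of the unit cube.  From an interior
  relative position every fixed point is eventually seen inside the cube.
\<close>

lemma grid_floor_scaled_cube_tendsto:
  fixes \<tau> :: "real ^ 'd"
  assumes \<delta>: "0 \<le> \<delta>" and X: "filterlim X at_top sequentially" and pos: "\<And>n. 0 < X n"
    and \<tau>: "\<tau> \<notin> cbox 0 (vec 1) - box 0 (vec 1)"
  shows "eventually (\<lambda>n. grid_floor \<delta> (X n *\<^sub>R \<tau>) \<in> {0..vec (X n)} \<longleftrightarrow> \<tau> \<in> box 0 (vec 1)) sequentially"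
    and "\<tau> \<in> box 0 (vec 1) \<Longrightarrow> eventually (\<lambda>n. u + grid_floor \<delta> (X n *\<^sub>R \<tau>) \<in> {0..vec (X n)}) sequentially"
proof -
  have large: "eventually (\<lambda>n. c < X n * a) sequentially" if "0 < a" for a c
  proof -
    have "eventually (\<lambda>n. c / a < X n) sequentially"
      using X by (simp add: filterlim_at_top_dense)
    then show ?thesis
      by eventually_elim (use that in \<open>simp add: pos_divide_less_eq\<close>)
  qed
  have inside: "eventually (\<lambda>n. u + grid_floor \<delta> (X n *\<^sub>R \<tau>) \<in> {0..vec (X n)}) sequentially"
    if \<tau>: "\<tau> \<in> box 0 (vec 1)" for u
  proof -
    have "eventually (\<lambda>n. 0 \<le> u $ i + grid_floor \<delta> (X n *\<^sub>R \<tau>) $ i \<and> u $ i + grid_floor \<delta> (X n *\<^sub>R \<tau>) $ i \<le> X n) sequentially" for i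
    proof -
      have "0 < \<tau> $ i" "0 < 1 - \<tau> $ i"
        using \<tau> by (auto simp: mem_box_cart)
      from large[OF this(1), of "\<delta> - u $ i"] large[OF this(2), of "u $ i"] show ?thesis
      proof eventually_elim
        case (elim n)
        then have "u $ i < X n - X n * \<tau> $ i" by (simp add: right_diff_distrib)
        then show ?case
          using elim(1) grid_floor_bounds[OF \<delta>, of "X n *\<^sub>R \<tau>" i] by simp
      qed
    qed
    then have "eventually (\<lambda>n. \<forall>i. 0 \<le> u $ i + grid_floor \<delta> (X n *\<^sub>R \<tau>) $ i \<and> u $ i + grid_floor \<delta> (X n *\<^sub>R \<tau>) $ i \<le> X n) sequentially"
      by (rule eventually_all_finite)
    then show ?thesis
      by eventually_elim (auto simp: less_eq_vec_def)
  qed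
  then show "\<tau> \<in> box 0 (vec 1) \<Longrightarrow> eventually (\<lambda>n. u + grid_floor \<delta> (X n *\<^sub>R \<tau>) \<in> {0..vec (X n)}) sequentially"
    by blast
  show "eventually (\<lambda>n. grid_floor \<delta> (X n *\<^sub>R \<tau>) \<in> {0..vec (X n)} \<longleftrightarrow> \<tau> \<in> box 0 (vec 1)) sequentially"
  proof (cases "\<tau> \<in> box 0 (vec 1)")
    case True
    then show ?thesis using inside[OF True, of 0] by (auto elim: eventually_mono)
  next
    case False
    with \<tau> have "\<tau> \<notin> cbox 0 (vec 1)" by blast
    then obtain i where i: "\<tau> $ i < 0 \<or> 1 < \<tau> $ i"
      by (auto simp: mem_box_cart not_le)
    have "eventually (\<lambda>n. grid_floor \<delta> (X n *\<^sub>R \<tau>) $ i < 0 \<or> X n < grid_floor \<delta> (X n *\<^sub>R \<tau>) $ i) sequentially"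
    proof (cases "\<tau> $ i < 0")
      case True
      have "grid_floor \<delta> (X n *\<^sub>R \<tau>) $ i < 0" for n
        using grid_floor_bounds(1)[OF \<delta>, of "X n *\<^sub>R \<tau>" i] mult_pos_neg[OF pos[of n] True] by simp
      then show ?thesis by simp
    next
      case False
      then have "0 < \<tau> $ i - 1" using i by simp
      from large[OF this, of \<delta>] show ?thesis
      proof eventually_elim
        case (elim n)
        then show ?case
          using grid_floor_bounds(2)[OF \<delta>, of "X n *\<^sub>R \<tau>" i] by (simp add: right_diff_distrib)
      qed
    qed
    then show ?thesis
      by eventually_elim (use False in \<open>auto simp: less_eq_vec_def not_le\<close>)
  qed
qed

context spectral_tail_field
begin

text \<open>
  The Lebesgue measure of the levels \<open>s\<close>, weighted with the probability that the sojourn above \<open>s\<close> belongs to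
  \<open>A\<close>; it is the numerator of the Berman average if \<open>A\<close> is the ray above \<open>x\<close>.
\<close>

definition exceedance :: "(real ^ 'd) set \<Rightarrow> ennreal set \<Rightarrow> ennreal" where
  "exceedance K A = (\<integral>\<^sup>+s. indicator {0..} s * emeasure M {\<omega>\<in>space M. sojourn \<delta> K s (Z \<omega>) \<in> A} \<partial>lborel)"

definition sojourn_moment :: "real \<Rightarrow> ennreal" where
  "sojourn_moment x = (\<integral>\<^sup>+\<omega>. reciprocal_above x (sojourn \<delta> UNIV 1 (Y \<omega>)) \<partial>M)"

lemma exceedance_measurable:
  assumes [measurable]: "K \<in> sets borel" "A \<in> sets borel"
  shows "{\<omega>\<in>space M. sojourn \<delta> K s (Z \<omega>) \<in> A} \<in> sets M"
    and "(\<lambda>s. emeasure M {\<omega>\<in>space M. sojourn \<delta> K s (Z \<omega>) \<in> A}) \<in> borel_measurable borel"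
proof -
  show set: "{\<omega>\<in>space M. sojourn \<delta> K s (Z \<omega>) \<in> A} \<in> sets M" for s
    by measurable
  have "emeasure M {\<omega>\<in>space M. sojourn \<delta> K s (Z \<omega>) \<in> A} = (\<integral>\<^sup>+\<omega>. indicator A (sojourn \<delta> K s (Z \<omega>)) \<partial>M)" for s
    unfolding nn_integral_indicator[OF set[of s], symmetric] by (intro nn_integral_cong) (simp add: indicator_def)
  then show "(\<lambda>s. emeasure M {\<omega>\<in>space M. sojourn \<delta> K s (Z \<omega>) \<in> A}) \<in> borel_measurable borel"
    by simp
qed

lemma exceedance_alt:
  assumes [measurable]: "K \<in> sets borel" "A \<in> sets borel"
  shows "exceedance K A = (\<integral>\<^sup>+\<omega>. \<integral>\<^sup>+s. indicator {0..} s * indicator A (sojourn \<delta> K s (Z \<omega>)) \<partial>lborel \<partial>M)"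
proof -
  interpret S: pair_sigma_finite M "lborel :: real measure" ..
  have "exceedance K A = (\<integral>\<^sup>+s. \<integral>\<^sup>+\<omega>. indicator {0..} s * indicator A (sojourn \<delta> K s (Z \<omega>)) \<partial>M \<partial>lborel)"
    unfolding exceedance_def
  proof (rule nn_integral_cong)
    fix s :: real
    have "emeasure M {\<omega>\<in>space M. sojourn \<delta> K s (Z \<omega>) \<in> A} = (\<integral>\<^sup>+\<omega>. indicator A (sojourn \<delta> K s (Z \<omega>)) \<partial>M)"
      unfolding nn_integral_indicator[OF exceedance_measurable(1)[OF assms, of s], symmetric]
      by (intro nn_integral_cong) (simp add: indicator_def)
    then show "indicator {0..} s * emeasure M {\<omega>\<in>space M. sojourn \<delta> K s (Z \<omega>) \<in> A} = (\<integral>\<^sup>+\<omega>. indicator {0..} s * indicator A (sojourn \<delta> K s (Z \<omega>)) \<partial>M)"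
      by (subst nn_integral_cmult) auto
  qed
  also have "\<dots> = (\<integral>\<^sup>+\<omega>. \<integral>\<^sup>+s. indicator {0..} s * indicator A (sojourn \<delta> K s (Z \<omega>)) \<partial>lborel \<partial>M)"
  proof (rule S.Fubini')
    have "(\<lambda>x. sojourn \<delta> K (snd x) (Z (fst x))) \<in> borel_measurable (M \<Otimes>\<^sub>M (lborel :: real measure))"
      by (intro measurable_sojourn) (auto intro: measurable_compose[OF measurable_fst Z_path])
    then show "(\<lambda>(\<omega>, s). indicator {0..} s * indicator A (sojourn \<delta> K s (Z \<omega>)) :: ennreal) \<in> borel_measurable (M \<Otimes>\<^sub>M (lborel :: real measure))"
      unfolding split_beta by measurable
  qed
  finally show ?thesis .
qed

text \<open>
  On a bounded set the sojourn is finite, so on \<open>A\<close>, which avoids \<open>0\<close>, the sojourn times its reciprocal is one.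
\<close>

lemma exceedance_identity:
  assumes K [measurable]: "K \<in> sets borel" "K \<subseteq> {a..b}" and A [measurable]: "A \<in> sets borel" and "0 \<notin> A"
  shows "exceedance K A = (\<integral>\<^sup>+t. indicator K (grid_floor \<delta> t) *
    (\<integral>\<^sup>+\<omega>. indicator A (sojourn \<delta> {u. u + grid_floor \<delta> t \<in> K} 1 (Y \<omega>)) / sojourn \<delta> {u. u + grid_floor \<delta> t \<in> K} 1 (Y \<omega>) \<partial>M) \<partial>lborel)"
proof -
  have "indicator A e = e * (indicator A e / e)" if "e < \<infinity>" for e :: ennreal
  proof (cases "e \<in> A")
    case True
    then have "e \<noteq> 0" using assms(4) by metis
    then show ?thesis using that True by (simp add: ennreal_times_divide)
  qed simp
  then have "exceedance K A = (\<integral>\<^sup>+\<omega>. \<integral>\<^sup>+s. indicator {0..} s * (sojourn \<delta> K s (Z \<omega>) *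
      (indicator A (sojourn \<delta> K s (Z \<omega>)) / sojourn \<delta> K s (Z \<omega>))) \<partial>lborel \<partial>M)"
    unfolding exceedance_alt[OF K(1) A] using sojourn_finite[OF K(2) \<delta>] by simp
  also have "\<dots> = (\<integral>\<^sup>+t. indicator K (grid_floor \<delta> t) *
    (\<integral>\<^sup>+\<omega>. indicator A (sojourn \<delta> {u. u + grid_floor \<delta> t \<in> K} 1 (Y \<omega>)) / sojourn \<delta> {u. u + grid_floor \<delta> t \<in> K} 1 (Y \<omega>) \<partial>M) \<partial>lborel)"
    by (rule sojourn_identity) auto
  finally show ?thesis .
qed

lemma exceedance_subadditive:
  assumes K: "K \<in> sets borel" "A \<in> sets borel" and "finite I"
    and L: "\<And>i. i \<in> I \<Longrightarrow> L i \<in> sets borel" "\<And>i. i \<in> I \<Longrightarrow> B i \<in> sets borel"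
    and cover: "\<And>s f. sojourn \<delta> K s f \<in> A \<Longrightarrow> \<exists>i\<in>I. sojourn \<delta> (L i) s f \<in> B i"
  shows "exceedance K A \<le> (\<Sum>i\<in>I. exceedance (L i) (B i))"
proof -
  have "exceedance K A \<le> (\<integral>\<^sup>+s. (\<Sum>i\<in>I. indicator {0..} s * emeasure M {\<omega>\<in>space M. sojourn \<delta> (L i) s (Z \<omega>) \<in> B i}) \<partial>lborel)"
    unfolding exceedance_def sum_distrib_left[symmetric]
  proof (intro nn_integral_mono mult_left_mono)
    fix s :: real
    have "emeasure M {\<omega>\<in>space M. sojourn \<delta> K s (Z \<omega>) \<in> A} \<le> emeasure M (\<Union>i\<in>I. {\<omega>\<in>space M. sojourn \<delta> (L i) s (Z \<omega>) \<in> B i})"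
      using assms(3) L by (intro emeasure_mono sets.finite_UN exceedance_measurable) (auto dest: cover)
    also have "\<dots> \<le> (\<Sum>i\<in>I. emeasure M {\<omega>\<in>space M. sojourn \<delta> (L i) s (Z \<omega>) \<in> B i})"
      using assms(3) L by (intro emeasure_subadditive_finite) (auto intro!: exceedance_measurable)
    finally show "emeasure M {\<omega>\<in>space M. sojourn \<delta> K s (Z \<omega>) \<in> A} \<le> (\<Sum>i\<in>I. emeasure M {\<omega>\<in>space M. sojourn \<delta> (L i) s (Z \<omega>) \<in> B i})" .
  qed simp
  also have "\<dots> = (\<Sum>i\<in>I. exceedance (L i) (B i))"
    unfolding exceedance_def
    using L by (intro nn_integral_sum) (auto intro!: borel_measurable_times_ennreal exceedance_measurable)
  finally show ?thesis .
qed

lemma berman_average_eq: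
  "berman_average M Z \<delta> x T = ennreal (1 / T ^ CARD('d)) * exceedance {0..vec T} {ennreal x<..}"
proof -
  have "emeasure M {\<omega>\<in>space M. (\<integral>\<^sup>+t\<in>{0..vec T}. indicator {t. Z \<omega> t > s} t \<partial>grid_measure \<delta>) > ennreal x} =
      emeasure M {\<omega>\<in>space M. sojourn \<delta> {0..vec T} s (Z \<omega>) \<in> {ennreal x<..}}" if "0 \<le> s" for s
  proof -
    have eq: "AE \<omega> in M. (\<integral>\<^sup>+t\<in>{0..vec T}. indicator {t. Z \<omega> t > s} t \<partial>grid_measure \<delta>) = sojourn \<delta> {0..vec T} s (Z \<omega>)"
      using AE_regular
    proof eventually_elim
      case (elim \<omega>)
      then show ?case
        unfolding nn_integral_grid_measure[OF \<delta>]
        using that by (simp add: sojourn_right_cts mult.commute)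
    qed
    have m: "{\<omega>\<in>space M. sojourn \<delta> {0..vec T} s (Z \<omega>) \<in> {ennreal x<..}} \<in> sets M"
      by (rule exceedance_measurable) auto
    moreover have "{\<omega>\<in>space M. (\<integral>\<^sup>+t\<in>{0..vec T}. indicator {t. Z \<omega> t > s} t \<partial>grid_measure \<delta>) > ennreal x} \<in> sets M"
      by (rule sets_AE_cong[OF complete m]) (use eq in auto)
    ultimately show ?thesis
      using eq by (intro emeasure_eq_AE) auto
  qed
  note eq = this
  have "(\<integral>\<^sup>+s\<in>{0..}. emeasure M {\<omega>\<in>space M. (\<integral>\<^sup>+t\<in>{0..vec T}. indicator {t. Z \<omega> t > s} t \<partial>grid_measure \<delta>) > ennreal x} \<partial>lborel)
      = exceedance {0..vec T} {ennreal x<..}"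
    unfolding exceedance_def
  proof (rule nn_integral_cong)
    fix s :: real
    show "emeasure M {\<omega>\<in>space M. (\<integral>\<^sup>+t\<in>{0..vec T}. indicator {t. Z \<omega> t > s} t \<partial>grid_measure \<delta>) > ennreal x} * indicator {0..} s =
      indicator {0..} s * emeasure M {\<omega>\<in>space M. sojourn \<delta> {0..vec T} s (Z \<omega>) \<in> {ennreal x<..}}"
      using eq[of s] by (cases "0 \<le> s") simp_all
  qed
  then show ?thesis
    by (simp add: berman_average_def)
qed

lemma berman_average_identity:
  assumes "0 \<le> x" "0 < T"
  shows "berman_average M Z \<delta> x T = (\<integral>\<^sup>+\<tau>. indicator {0..vec T} (grid_floor \<delta> (T *\<^sub>R \<tau>)) *
     (\<integral>\<^sup>+\<omega>. reciprocal_above x (sojourn \<delta> {u. u + grid_floor \<delta> (T *\<^sub>R \<tau>) \<in> {0..vec T}} 1 (Y \<omega>)) \<partial>M) \<partial>lborel)"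
proof -
  let ?g = "\<lambda>p. \<integral>\<^sup>+\<omega>. reciprocal_above x (sojourn \<delta> {u. u + p \<in> {0..vec T}} 1 (Y \<omega>)) \<partial>M"
  let ?h = "\<lambda>t. indicator {0..vec T} (grid_floor \<delta> t) * ?g (grid_floor \<delta> t)"
  have g: "?g \<in> borel_measurable borel"
  proof (rule borel_measurable_nn_integral)
    have "(\<lambda>q. sojourn \<delta> {u. u + fst q \<in> {0..vec T}} 1 (Y (snd q))) \<in> borel_measurable (borel \<Otimes>\<^sub>M M)"
      by (intro measurable_sojourn_shifted) (auto intro: measurable_compose[OF measurable_snd Y_path])
    then show "(\<lambda>(p, \<omega>). reciprocal_above x (sojourn \<delta> {u. u + p \<in> {0..vec T}} 1 (Y \<omega>))) \<in> borel_measurable (borel \<Otimes>\<^sub>M M)"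
      unfolding split_beta by measurable
  qed
  then have h: "?h \<in> borel_measurable borel"
    using measurable_compose[OF measurable_grid_floor g] by measurable
  have "indicator {ennreal x<..} e / e = reciprocal_above x e" for e
    by (simp add: reciprocal_above_def indicator_def)
  then have "exceedance {0..vec T} {ennreal x<..} = (\<integral>\<^sup>+t. ?h t \<partial>lborel)"
    using assms by (subst exceedance_identity[where a=0 and b="vec T"]) auto
  also have "\<dots> = ennreal (T ^ CARD('d)) * (\<integral>\<^sup>+\<tau>. ?h (T *\<^sub>R \<tau>) \<partial>lborel)"
    by (rule nn_integral_lborel_scale[OF h assms(2)])
  finally show ?thesis
    unfolding berman_average_eq using assms(2)
    by (simp add: mult.assoc[symmetric] ennreal_mult[symmetric])
qed

lemma reciprocal_above_sojourn_bound:
  assumes "0 \<le> x" "0 < x \<or> 0 < \<delta>"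
  obtains B where "\<And>K s f. reciprocal_above x (sojourn \<delta> K s (f :: real ^ 'd \<Rightarrow> real)) \<le> ennreal B"
proof (cases "0 < \<delta>")
  case True
  have "reciprocal_above x (sojourn \<delta> K s f) \<le> ennreal (1 / \<delta> ^ CARD('d))" for K s and f :: "real ^ 'd \<Rightarrow> real"
    using True by (intro reciprocal_above_bound sojourn_lower_bound) auto
  then show ?thesis by (rule that)
next
  case False
  then have "0 < x" using assms by simp
  then have "reciprocal_above x (sojourn \<delta> K s f) \<le> ennreal (1 / x)" for K s and f :: "real ^ 'd \<Rightarrow> real"
    by (intro reciprocal_above_bound) auto
  then show ?thesis by (rule that)
qed

lemma sojourn_moment_finite:
  assumes "0 \<le> x" "0 < x \<or> 0 < \<delta>"
  shows "sojourn_moment x < \<infinity>"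
proof -
  obtain B where B: "\<And>K s f. reciprocal_above x (sojourn \<delta> K s (f :: real ^ 'd \<Rightarrow> real)) \<le> ennreal B"
    using reciprocal_above_sojourn_bound[OF assms] by blast
  have "sojourn_moment x \<le> (\<integral>\<^sup>+\<omega>. ennreal B \<partial>M)"
    unfolding sojourn_moment_def by (intro nn_integral_mono B)
  also have "\<dots> < \<infinity>" by (simp add: emeasure_space_1)
  finally show ?thesis .
qed

text \<open>
  Dominated convergence twice: over the probability space for a fixed relative position, and then over the
  relative positions.
\<close>

lemma berman_average_tendsto_bounded:
  assumes x: "0 \<le> x" "0 < x \<or> 0 < \<delta>"
  shows "(berman_average M Z \<delta> x \<longlongrightarrow> sojourn_moment x) at_top"
proof (rule tendsto_at_topI_sequentially)
  obtain B where B: "\<And>K s f. reciprocal_above x (sojourn \<delta> K s (f :: real ^ 'd \<Rightarrow> real)) \<le> ennreal B"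
    using reciprocal_above_sojourn_bound[OF x] by blast
  fix X' :: "nat \<Rightarrow> real" assume X': "filterlim X' at_top sequentially"
  \<comment> \<open>Sides below \<open>1 + \<delta>\<close> occur finitely often; discarding them makes the dominating function below valid for all \<open>n\<close>.\<close>
  define X where "X n = max (X' n) (1 + \<delta>)" for n
  have ev: "eventually (\<lambda>n. X' n = X n) sequentially"
    using X' unfolding filterlim_at_top X_def by (auto elim!: eventually_mono dest!: spec[of _ "1 + \<delta>"])
  then have X: "filterlim X at_top sequentially"
    using X' filterlim_cong[OF refl refl ev] by simp
  have X1: "1 \<le> X n" "\<delta> \<le> X n" for n
    using \<delta> by (auto simp: X_def)
  have Xpos: "0 < X n" for n
    using X1[of n] by linarith
  let ?K = "\<lambda>n \<tau>. {u. u + grid_floor \<delta> (X n *\<^sub>R \<tau>) \<in> {0..vec (X n)}}"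
  let ?G = "\<lambda>n \<tau>. \<integral>\<^sup>+\<omega>. reciprocal_above x (sojourn \<delta> (?K n \<tau>) 1 (Y \<omega>)) \<partial>M"
  let ?U = "\<lambda>n \<tau>. indicator {0..vec (X n)} (grid_floor \<delta> (X n *\<^sub>R \<tau>)) * ?G n \<tau>"
  have K: "{u. u + p \<in> {0..vec (X n)}} \<in> sets borel" for n and p :: "real ^ 'd"
  proof -
    have "(\<lambda>u. u + p) -` {0..vec (X n)} \<inter> space borel \<in> sets borel" by measurable
    then show ?thesis by (simp add: vimage_def)
  qed
  have G_le: "?G n \<tau> \<le> ennreal B" for n \<tau>
  proof -
    have "?G n \<tau> \<le> (\<integral>\<^sup>+\<omega>. ennreal B \<partial>M)"
      by (intro nn_integral_mono B)
    then show ?thesis by (simp add: emeasure_space_1)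
  qed
  have G_lim: "(\<lambda>n. ?G n \<tau>) \<longlonglongrightarrow> sojourn_moment x" if \<tau>: "\<tau> \<in> box 0 (vec 1)" for \<tau>
    unfolding sojourn_moment_def
  proof (rule nn_integral_dominated_convergence[where w="\<lambda>_. ennreal B"])
    show "(\<lambda>\<omega>. reciprocal_above x (sojourn \<delta> (?K n \<tau>) 1 (Y \<omega>))) \<in> borel_measurable M" for n
      using K by measurable
    have "(\<lambda>n. reciprocal_above x (sojourn \<delta> (?K n \<tau>) 1 (Y \<omega>))) \<longlonglongrightarrow> reciprocal_above x (sojourn \<delta> UNIV 1 (Y \<omega>))" for \<omega>
    proof (rule reciprocal_above_tendsto[OF sojourn_tendsto])
      show "?K n \<tau> \<in> sets borel" for n by (rule K)
      show "eventually (\<lambda>n. u \<in> ?K n \<tau>) sequentially" for u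
        using grid_floor_scaled_cube_tendsto(2)[OF \<delta> X Xpos _ \<tau>, of u] \<tau> by simp
      show "sojourn \<delta> (?K n \<tau>) 1 (Y \<omega>) \<le> sojourn \<delta> UNIV 1 (Y \<omega>)" for n
        by (rule sojourn_mono) simp
    qed
    then show "AE \<omega> in M. (\<lambda>n. reciprocal_above x (sojourn \<delta> (?K n \<tau>) 1 (Y \<omega>))) \<longlonglongrightarrow> reciprocal_above x (sojourn \<delta> UNIV 1 (Y \<omega>))"
      by simp
  qed (auto simp: B emeasure_space_1)
  have "(\<lambda>n. \<integral>\<^sup>+\<tau>. ?U n \<tau> \<partial>lborel) \<longlonglongrightarrow> (\<integral>\<^sup>+\<tau>. indicator (box 0 (vec 1 :: real ^ 'd)) \<tau> * sojourn_moment x \<partial>lborel)"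
  \<comment> \<open>The lower corner of a cell lies at most \<open>\<delta> \<le> X n\<close> below the point, hence the side \<open>2\<close>.\<close>
  proof (rule nn_integral_dominated_convergence[where w="\<lambda>\<tau>. ennreal B * indicator (cbox 0 (vec 2 :: real ^ 'd)) \<tau>"])
    show "?U n \<in> borel_measurable lborel" for n
    proof -
      have "(\<lambda>q. sojourn \<delta> {u. u + grid_floor \<delta> (X n *\<^sub>R fst q) \<in> {0..vec (X n)}} 1 (Y (snd q))) \<in> borel_measurable (borel \<Otimes>\<^sub>M M)"
        by (intro measurable_sojourn_shifted) (auto intro: measurable_compose[OF measurable_snd Y_path])
      then have "(\<lambda>(\<tau>, \<omega>). reciprocal_above x (sojourn \<delta> (?K n \<tau>) 1 (Y \<omega>))) \<in> borel_measurable (borel \<Otimes>\<^sub>M M)"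
        unfolding split_beta by measurable
      then have "?G n \<in> borel_measurable borel"
        by (rule borel_measurable_nn_integral)
      then show ?thesis by measurable
    qed
    show "AE \<tau> in lborel. ?U n \<tau> \<le> ennreal B * indicator (cbox 0 (vec 2)) \<tau>" for n
    proof (rule AE_I2)
      fix \<tau> :: "real ^ 'd"
      have "\<tau> \<in> cbox 0 (vec 2)" if "grid_floor \<delta> (X n *\<^sub>R \<tau>) \<in> {0..vec (X n)}"
      proof -
        have "0 \<le> \<tau> $ i \<and> \<tau> $ i \<le> 2" for i
        proof -
          have "0 \<le> grid_floor \<delta> (X n *\<^sub>R \<tau>) $ i" "grid_floor \<delta> (X n *\<^sub>R \<tau>) $ i \<le> X n"
            using that by (auto simp: less_eq_vec_def)
          moreover have "grid_floor \<delta> (X n *\<^sub>R \<tau>) $ i \<le> X n * \<tau> $ i" "X n * \<tau> $ i \<le> grid_floor \<delta> (X n *\<^sub>R \<tau>) $ i + \<delta>"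
            using grid_floor_bounds[OF \<delta>, of "X n *\<^sub>R \<tau>" i] by simp_all
          ultimately have "X n * 0 \<le> X n * \<tau> $ i" "X n * \<tau> $ i \<le> X n * 2"
            using X1(2)[of n] by linarith+
          then show ?thesis
            unfolding mult_le_cancel_left_pos[OF Xpos] by simp
        qed
        then show ?thesis by (simp add: mem_box_cart)
      qed
      then show "?U n \<tau> \<le> ennreal B * indicator (cbox 0 (vec 2)) \<tau>"
        using G_le[of n \<tau>] by (auto simp: indicator_def)
    qed
    show "(\<integral>\<^sup>+\<tau>. ennreal B * indicator (cbox 0 (vec 2 :: real ^ 'd)) \<tau> \<partial>lborel) < \<infinity>"
      using emeasure_lborel_cbox_finite[of "0 :: real ^ 'd" "vec 2"]
      by (simp add: nn_integral_cmult_indicator ennreal_mult_less_top)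
    have null: "cbox 0 (vec 1) - box 0 (vec 1 :: real ^ 'd) \<in> null_sets lborel"
    proof -
      have "emeasure lborel (box 0 (vec 1 :: real ^ 'd)) = 1" "emeasure lborel (cbox 0 (vec 1 :: real ^ 'd)) = 1"
        using emeasure_lborel_between_cubes[of "box 0 (vec 1 :: real ^ 'd)" 0 1]
          emeasure_lborel_between_cubes[of "cbox 0 (vec 1 :: real ^ 'd)" 0 1]
        by (auto simp: box_subset_cbox)
      then have "emeasure lborel (cbox 0 (vec 1) - box 0 (vec 1 :: real ^ 'd)) = 0"
        by (subst emeasure_Diff) (auto simp: box_subset_cbox)
      then show ?thesis by auto
    qed
    show "AE \<tau> in lborel. (\<lambda>n. ?U n \<tau>) \<longlonglongrightarrow> indicator (box 0 (vec 1)) \<tau> * sojourn_moment x"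
      using AE_not_in[OF null]
    proof eventually_elim
      fix \<tau> :: "real ^ 'd" assume \<tau>: "\<tau> \<notin> cbox 0 (vec 1) - box 0 (vec 1)"
      show "(\<lambda>n. ?U n \<tau>) \<longlonglongrightarrow> indicator (box 0 (vec 1)) \<tau> * sojourn_moment x"
      proof (cases "\<tau> \<in> box 0 (vec 1)")
        case True
        then have "eventually (\<lambda>n. ?G n \<tau> = ?U n \<tau>) sequentially"
          using grid_floor_scaled_cube_tendsto(1)[OF \<delta> X Xpos \<tau>] by (auto elim!: eventually_mono)
        from Lim_transform_eventually[OF G_lim[OF True] this] show ?thesis
          using True by simp
      next
        case False
        then have "eventually (\<lambda>n. ?U n \<tau> = 0) sequentially"
          using grid_floor_scaled_cube_tendsto(1)[OF \<delta> X Xpos \<tau>] by (auto elim!: eventually_mono)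
        then show ?thesis
          using False by (simp add: tendsto_eventually)
      qed
    qed
  qed auto
  moreover have "(\<integral>\<^sup>+\<tau>. indicator (box 0 (vec 1 :: real ^ 'd)) \<tau> * sojourn_moment x \<partial>lborel) = sojourn_moment x"
  proof -
    have "emeasure lborel (box 0 (vec 1 :: real ^ 'd)) = 1"
      using emeasure_lborel_between_cubes[of "box 0 (vec 1 :: real ^ 'd)" 0 1] by (auto simp: box_subset_cbox)
    then show ?thesis by (simp add: nn_integral_multc)
  qed
  ultimately have "(\<lambda>n. berman_average M Z \<delta> x (X n)) \<longlonglongrightarrow> sojourn_moment x"
    unfolding berman_average_identity[OF x(1) Xpos] by simp
  moreover have "eventually (\<lambda>n. berman_average M Z \<delta> x (X n) = berman_average M Z \<delta> x (X' n)) sequentially"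
    using ev by eventually_elim simp
  ultimately show "(\<lambda>n. berman_average M Z \<delta> x (X' n)) \<longlonglongrightarrow> sojourn_moment x"
    by (rule Lim_transform_eventually)
qed

end

section \<open>The continuous case at level zero\<close>

lemma nn_integral_below:
  "(\<integral>\<^sup>+s. indicator {0..} s * indicator {s. ennreal s < S} s \<partial>lborel) \<le> S"
proof (cases S)
  case (real r)
  have "(\<integral>\<^sup>+s. indicator {0..} s * indicator {s. ennreal s < S} s \<partial>lborel) \<le> (\<integral>\<^sup>+s. indicator {0..r} s \<partial>lborel)"
    using real by (intro nn_integral_mono) (auto simp: indicator_def ennreal_less_iff)
  then show ?thesis using real by simp
qed simp

lemma unit_cubes_cover:
  fixes t :: "real ^ 'd"
  assumes t: "t \<in> {0..vec (real N)}" and N: "0 < N"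
  shows "\<exists>k :: 'd \<Rightarrow> nat. (\<forall>i. k i < N) \<and> t + (\<chi> i. - real (k i)) \<in> {0..vec 1}"
proof -
  have "\<exists>m<N. 0 \<le> t $ i - real m \<and> t $ i - real m \<le> 1" for i
  proof -
    have ti: "0 \<le> t $ i" "t $ i \<le> real N" using t by (auto simp: less_eq_vec_def)
    show ?thesis
    proof (cases "t $ i < real N")
      case True
      have "nat \<lfloor>t $ i\<rfloor> < N" using True ti by linarith
      moreover have "0 \<le> t $ i - real (nat \<lfloor>t $ i\<rfloor>) \<and> t $ i - real (nat \<lfloor>t $ i\<rfloor>) \<le> 1"
        using ti by linarith
      ultimately show ?thesis by blast
    next
      \<comment> \<open>The upper face of the large cube belongs to the last unit cube.\<close>
      case False
      then have "0 \<le> t $ i - real (N - 1) \<and> t $ i - real (N - 1) \<le> 1"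
        using ti N by (simp add: of_nat_diff)
      moreover have "N - 1 < N" using N by simp
      ultimately show ?thesis by blast
    qed
  qed
  then obtain k where "\<forall>i. k i < N \<and> 0 \<le> t $ i - real (k i) \<and> t $ i - real (k i) \<le> 1"
    by metis
  then show ?thesis
    by (intro exI[of _ k]) (auto simp: less_eq_vec_def)
qed

lemma tendsto_ceiling_ratio: "((\<lambda>T::real. real (nat \<lceil>T\<rceil>) / T) \<longlongrightarrow> 1) at_top"
proof (rule real_tendsto_sandwich)
  show "eventually (\<lambda>T::real. 1 \<le> real (nat \<lceil>T\<rceil>) / T) at_top"
    using eventually_gt_at_top[of 0] by eventually_elim (simp add: pos_le_divide_eq real_nat_ceiling_ge)
  show "eventually (\<lambda>T::real. real (nat \<lceil>T\<rceil>) / T \<le> 1 + inverse T) at_top"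
    using eventually_gt_at_top[of 0]
  proof eventually_elim
    case (elim T)
    then have "real (nat \<lceil>T\<rceil>) \<le> T + 1" by linarith
    then have "real (nat \<lceil>T\<rceil>) / T \<le> (T + 1) / T" using elim by (intro divide_right_mono) auto
    then show ?case using elim by (simp add: add_divide_distrib inverse_eq_divide)
  qed
  have "((\<lambda>T::real. 1 + inverse T) \<longlongrightarrow> 1 + 0) at_top"
    by (intro tendsto_intros tendsto_inverse_0_at_top filterlim_ident)
  then show "((\<lambda>T::real. 1 + inverse T) \<longlongrightarrow> 1) at_top" by simp
qed simp

context spectral_tail_field
begin

text \<open>
  By \<open>exceedance_identity\<close> the quantity depends on \<open>K\<close> only through the sets \<open>K - t\<close> with \<open>t \<in> K\<close>.
\<close>

lemma exceedance_shift:
  assumes "\<delta> = 0" and K [measurable]: "K \<in> sets borel" "K \<subseteq> {a..b}" and A [measurable]: "A \<in> sets borel" "0 \<notin> A"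
  shows "exceedance {t. t + p \<in> K} A = exceedance K A"
proof -
  let ?\<phi> = "\<lambda>e. indicator A e / e :: ennreal"
  let ?g = "\<lambda>t. indicator K t * (\<integral>\<^sup>+\<omega>. ?\<phi> (sojourn \<delta> {u. u + t \<in> K} 1 (Y \<omega>)) \<partial>M)"
  have Kp: "{t. t + p \<in> K} \<in> sets borel"
  proof -
    have "(\<lambda>u. u + p) -` K \<inter> space borel \<in> sets borel" by measurable
    then show ?thesis by (simp add: vimage_def)
  qed
  have sub: "{t. t + p \<in> K} \<subseteq> {a - p..b - p}"
    using K(2) by (auto simp: less_eq_vec_def algebra_simps subset_iff)
  have g: "?g \<in> borel_measurable borel"
  proof -
    have "(\<lambda>q. sojourn \<delta> {u. u + fst q \<in> K} 1 (Y (snd q))) \<in> borel_measurable (borel \<Otimes>\<^sub>M M)"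
      by (intro measurable_sojourn_shifted) (auto intro: measurable_compose[OF measurable_snd Y_path])
    then have "(\<lambda>(t, \<omega>). ?\<phi> (sojourn \<delta> {u. u + t \<in> K} 1 (Y \<omega>))) \<in> borel_measurable (borel \<Otimes>\<^sub>M M)"
      unfolding split_beta by measurable
    then have "(\<lambda>t. \<integral>\<^sup>+\<omega>. ?\<phi> (sojourn \<delta> {u. u + t \<in> K} 1 (Y \<omega>)) \<partial>M) \<in> borel_measurable borel"
      by (rule borel_measurable_nn_integral)
    then show ?thesis by measurable
  qed
  have "exceedance {t. t + p \<in> K} A = (\<integral>\<^sup>+t. ?g (t + p) \<partial>lborel)"
    unfolding exceedance_identity[OF Kp sub A]
    by (simp add: grid_floor_def \<open>\<delta> = 0\<close> add.assoc indicator_def)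
  also have "\<dots> = (\<integral>\<^sup>+t. ?g t \<partial>lborel)"
    by (rule nn_integral_lborel_shift[OF g])
  also have "\<dots> = exceedance K A"
    unfolding exceedance_identity[OF K A] by (simp add: grid_floor_def \<open>\<delta> = 0\<close>)
  finally show ?thesis .
qed

text \<open>
  A positive sojourn above \<open>s\<close> forces the supremum over the cube to exceed \<open>s\<close>.
\<close>

lemma exceedance_unit_cube_finite:
  assumes "\<delta> = 0" and sup: "(\<integral>\<^sup>+\<omega>. (SUP t\<in>{0..vec 1}. ennreal (Z \<omega> t)) \<partial>M) < \<infinity>"
  shows "exceedance {0..vec 1} {0<..} < \<infinity>"
proof -
  have "exceedance {0..vec 1} {0<..} = (\<integral>\<^sup>+\<omega>. \<integral>\<^sup>+s. indicator {0..} s * indicator {0<..} (sojourn \<delta> {0..vec 1} s (Z \<omega>)) \<partial>lborel \<partial>M)"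
    by (rule exceedance_alt) auto
  also have "\<dots> \<le> (\<integral>\<^sup>+\<omega>. (SUP t\<in>{0..vec 1}. ennreal (Z \<omega> t)) \<partial>M)"
  proof (rule nn_integral_mono_AE)
    show "AE \<omega> in M. (\<integral>\<^sup>+s. indicator {0..} s * indicator {0<..} (sojourn \<delta> {0..vec 1} s (Z \<omega>)) \<partial>lborel) \<le> (SUP t\<in>{0..vec 1}. ennreal (Z \<omega> t))"
      using AE_regular
    proof eventually_elim
      case (elim \<omega>)
      let ?S = "SUP t\<in>{0..vec 1}. ennreal (Z \<omega> t)"
      have "ennreal s < ?S" if "0 \<le> s" "0 < sojourn \<delta> {0..vec 1} s (Z \<omega>)" for s
      proof (rule ccontr)
        assume "\<not> ennreal s < ?S"
        then have "\<not> s < Z \<omega> u" if "u \<in> {0..vec 1}" for u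
          using SUP_upper[OF that, of "\<lambda>t. ennreal (Z \<omega> t)"] \<open>0 \<le> s\<close>
          by (meson ennreal_less_iff leD leI order_trans order_le_less_trans)
        then have zero: "indicator {0..vec 1} u * indicator {u. s < Z \<omega> u} u = (0 :: ennreal)" for u
          by (simp add: indicator_def)
        have "sojourn \<delta> {0..vec 1} s (Z \<omega>) =
            (\<integral>\<^sup>+t. indicator {0..vec 1} (grid_floor \<delta> t) * indicator {u. s < Z \<omega> u} (grid_floor \<delta> t) \<partial>lborel)"
          using elim \<open>0 \<le> s\<close> by (intro sojourn_right_cts) auto
        then have "sojourn \<delta> {0..vec 1} s (Z \<omega>) = 0"
          unfolding zero by simp
        with that(2) show False by simp
      qed
      then have "(\<integral>\<^sup>+s. indicator {0..} s * indicator {0<..} (sojourn \<delta> {0..vec 1} s (Z \<omega>)) \<partial>lborel)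
        \<le> (\<integral>\<^sup>+s. indicator {0..} s * indicator {s. ennreal s < ?S} s \<partial>lborel)"
        by (intro nn_integral_mono) (auto simp: indicator_def)
      also have "\<dots> \<le> ?S" by (rule nn_integral_below)
      finally show ?case .
    qed
  qed
  also have "\<dots> < \<infinity>" by (rule sup)
  finally show ?thesis .
qed

lemma exceedance_short_tendsto:
  assumes K: "K \<in> sets borel" and fin: "exceedance K {0<..} < \<infinity>"
  shows "(\<lambda>n. exceedance K {0<..ennreal (1 / Suc n)}) \<longlonglongrightarrow> 0"
proof -
  have "(\<lambda>n. exceedance K {0<..ennreal (1 / Suc n)}) \<longlonglongrightarrow> (\<integral>\<^sup>+s. 0 \<partial>(lborel :: real measure))"
    unfolding exceedance_def
  proof (rule nn_integral_dominated_convergence[where w="\<lambda>s. indicator {0..} s * emeasure M {\<omega>\<in>space M. sojourn \<delta> K s (Z \<omega>) \<in> {0<..}}"])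
    let ?e = "\<lambda>n s. emeasure M {\<omega>\<in>space M. sojourn \<delta> K s (Z \<omega>) \<in> {0<..ennreal (1 / Suc n)}}"
    show "(\<integral>\<^sup>+s. indicator {0..} s * emeasure M {\<omega>\<in>space M. sojourn \<delta> K s (Z \<omega>) \<in> {0<..}} \<partial>lborel) < \<infinity>"
      using fin by (simp add: exceedance_def)
    show "AE s in lborel. indicator {0..} s * ?e n s \<le> indicator {0..} s * emeasure M {\<omega>\<in>space M. sojourn \<delta> K s (Z \<omega>) \<in> {0<..}}" for n
      using K by (intro AE_I2 mult_left_mono emeasure_mono exceedance_measurable) auto
    have "(\<lambda>n. ?e n s) \<longlonglongrightarrow> 0" for s
    proof -
      have "(\<lambda>n. ?e n s) \<longlonglongrightarrow> emeasure M (\<Inter>n. {\<omega>\<in>space M. sojourn \<delta> K s (Z \<omega>) \<in> {0<..ennreal (1 / Suc n)}})"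
      proof (rule Lim_emeasure_decseq)
        have "1 / real (Suc n) \<le> 1 / real (Suc m)" if "m \<le> n" for m n
          using that by (intro divide_left_mono) auto
        then show "decseq (\<lambda>n. {\<omega>\<in>space M. sojourn \<delta> K s (Z \<omega>) \<in> {0<..ennreal (1 / Suc n)}})"
          unfolding decseq_def by (auto intro: order_trans ennreal_leI simp del: of_nat_Suc)
        show "range (\<lambda>n. {\<omega>\<in>space M. sojourn \<delta> K s (Z \<omega>) \<in> {0<..ennreal (1 / Suc n)}}) \<subseteq> sets M"
          using K by (auto intro!: exceedance_measurable(1))
      qed simp
      moreover have "(\<Inter>n. {\<omega>\<in>space M. sojourn \<delta> K s (Z \<omega>) \<in> {0<..ennreal (1 / Suc n)}}) = {}"
      proof -
        have "\<exists>n. \<not> e \<le> ennreal (1 / Suc n)" if "0 < e" for e :: ennreal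
        proof (rule ccontr)
          assume "\<not> (\<exists>n. \<not> e \<le> ennreal (1 / Suc n))"
          then have "e \<le> ennreal (inverse (real (Suc n)))" for n
            by (simp add: inverse_eq_divide)
          moreover have "(\<lambda>n. ennreal (inverse (real (Suc n)))) \<longlonglongrightarrow> ennreal 0"
            by (intro tendsto_ennrealI LIMSEQ_inverse_real_of_nat)
          ultimately have "e \<le> ennreal 0"
            by (intro LIMSEQ_le_const) auto
          with that show False by simp
        qed
        then show ?thesis by auto
      qed
      ultimately show ?thesis by simp
    qed
    then have "(\<lambda>n. indicator {0..} s * ?e n s) \<longlonglongrightarrow> 0" for s
      by (cases "0 \<le> s") auto
    then show "AE s in lborel. (\<lambda>n. indicator {0..} s * ?e n s) \<longlonglongrightarrow> 0"
      by simp
  qed (use K in \<open>auto intro!: borel_measurable_times_ennreal exceedance_measurable\<close>)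
  then show ?thesis by simp
qed

text \<open>
  Take a level above which the sojourn in the large cube is positive but at most \<open>x\<close>.  One of the unit cubes that cover
  the large one has a positive sojourn, and it is at most \<open>x\<close> since the unit cube is a part of the large
  one.
\<close>

lemma exceedance_cube_le:
  assumes \<delta>0: "\<delta> = 0" and N: "0 < N"
  shows "exceedance {0..vec (real N)} {0<..} \<le> exceedance {0..vec (real N)} {ennreal x<..} +
    of_nat (N ^ CARD('d)) * exceedance {0..vec 1} {0<..ennreal x}"
proof -
  define I where "I = {k :: 'd \<Rightarrow> nat. \<forall>i. k i < N}"
  have I: "I = (\<Pi>\<^sub>E i\<in>UNIV. {..<N})"
    by (auto simp: I_def PiE_def Pi_def)
  then have fin: "finite I" and card: "card I = N ^ CARD('d)"
    by (auto simp: finite_PiE card_PiE)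
  define Q where "Q k = {t :: real ^ 'd. t + (\<chi> i. - real (k i)) \<in> {0..vec 1}}" for k
  have Q: "Q k \<in> sets borel" for k
  proof -
    have "(\<lambda>t. t + (\<chi> i. - real (k i))) -` {0..vec 1 :: real ^ 'd} \<inter> space borel \<in> sets borel" by measurable
    then show ?thesis by (simp add: Q_def vimage_def)
  qed
  let ?C = "{0..vec (real N)} :: (real ^ 'd) set"
  \<comment> \<open>The index \<open>None\<close> stands for a long sojourn in the large cube, \<open>Some k\<close> for a short one in the unit cube at \<open>k\<close>.\<close>
  let ?L = "\<lambda>i. case i of None \<Rightarrow> ?C | Some k \<Rightarrow> Q k"
  let ?B = "\<lambda>i. case i of None \<Rightarrow> {ennreal x<..} | Some k \<Rightarrow> {0<..ennreal x}"
  have "exceedance ?C {0<..} \<le> (\<Sum>i\<in>insert None (Some ` I). exceedance (?L i) (?B i))"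
  proof (rule exceedance_subadditive)
    fix s and f :: "real ^ 'd \<Rightarrow> real"
    assume "sojourn \<delta> ?C s f \<in> {0<..}"
    then have pos: "0 < sojourn \<delta> ?C s f" by simp
    have sub: "?C \<subseteq> (\<Union>k\<in>I. Q k)"
    proof
      fix t assume "t \<in> ?C"
      from unit_cubes_cover[OF this N] show "t \<in> (\<Union>k\<in>I. Q k)"
        unfolding I_def Q_def by blast
    qed
    have "sojourn \<delta> ?C s f \<le> (\<Sum>k\<in>I. sojourn \<delta> (Q k) s f)"
      by (rule order_trans[OF sojourn_mono[OF sub] sojourn_Union_le[OF fin Q]])
    then have "(\<Sum>k\<in>I. sojourn \<delta> (Q k) s f) \<noteq> 0"
      using pos by auto
    then obtain k where k: "k \<in> I" "sojourn \<delta> (Q k) s f \<noteq> 0"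
      by (meson sum.neutral)
    have "Q k \<subseteq> ?C"
    proof
      fix t assume "t \<in> Q k"
      then have *: "real (k i) \<le> t $ i" "t $ i \<le> real (k i) + 1" for i
        by (auto simp: Q_def less_eq_vec_def algebra_simps)
      have "0 \<le> t $ i \<and> t $ i \<le> real N" for i
      proof -
        have "Suc (k i) \<le> N" using k(1) by (auto simp: I_def Suc_le_eq)
        then have "real (k i) + 1 \<le> real N" by linarith
        then show ?thesis using *[of i] by linarith
      qed
      then show "t \<in> ?C" by (simp add: less_eq_vec_def)
    qed
    then have le: "sojourn \<delta> (Q k) s f \<le> sojourn \<delta> ?C s f"
      by (rule sojourn_mono)
    show "\<exists>i\<in>insert None (Some ` I). sojourn \<delta> (?L i) s f \<in> ?B i"
    proof (cases "ennreal x < sojourn \<delta> ?C s f")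
      case True
      then show ?thesis by simp
    next
      case False
      then have "sojourn \<delta> (Q k) s f \<le> ennreal x"
        using le by (simp add: not_less)
      then have "sojourn \<delta> (?L (Some k)) s f \<in> ?B (Some k)"
        using k(2) by (simp add: zero_less_iff_neq_zero)
      then show ?thesis using k(1) by blast
    qed
  qed (use fin Q in \<open>auto split: option.split\<close>)
  also have "\<dots> = exceedance ?C {ennreal x<..} + (\<Sum>k\<in>I. exceedance (Q k) {0<..ennreal x})"
    using fin by (subst sum.insert) (auto simp: sum.reindex)
  also have "(\<Sum>k\<in>I. exceedance (Q k) {0<..ennreal x}) = (\<Sum>k\<in>I. exceedance {0..vec 1} {0<..ennreal x})"
    unfolding Q_def by (intro sum.cong refl exceedance_shift[OF \<delta>0, where a=0 and b="vec 1"]) auto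
  finally show ?thesis by (simp add: card)
qed

lemma sojourn_moment_mono: "x \<le> y \<Longrightarrow> sojourn_moment y \<le> sojourn_moment x"
  unfolding sojourn_moment_def reciprocal_above_def
  by (intro nn_integral_mono divide_right_mono_ennreal) (auto dest: ennreal_leI order_le_less_trans)

text \<open>
  As the level decreases to zero, the weights increase to the weight at level zero.
\<close>

lemma sojourn_moment_0_le:
  assumes "\<And>n. sojourn_moment (1 / Suc n) \<le> C"
  shows "sojourn_moment 0 \<le> C"
proof -
  have "reciprocal_above 0 e \<le> liminf (\<lambda>n. reciprocal_above (1 / Suc n) e)" for e
  proof (cases "0 < e")
    case True
    have "(\<lambda>n. ennreal (inverse (real (Suc n)))) \<longlonglongrightarrow> ennreal 0"
      by (intro tendsto_ennrealI LIMSEQ_inverse_real_of_nat)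
    then have "eventually (\<lambda>n. ennreal (1 / Suc n) < e) sequentially"
      using True by (intro order_tendstoD) (auto simp: inverse_eq_divide)
    then have "eventually (\<lambda>n. reciprocal_above (1 / Suc n) e = reciprocal_above 0 e) sequentially"
      by eventually_elim (use True in \<open>simp add: reciprocal_above_def\<close>)
    then have "(\<lambda>n. reciprocal_above (1 / Suc n) e) \<longlonglongrightarrow> reciprocal_above 0 e"
      by (rule tendsto_eventually)
    then have "liminf (\<lambda>n. reciprocal_above (1 / Suc n) e) = reciprocal_above 0 e"
      by (intro lim_imp_Liminf) auto
    then show ?thesis by simp
  qed (simp add: reciprocal_above_def)
  then have "sojourn_moment 0 \<le> (\<integral>\<^sup>+\<omega>. liminf (\<lambda>n. reciprocal_above (1 / Suc n) (sojourn \<delta> UNIV 1 (Y \<omega>))) \<partial>M)"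
    unfolding sojourn_moment_def by (intro nn_integral_mono)
  also have "\<dots> \<le> liminf (\<lambda>n. sojourn_moment (1 / Suc n))"
    unfolding sojourn_moment_def by (rule nn_integral_liminf) measurable
  also have "\<dots> \<le> limsup (\<lambda>n. sojourn_moment (1 / Suc n))"
    by (rule Liminf_le_Limsup) simp
  also have "\<dots> \<le> C"
    by (intro Limsup_bounded always_eventually allI assms)
  finally show ?thesis .
qed

text \<open>
  With \<open>B\<^sub>x\<close> the limit at a level \<open>x > 0\<close>, the averages at level zero are asymptotically between \<open>B\<^sub>x\<close> and
  \<open>B\<^sub>x + c(x)\<close>, where \<open>c(x)\<close> is the contribution of a single unit cube; then let \<open>x\<close> tend to \<open>0\<close>.  Rounding \<open>T\<close> up to an
  integer, so that unit cubes tile the cube, costs a factor that tends to one.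
\<close>

lemma berman_average_pickands:
  assumes \<delta>0: "\<delta> = 0" and sup: "(\<integral>\<^sup>+\<omega>. (SUP t\<in>{0..vec 1}. ennreal (Z \<omega> t)) \<partial>M) < \<infinity>"
  shows "(berman_average M Z \<delta> 0 \<longlongrightarrow> sojourn_moment 0) at_top" and "sojourn_moment 0 < \<infinity>"
proof -
  define c where "c n = exceedance {0..vec 1} {0<..ennreal (1 / Suc n)}" for n
  have Q: "exceedance {0..vec 1} {0<..} < \<infinity>"
    by (rule exceedance_unit_cube_finite) fact+
  have c_fin: "c n < \<infinity>" for n
  proof -
    have "c n \<le> (\<Sum>i\<in>{()}. exceedance {0..vec 1} {0<..})"
      unfolding c_def by (rule exceedance_subadditive) auto
    then show ?thesis using Q by (simp add: order_le_less_trans)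
  qed
  have c_lim: "c \<longlonglongrightarrow> 0"
    unfolding c_def using Q by (intro exceedance_short_tendsto) auto
  have fin: "sojourn_moment (1 / Suc n) < \<infinity>" for n
    by (rule sojourn_moment_finite) auto
  have lim: "(berman_average M Z \<delta> (1 / Suc n) \<longlongrightarrow> sojourn_moment (1 / Suc n)) at_top" for n
    by (rule berman_average_tendsto_bounded) auto
  define r where "r T = real (nat \<lceil>T\<rceil>)" for T :: real
  have r_top: "filterlim r at_top at_top"
    unfolding r_def
    by (rule filterlim_at_top_mono[OF filterlim_ident]) (auto simp: real_nat_ceiling_ge)
  have upper: "berman_average M Z \<delta> 0 T \<le> ennreal ((r T / T) ^ CARD('d)) * (berman_average M Z \<delta> (1 / Suc n) (r T) + c n)"
    if T: "1 \<le> T" for T n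
  proof -
    define N where "N = nat \<lceil>T\<rceil>"
    have N: "0 < N" "T \<le> real N" "r T = real N"
      using T unfolding N_def r_def by linarith+
    have "exceedance {0..vec T} {0<..} \<le> (\<Sum>i\<in>{()}. exceedance {0..vec (real N)} {0<..})"
    proof (rule exceedance_subadditive)
      fix s and f :: "real ^ 'd \<Rightarrow> real" assume "sojourn \<delta> {0..vec T} s f \<in> {0<..}"
      moreover have "sojourn \<delta> {0..vec T} s f \<le> sojourn \<delta> {0..vec (real N)} s f"
        using N(2) by (intro sojourn_mono) (auto simp: less_eq_vec_def intro: order_trans)
      ultimately show "\<exists>i\<in>{()}. sojourn \<delta> {0..vec (real N)} s f \<in> {0<..}" by auto
    qed auto
    also have "\<dots> \<le> exceedance {0..vec (real N)} {ennreal (1 / Suc n)<..} + of_nat (N ^ CARD('d)) * c n"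
      unfolding c_def using exceedance_cube_le[OF \<delta>0 N(1), of "1 / Suc n"] by simp
    also have "\<dots> = ennreal (real N ^ CARD('d)) * (berman_average M Z \<delta> (1 / Suc n) (r T) + c n)"
    proof -
      have "ennreal (real N ^ CARD('d)) * berman_average M Z \<delta> (1 / Suc n) (r T) = exceedance {0..vec (real N)} {ennreal (1 / Suc n)<..}"
        unfolding berman_average_eq N(3) using N(1)
        by (simp add: mult.assoc[symmetric] ennreal_mult[symmetric])
      moreover have "ennreal (real N ^ CARD('d)) = of_nat (N ^ CARD('d))"
        by (simp add: ennreal_of_nat_eq_real_of_nat)
      ultimately show ?thesis by (simp only: distrib_left)
    qed
    finally have "ennreal (1 / T ^ CARD('d)) * exceedance {0..vec T} {0<..} \<le>
        ennreal (1 / T ^ CARD('d)) * (ennreal (real N ^ CARD('d)) * (berman_average M Z \<delta> (1 / Suc n) (r T) + c n))"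
      by (rule mult_left_mono) simp
    also have "\<dots> = ennreal ((r T / T) ^ CARD('d)) * (berman_average M Z \<delta> (1 / Suc n) (r T) + c n)"
      using T by (simp add: mult.assoc[symmetric] ennreal_mult[symmetric] N(3) power_divide)
    finally show ?thesis by (simp add: berman_average_eq)
  qed
  have limsup: "Limsup at_top (berman_average M Z \<delta> 0) \<le> sojourn_moment (1 / Suc n) + c n" for n
  proof -
    have "((\<lambda>T. berman_average M Z \<delta> (1 / Suc n) (r T)) \<longlongrightarrow> sojourn_moment (1 / Suc n)) at_top"
      by (rule filterlim_compose[OF lim r_top])
    then have a: "((\<lambda>T. berman_average M Z \<delta> (1 / Suc n) (r T) + c n) \<longlongrightarrow> sojourn_moment (1 / Suc n) + c n) at_top"
      by (intro tendsto_add tendsto_const)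
    have "((\<lambda>T. ennreal ((r T / T) ^ CARD('d))) \<longlongrightarrow> ennreal (1 ^ CARD('d))) at_top"
      unfolding r_def by (intro tendsto_ennrealI tendsto_power tendsto_ceiling_ratio)
    then have b: "((\<lambda>T. ennreal ((r T / T) ^ CARD('d))) \<longlongrightarrow> 1) at_top"
      by simp
    have "((\<lambda>T. ennreal ((r T / T) ^ CARD('d)) * (berman_average M Z \<delta> (1 / Suc n) (r T) + c n)) \<longlongrightarrow>
        1 * (sojourn_moment (1 / Suc n) + c n)) at_top"
      using fin[of n] c_fin[of n] by (intro tendsto_mult_ennreal a b) auto
    then have "Limsup at_top (\<lambda>T. ennreal ((r T / T) ^ CARD('d)) * (berman_average M Z \<delta> (1 / Suc n) (r T) + c n)) = sojourn_moment (1 / Suc n) + c n"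
      by (intro lim_imp_Limsup) auto
    moreover have "Limsup at_top (berman_average M Z \<delta> 0) \<le>
        Limsup at_top (\<lambda>T. ennreal ((r T / T) ^ CARD('d)) * (berman_average M Z \<delta> (1 / Suc n) (r T) + c n))"
      by (intro Limsup_mono eventually_mono[OF eventually_ge_at_top[of 1]] upper)
    ultimately show ?thesis by simp
  qed
  have lower: "sojourn_moment (1 / Suc n) \<le> Liminf at_top (berman_average M Z \<delta> 0)" for n
  proof -
    have "berman_average M Z \<delta> (1 / Suc n) T \<le> berman_average M Z \<delta> 0 T" for T
    proof -
      have "exceedance {0..vec T} {ennreal (1 / Suc n)<..} \<le> (\<Sum>i\<in>{()}. exceedance {0..vec T} {ennreal 0<..})"
        by (rule exceedance_subadditive) (auto intro: le_less_trans[rotated])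
      then show ?thesis
        unfolding berman_average_eq by (intro mult_left_mono) auto
    qed
    then have "Liminf at_top (berman_average M Z \<delta> (1 / Suc n)) \<le> Liminf at_top (berman_average M Z \<delta> 0)"
      by (intro Liminf_mono always_eventually allI)
    moreover have "Liminf at_top (berman_average M Z \<delta> (1 / Suc n)) = sojourn_moment (1 / Suc n)"
      by (rule lim_imp_Liminf[OF _ lim]) simp
    ultimately show ?thesis by simp
  qed
  have lower0: "sojourn_moment 0 \<le> Liminf at_top (berman_average M Z \<delta> 0)"
    by (rule sojourn_moment_0_le[OF lower])
  have upper0: "Limsup at_top (berman_average M Z \<delta> 0) \<le> sojourn_moment 0"
  proof -
    have "(\<lambda>n. sojourn_moment 0 + c n) \<longlonglongrightarrow> sojourn_moment 0 + 0"
      by (intro tendsto_add tendsto_const c_lim)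
    moreover have "Limsup at_top (berman_average M Z \<delta> 0) \<le> sojourn_moment 0 + c n" for n
      using limsup[of n] sojourn_moment_mono[of 0 "1 / Suc n"] by (meson add_right_mono divide_nonneg_nonneg of_nat_0_le_iff order_trans zero_le_one)
    ultimately have "Limsup at_top (berman_average M Z \<delta> 0) \<le> sojourn_moment 0 + 0"
      by (intro LIMSEQ_le_const) auto
    then show ?thesis by simp
  qed
  show "(berman_average M Z \<delta> 0 \<longlongrightarrow> sojourn_moment 0) at_top"
    by (rule tendsto_le_Liminf_Limsup_le[OF _ lower0 upper0]) simp
  have "sojourn_moment 0 \<le> Limsup at_top (berman_average M Z \<delta> 0)"
    using lower0 Liminf_le_Limsup[of at_top "berman_average M Z \<delta> 0"] by (simp add: order_trans)
  also have "\<dots> \<le> sojourn_moment (1 / Suc 0) + c 0"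
    by (rule limsup)
  also have "\<dots> < \<infinity>"
    using fin[of 0] c_fin[of 0] by simp
  finally show "sojourn_moment 0 < \<infinity>" .
qed

lemma sojourn_moment_eq:
  "sojourn_moment x = (\<integral>\<^sup>+\<omega>. (if sojourn_above_one \<delta> (Y \<omega>) > ennreal x then 1 else 0) / sojourn_above_one \<delta> (Y \<omega>) \<partial>M)"
proof -
  have "sojourn \<delta> UNIV 1 (Y \<omega>) = sojourn_above_one \<delta> (Y \<omega>)" if "\<omega> \<in> space M" for \<omega>
  proof -
    have "right_cts (Y \<omega>)"
      unfolding Y_eq[abs_def] by (intro right_cts_mult right_cts_cadlag \<Theta>_cadlag that)
    then show ?thesis
      unfolding sojourn_above_one_def nn_integral_grid_measure[OF \<delta>] by (simp add: sojourn_right_cts)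
  qed
  then show ?thesis
    unfolding sojourn_moment_def by (intro nn_integral_cong) (simp add: reciprocal_above_def)
qed

end

theorem theorem2p5:
  fixes M :: "'a measure"
    and Z :: "'a \<Rightarrow> real ^ 'd \<Rightarrow> real"
    and V :: "nat \<Rightarrow> 'a \<Rightarrow> real"
    and C :: "nat \<Rightarrow> 'a \<Rightarrow> real ^ 'd \<Rightarrow> real"
    and \<Theta> :: "'a \<Rightarrow> real ^ 'd \<Rightarrow> real"
    and R :: "'a \<Rightarrow> real"
    and Y :: "'a \<Rightarrow> real ^ 'd \<Rightarrow> real"
    and \<delta> x :: real
  assumes "prob_space M" and "complete_measure M" and "non_atomic M"
    and "cadlag_field M Z"
    and Z_mean: "\<And>t. (\<integral>\<omega>. Z \<omega> t \<partial>M) = 1"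
    and Z_sup: "\<And>T. T > 0 \<Longrightarrow> (\<integral>\<^sup>+\<omega>. (SUP t\<in>{0..vec T}. ennreal (Z \<omega> t)) \<partial>M) < \<infinity>"
    and Z_pos: "AE \<omega> in M. (SUP t. ennreal (Z \<omega> t)) > 0"
    and "max_stable_ingredients M V C Z"
    and X_stationary: "stationary_field M (max_stable_field V C)"
    and \<Theta>_meas: "\<Theta> \<in> M \<rightarrow>\<^sub>M cadlag_measurable_space"
    and \<Theta>_law: "\<And>A. A \<in> sets cadlag_measurable_space \<Longrightarrow>
      measure M {\<omega>\<in>space M. \<Theta> \<omega> \<in> A} =
      (\<integral>\<omega>. Z \<omega> 0 * indicator A (\<lambda>t. Z \<omega> t / Z \<omega> 0) \<partial>M)"
    and R_indep: "independent_elements M borel R cadlag_measurable_space \<Theta>"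
    and R_law: "\<And>r. r \<ge> 1 \<Longrightarrow> measure M {\<omega>\<in>space M. R \<omega> > r} = 1 / r"
    and Y_eq: "\<And>\<omega> t. Y \<omega> t = R \<omega> * \<Theta> \<omega> t"
    and "\<delta> \<ge> 0" and "x \<ge> 0"
    and S_pos: "AE \<omega> in M. total_mass \<delta> (Z \<omega>) > 0"
    and S_0: "measure M {\<omega>\<in>space M. total_mass 0 (Z \<omega>) = \<infinity>} < 1"
  shows "(berman_average M Z \<delta> x \<longlongrightarrow> berman M Z \<delta> x) at_top
    \<and> berman M Z \<delta> x =
        (\<integral>\<^sup>+\<omega>. (if sojourn_above_one \<delta> (Y \<omega>) > ennreal x then 1 else 0)
               / sojourn_above_one \<delta> (Y \<omega>) \<partial>M)
    \<and> (\<integral>\<^sup>+\<omega>. (if sojourn_above_one \<delta> (Y \<omega>) > ennreal x then 1 else 0)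
               / sojourn_above_one \<delta> (Y \<omega>) \<partial>M) < \<infinity>"
proof -
  have Z: "Z \<in> M \<rightarrow>\<^sub>M path_space" and AE: "AE \<omega> in M. Z \<omega> \<in> cadlag_space"
    using \<open>cadlag_field M Z\<close> by (auto simp: cadlag_field_def)
  have nonneg: "AE \<omega> in M. 0 \<le> Z \<omega> t" for t
    using AE by eventually_elim (simp add: cadlag_space_def)
  have int: "integrable M (\<lambda>\<omega>. Z \<omega> t)" for t
    using Z_mean[of t] not_integrable_integral_eq by fastforce
  have shift: "spectral_law M Z h = spectral_law M Z 0" for h
    by (rule spectral_law_shift) fact+
  interpret spectral_tail_field M Z \<Theta> Y R \<delta>
    unfolding spectral_tail_field_def spectral_tail_field_axioms_def
    by (intro conjI allI impI shift) (fact | rule assms)+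
  have "(berman_average M Z \<delta> x \<longlongrightarrow> sojourn_moment x) at_top \<and> sojourn_moment x < \<infinity>"
  proof (cases "0 < x \<or> 0 < \<delta>")
    case True
    then show ?thesis
      using berman_average_tendsto_bounded sojourn_moment_finite \<open>0 \<le> x\<close> by blast
  next
    case False
    then have "x = 0" "\<delta> = 0" using \<open>0 \<le> x\<close> \<open>0 \<le> \<delta>\<close> by auto
    then show ?thesis
      using berman_average_pickands[OF _ Z_sup[of 1]] by simp
  qed
  moreover from this have "berman M Z \<delta> x = sojourn_moment x"
    unfolding berman_def by (intro tendsto_Lim) auto
  ultimately show ?thesis
    by (simp add: sojourn_moment_eq)
qed

end
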